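(* Let $(M,I,J,K,g_M)$ be a hyperkähler manifold, $(N,g_N)$ a Riemannian manifold, and $F:(M,g_M)\to(N,g_N)$ a h-anti-invariant submersion such that $(I,J,K)$ is a h-anti-invariant basis, i.e. $F$ is a Riemannian submersion with $R(\ker F_* )\subset(\ker F_* )^{\perp}$ for each $R\in\{I,J,K\}$. Then the following conditions are equivalent: a) $F$ is harmonic; b) $Q_I(\mathrm{trace}(\mathcal{T}))=0$ on $\ker F_*$, and $\mathrm{trace}(I\mathcal{T}_V)=0$ on $\ker F_*$ for all $V\in\Gamma(\ker F_* )$; c) $Q_J(\mathrm{trace}(\mathcal{T}))=0$ on $\ker F_*$, and $\mathrm{trace}(J\mathcal{T}_V)=0$ on $\ker F_*$ for all $V\in\Gamma(\ker F_* )$; d) $Q_K(\mathrm{trace}(\mathcal{T}))=0$ on $\ker F_*$, and $\mathrm{trace}(K\mathcal{T}_V)=0$ on $\ker F_*$ for all $V\in\Gamma(\ker F_* )$.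
   Context: A hyperkähler manifold $(M,I,J,K,g_M)$ is a $4m$-dimensional Riemannian manifold with endomorphism fields $I,J,K$ of $TM$ satisfying $I^2=J^2=K^2=-\mathrm{id}$, $IJ=-JI=K$, $JK=-KJ=I$, $KI=-IK=J$, $g_M(RX,RY)=g_M(X,Y)$ for $R\in\{I,J,K\}$, and $\nabla I=\nabla J=\nabla K=0$, where $\nabla$ is the Levi-Civita connection of $g_M$. A Riemannian submersion $F:(M,g_M)\to(N,g_N)$ is a smooth surjective submersion such that $(F_* )_p:(\ker (F_* )_p)^{\perp}\to T_{F(p)}N$ is a linear isometry for every $p\in M$. For a vector field $U$ on $M$ write $U=\mathcal{V}U+\mathcal{H}U$ with $\mathcal{V}U\in\Gamma(\ker F_* )$ and $\mathcal{H}U\in\Gamma((\ker F_* )^{\perp})$. The O'Neill tensor $\mathcal{T}$ is $$\mathcal{T}_U W=\mathcal{H}\nabla_{\mathcal{V}U}\mathcal{V}W+\mathcal{V}\nabla_{\mathcal{V}U}\mathcal{H}W .$$ For $R\in\{I,J,K\}$ let $\mu_R$ be the orthogonal complement of $R(\ker F_* )$ in $(\ker F_* )^{\perp}$, so $(\ker F_* )^{\perp}=R(\ker F_* )\oplus\mu_R$, and let $Q_R:(\ker F_* )^{\perp}\to\mu_R$ be the orthogonal projection. For a local orthonormal frame $\{e_1,\dots,e_k\}$ of $\ker F_*$, the trace of $\mathcal{T}$ on $\ker F_*$ is $\mathrm{trace}(\mathcal{T})=\sum_{i=1}^k\mathcal{T}_{e_i}e_i$ (a section of $(\ker F_* )^{\perp}$),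 and the trace of $R\mathcal{T}_V$ on $\ker F_*$ is $\mathrm{trace}(R\mathcal{T}_V)=\sum_{i=1}^k g_M(R\mathcal{T}_Ve_i,e_i)$. The second fundamental form of $F$ is $(\nabla F_* )(U,W)=\nabla^F_U F_*W-F_*(\nabla_UW)$ for $U,W\in\Gamma(TM)$, where $\nabla^F$ is the pullback connection along $F$; $F$ is harmonic if and only if the trace of $\nabla F_*$ with respect to $g_M$ vanishes. *)

theory Defs
  imports "HOL-Analysis.Analysis" "HOL-Library.Function_Algebras"
begin

subsection \<open>Real functions as a vector space\<close>

text \<open>Tangent vectors are represented below as functionals on functions, so that the tangent
  spaces are subspaces of a function space with pointwise operations.\<close>

instantiation "fun" :: (type, scaleR) scaleR
begin

definition scaleR_fun :: "real \<Rightarrow> ('a \<Rightarrow> 'b) \<Rightarrow> 'a \<Rightarrow> 'b" where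
  "scaleR_fun c f = (\<lambda>x. c *\<^sub>R f x)"

instance ..

end

lemma scaleR_fun_apply [simp]: "(c *\<^sub>R f) x = c *\<^sub>R f x"
  by (simp add: scaleR_fun_def)

instance "fun" :: (type, real_vector) real_vector
  by standard (simp_all add: fun_eq_iff scaleR_add_right scaleR_add_left)


subsection \<open>Smooth functions on open subsets of Euclidean spaces\<close>

primrec C_k_on :: "nat \<Rightarrow> 'e::euclidean_space set \<Rightarrow> ('e \<Rightarrow> 'f::real_normed_vector) \<Rightarrow> bool" where
  "C_k_on 0 S f \<longleftrightarrow> continuous_on S f"
| "C_k_on (Suc k) S f \<longleftrightarrow>
     f differentiable_on S \<and> (\<forall>u. C_k_on k S (\<lambda>x. frechet_derivative f (at x) u))"

definition smooth_on :: "'e::euclidean_space set \<Rightarrow> ('e \<Rightarrow> 'f::real_normed_vector) \<Rightarrow> bool" where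
  "smooth_on S f \<longleftrightarrow> (\<forall>k. C_k_on k S f)"


subsection \<open>Smooth manifolds\<close>

text \<open>A manifold is a type with its topology, together with an atlas of charts \<open>(U, \<phi>)\<close>.
  Only the values of \<open>\<phi>\<close> on \<open>U\<close> matter. The atlas need not be maximal.\<close>

type_synonym ('m, 'e) chart = "'m set \<times> ('m \<Rightarrow> 'e)"
type_synonym ('m, 'e) atlas = "('m, 'e) chart set"

definition is_chart :: "('m::topological_space, 'e::euclidean_space) chart \<Rightarrow> bool" where
  "is_chart = (\<lambda>(U, \<phi>). open U \<and> open (\<phi> ` U) \<and> homeomorphism U (\<phi> ` U) \<phi> (inv_into U \<phi>))"

definition smooth_manifold ::
    "('m::{t2_space, second_countable_topology}, 'e::euclidean_space) atlas \<Rightarrow> bool" where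
  "smooth_manifold A \<longleftrightarrow>
     (\<forall>c\<in>A. is_chart c) \<and>
     (\<Union>(U, \<phi>)\<in>A. U) = UNIV \<and>
     (\<forall>(U, \<phi>)\<in>A. \<forall>(V, \<psi>)\<in>A. smooth_on (\<phi> ` (U \<inter> V)) (\<psi> \<circ> inv_into U \<phi>))"

definition smooth_fun ::
    "('m::topological_space, 'e::euclidean_space) atlas \<Rightarrow> 'm set \<Rightarrow> ('m \<Rightarrow> real) \<Rightarrow> bool" where
  "smooth_fun A W f \<longleftrightarrow> (\<forall>(U, \<phi>)\<in>A. smooth_on (\<phi> ` (U \<inter> W)) (f \<circ> inv_into U \<phi>))"

definition smooth_near ::
    "('m::topological_space, 'e::euclidean_space) atlas \<Rightarrow> 'm \<Rightarrow> ('m \<Rightarrow> real) \<Rightarrow> bool" where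
  "smooth_near A p f \<longleftrightarrow> (\<exists>W. open W \<and> p \<in> W \<and> smooth_fun A W f)"

definition smooth_map ::
    "('m::topological_space, 'e::euclidean_space) atlas \<Rightarrow>
     ('n::topological_space, 'f::euclidean_space) atlas \<Rightarrow> ('m \<Rightarrow> 'n) \<Rightarrow> bool" where
  "smooth_map A B F \<longleftrightarrow>
     continuous_on UNIV F \<and>
     (\<forall>(U, \<phi>)\<in>A. \<forall>(V, \<psi>)\<in>B. smooth_on (\<phi> ` (U \<inter> F -` V)) (\<psi> \<circ> F \<circ> inv_into U \<phi>))"


subsection \<open>Tangent vectors and vector fields\<close>

text \<open>A tangent vector at \<open>p\<close> is a directional derivative operator acting on the functions that are
  smooth near \<open>p\<close>; in a chart it is a linear combination of the coordinate derivatives at \<open>p\<close>.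
  Setting it to \<open>0\<close> on all other functions makes equality of tangent vectors the equality
  of functionals.\<close>

type_synonym 'm tvec = "('m \<Rightarrow> real) \<Rightarrow> real"

definition dir_deriv ::
    "('m::topological_space, 'e::euclidean_space) atlas \<Rightarrow> ('m, 'e) chart \<Rightarrow> 'm \<Rightarrow> 'e \<Rightarrow> 'm tvec" where
  "dir_deriv A c p u = (\<lambda>f.
     if smooth_near A p f
     then frechet_derivative (f \<circ> inv_into (fst c) (snd c)) (at (snd c p)) u else 0)"

definition tangent_space ::
    "('m::topological_space, 'e::euclidean_space) atlas \<Rightarrow> 'm \<Rightarrow> 'm tvec set" where
  "tangent_space A p = {dir_deriv A c p u | c u. c \<in> A \<and> p \<in> fst c}"

definition differential ::
    "('n::topological_space, 'f::euclidean_space) atlas \<Rightarrow> ('m \<Rightarrow> 'n) \<Rightarrow> 'm \<Rightarrow> 'm tvec \<Rightarrow> 'n tvec" where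
  "differential B F p v = (\<lambda>f. if smooth_near B (F p) f then v (f \<circ> F) else 0)"

text \<open>Smooth sections over the open set \<open>W\<close> of the pullback bundle along \<open>F\<close>, that is, vector
  fields along \<open>F\<close>. Fields are total functions, of which only the values on \<open>W\<close> matter.
  Vector fields on the manifold itself are the case in which \<open>F\<close> is the identity.\<close>

definition fields_along ::
    "('m::topological_space, 'e::euclidean_space) atlas \<Rightarrow>
     ('n::topological_space, 'f::euclidean_space) atlas \<Rightarrow>
     ('m \<Rightarrow> 'n) \<Rightarrow> 'm set \<Rightarrow> ('m \<Rightarrow> 'n tvec) set" where
  "fields_along A B F W = {Z.
     (\<forall>p\<in>W. Z p \<in> tangent_space B (F p)) \<and>
     (\<forall>O' f. open O' \<longrightarrow> smooth_fun B O' f \<longrightarrow> smooth_fun A (W \<inter> F -` O') (\<lambda>p. Z p f))}"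

abbreviation vector_fields ::
    "('m::topological_space, 'e::euclidean_space) atlas \<Rightarrow> 'm set \<Rightarrow> ('m \<Rightarrow> 'm tvec) set" where
  "vector_fields A W \<equiv> fields_along A A (\<lambda>p. p) W"

definition sections ::
    "('m::topological_space, 'e::euclidean_space) atlas \<Rightarrow> ('m \<Rightarrow> 'm tvec set) \<Rightarrow> 'm set \<Rightarrow>
     ('m \<Rightarrow> 'm tvec) set" where
  "sections A E W = {X \<in> vector_fields A W. \<forall>p\<in>W. X p \<in> E p}"

definition lie_bracket ::
    "('m::topological_space, 'e::euclidean_space) atlas \<Rightarrow> ('m \<Rightarrow> 'm tvec) \<Rightarrow> ('m \<Rightarrow> 'm tvec) \<Rightarrow>
     'm \<Rightarrow> 'm tvec" where
  "lie_bracket A X Y p = (\<lambda>f.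
     if smooth_near A p f then X p (\<lambda>q. Y q f) - Y p (\<lambda>q. X q f) else 0)"

definition linear_on_subspace :: "'a::real_vector set \<Rightarrow> ('a \<Rightarrow> 'b::real_vector) \<Rightarrow> bool" where
  "linear_on_subspace S L \<longleftrightarrow>
     (\<forall>v\<in>S. \<forall>w\<in>S. L (v + w) = L v + L w) \<and> (\<forall>c. \<forall>v\<in>S. L (c *\<^sub>R v) = c *\<^sub>R L v)"

definition endomorphism_field ::
    "('m::topological_space, 'e::euclidean_space) atlas \<Rightarrow> ('m \<Rightarrow> 'm tvec \<Rightarrow> 'm tvec) \<Rightarrow> bool" where
  "endomorphism_field A R \<longleftrightarrow>
     (\<forall>p. linear_on_subspace (tangent_space A p) (R p) \<and>
          R p ` tangent_space A p \<subseteq> tangent_space A p) \<and>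
     (\<forall>W X. open W \<longrightarrow> X \<in> vector_fields A W \<longrightarrow> (\<lambda>p. R p (X p)) \<in> vector_fields A W)"


subsection \<open>Riemannian metrics and connections\<close>

type_synonym 'm metric = "'m \<Rightarrow> 'm tvec \<Rightarrow> 'm tvec \<Rightarrow> real"

definition riemannian_metric ::
    "('m::topological_space, 'e::euclidean_space) atlas \<Rightarrow> 'm metric \<Rightarrow> bool" where
  "riemannian_metric A g \<longleftrightarrow>
     (\<forall>p. \<forall>w\<in>tangent_space A p. linear_on_subspace (tangent_space A p) (\<lambda>v. g p v w)) \<and>
     (\<forall>p. \<forall>v\<in>tangent_space A p. \<forall>w\<in>tangent_space A p. g p v w = g p w v) \<and>
     (\<forall>p. \<forall>v\<in>tangent_space A p. v \<noteq> 0 \<longrightarrow> g p v v > 0) \<and>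
     (\<forall>W X Y. open W \<longrightarrow> X \<in> vector_fields A W \<longrightarrow> Y \<in> vector_fields A W \<longrightarrow>
        smooth_fun A W (\<lambda>p. g p (X p) (Y p)))"

definition riemannian_manifold ::
    "('m::{t2_space, second_countable_topology}, 'e::euclidean_space) atlas \<Rightarrow> 'm metric \<Rightarrow> bool" where
  "riemannian_manifold A g \<longleftrightarrow> smooth_manifold A \<and> riemannian_metric A g"

text \<open>\<open>D p v Z\<close> is the covariant derivative at \<open>p\<close> of the field \<open>Z\<close> along \<open>F\<close> in the direction of
  the tangent vector \<open>v\<close> at \<open>p\<close>. Fields defined on open subsets are allowed; the third condition says
  that \<open>D p v Z\<close> only depends on the restriction of \<open>Z\<close> to any open neighbourhood of \<open>p\<close>.
  Affine connections are the case in which \<open>F\<close> is the identity.\<close>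

type_synonym ('m, 'n) connection = "'m \<Rightarrow> 'm tvec \<Rightarrow> ('m \<Rightarrow> 'n tvec) \<Rightarrow> 'n tvec"

definition connection_along ::
    "('m::topological_space, 'e::euclidean_space) atlas \<Rightarrow>
     ('n::topological_space, 'f::euclidean_space) atlas \<Rightarrow>
     ('m \<Rightarrow> 'n) \<Rightarrow> ('m, 'n) connection \<Rightarrow> bool" where
  "connection_along A B F D \<longleftrightarrow> (\<forall>W. open W \<longrightarrow>
     (\<forall>X\<in>vector_fields A W. \<forall>Z\<in>fields_along A B F W.
        (\<lambda>p. D p (X p) Z) \<in> fields_along A B F W) \<and>
     (\<forall>p\<in>W. \<forall>Z\<in>fields_along A B F W.
        (\<forall>v\<in>tangent_space A p. D p v Z \<in> tangent_space B (F p)) \<and>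
        linear_on_subspace (tangent_space A p) (\<lambda>v. D p v Z)) \<and>
     (\<forall>p\<in>W. \<forall>v\<in>tangent_space A p. \<forall>Z\<in>fields_along A B F W. \<forall>Z'\<in>fields_along A B F W.
        (\<forall>q\<in>W. Z q = Z' q) \<longrightarrow> D p v Z = D p v Z') \<and>
     (\<forall>p\<in>W. \<forall>v\<in>tangent_space A p. \<forall>Z\<in>fields_along A B F W. \<forall>Z'\<in>fields_along A B F W.
        D p v (\<lambda>q. Z q + Z' q) = D p v Z + D p v Z') \<and>
     (\<forall>p\<in>W. \<forall>v\<in>tangent_space A p. \<forall>Z\<in>fields_along A B F W. \<forall>f. smooth_fun A W f \<longrightarrow>
        D p v (\<lambda>q. f q *\<^sub>R Z q) = v f *\<^sub>R Z p + f p *\<^sub>R D p v Z))"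

definition levi_civita ::
    "('m::topological_space, 'e::euclidean_space) atlas \<Rightarrow> 'm metric \<Rightarrow> ('m, 'm) connection \<Rightarrow> bool" where
  "levi_civita A g D \<longleftrightarrow>
     connection_along A A (\<lambda>p. p) D \<and>
     (\<forall>W. open W \<longrightarrow>
        (\<forall>p\<in>W. \<forall>v\<in>tangent_space A p. \<forall>Y\<in>vector_fields A W. \<forall>Z\<in>vector_fields A W.
           v (\<lambda>q. g q (Y q) (Z q)) = g p (D p v Y) (Z p) + g p (Y p) (D p v Z)) \<and>
        (\<forall>p\<in>W. \<forall>X\<in>vector_fields A W. \<forall>Y\<in>vector_fields A W.
           D p (X p) Y - D p (Y p) X = lie_bracket A X Y p))"

definition parallel ::
    "('m::topological_space, 'e::euclidean_space) atlas \<Rightarrow> ('m, 'm) connection \<Rightarrow>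
     ('m \<Rightarrow> 'm tvec \<Rightarrow> 'm tvec) \<Rightarrow> bool" where
  "parallel A D R \<longleftrightarrow> (\<forall>W. open W \<longrightarrow>
     (\<forall>p\<in>W. \<forall>v\<in>tangent_space A p. \<forall>Y\<in>vector_fields A W.
        D p v (\<lambda>q. R q (Y q)) - R p (D p v Y) = 0))"

text \<open>The connection \<open>DF\<close> on the pullback bundle along \<open>F\<close> induced by the connection \<open>DN\<close> of
  the target.\<close>

definition pullback_connection ::
    "('m::topological_space, 'e::euclidean_space) atlas \<Rightarrow>
     ('n::topological_space, 'f::euclidean_space) atlas \<Rightarrow>
     ('m \<Rightarrow> 'n) \<Rightarrow> ('n, 'n) connection \<Rightarrow> ('m, 'n) connection \<Rightarrow> bool" where
  "pullback_connection A B F DN DF \<longleftrightarrow>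
     connection_along A B F DF \<and>
     (\<forall>W. open W \<longrightarrow> (\<forall>Z\<in>vector_fields B W. \<forall>p\<in>F -` W. \<forall>u\<in>tangent_space A p.
        DF p u (Z \<circ> F) = DN (F p) (differential B F p u) Z))"

definition hyperkaehler ::
    "('m::{t2_space, second_countable_topology}, 'e::euclidean_space) atlas \<Rightarrow> 'm metric \<Rightarrow>
     ('m, 'm) connection \<Rightarrow> ('m \<Rightarrow> 'm tvec \<Rightarrow> 'm tvec) \<Rightarrow> ('m \<Rightarrow> 'm tvec \<Rightarrow> 'm tvec) \<Rightarrow>
     ('m \<Rightarrow> 'm tvec \<Rightarrow> 'm tvec) \<Rightarrow> bool" where
  "hyperkaehler A g D I J K \<longleftrightarrow>
     riemannian_manifold A g \<and> 4 dvd DIM('e) \<and> levi_civita A g D \<and>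
     (\<forall>R\<in>{I, J, K}. endomorphism_field A R \<and> parallel A D R \<and>
        (\<forall>p. \<forall>v\<in>tangent_space A p. R p (R p v) = - v) \<and>
        (\<forall>p. \<forall>v\<in>tangent_space A p. \<forall>w\<in>tangent_space A p. g p (R p v) (R p w) = g p v w)) \<and>
     (\<forall>p. \<forall>v\<in>tangent_space A p.
        I p (J p v) = K p v \<and> - J p (I p v) = K p v \<and>
        J p (K p v) = I p v \<and> - K p (J p v) = I p v \<and>
        K p (I p v) = J p v \<and> - I p (K p v) = J p v)"


subsection \<open>Riemannian submersions\<close>

definition orth_compl :: "('v \<Rightarrow> 'v \<Rightarrow> real) \<Rightarrow> 'v set \<Rightarrow> 'v set \<Rightarrow> 'v set" where
  "orth_compl h S E = {w \<in> E. \<forall>v\<in>S. h w v = 0}"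

definition orth_proj :: "('v::real_vector \<Rightarrow> 'v \<Rightarrow> real) \<Rightarrow> 'v set \<Rightarrow> 'v \<Rightarrow> 'v" where
  "orth_proj h S v = (THE w. w \<in> S \<and> (\<forall>u\<in>S. h (v - w) u = 0))"

definition ker_diff ::
    "('m::topological_space, 'e::euclidean_space) atlas \<Rightarrow>
     ('n::topological_space, 'f::euclidean_space) atlas \<Rightarrow> ('m \<Rightarrow> 'n) \<Rightarrow> 'm \<Rightarrow> 'm tvec set" where
  "ker_diff A B F p = {v \<in> tangent_space A p. differential B F p v = 0}"

definition horizontal ::
    "('m::topological_space, 'e::euclidean_space) atlas \<Rightarrow> 'm metric \<Rightarrow>
     ('n::topological_space, 'f::euclidean_space) atlas \<Rightarrow> ('m \<Rightarrow> 'n) \<Rightarrow> 'm \<Rightarrow> 'm tvec set" where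
  "horizontal A g B F p = orth_compl (g p) (ker_diff A B F p) (tangent_space A p)"

definition riemannian_submersion ::
    "('m::topological_space, 'e::euclidean_space) atlas \<Rightarrow> 'm metric \<Rightarrow>
     ('n::topological_space, 'f::euclidean_space) atlas \<Rightarrow> 'n metric \<Rightarrow> ('m \<Rightarrow> 'n) \<Rightarrow> bool" where
  "riemannian_submersion A gM B gN F \<longleftrightarrow>
     smooth_map A B F \<and> surj F \<and>
     (\<forall>p. differential B F p ` tangent_space A p = tangent_space B (F p)) \<and>
     (\<forall>p. bij_betw (differential B F p) (horizontal A gM B F p) (tangent_space B (F p)) \<and>
          (\<forall>x\<in>horizontal A gM B F p. \<forall>y\<in>horizontal A gM B F p.
             gN (F p) (differential B F p x) (differential B F p y) = gM p x y))"

definition h_anti_invariant_submersion ::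
    "('m::topological_space, 'e::euclidean_space) atlas \<Rightarrow> 'm metric \<Rightarrow>
     ('m \<Rightarrow> 'm tvec \<Rightarrow> 'm tvec) \<Rightarrow> ('m \<Rightarrow> 'm tvec \<Rightarrow> 'm tvec) \<Rightarrow> ('m \<Rightarrow> 'm tvec \<Rightarrow> 'm tvec) \<Rightarrow>
     ('n::topological_space, 'f::euclidean_space) atlas \<Rightarrow> 'n metric \<Rightarrow> ('m \<Rightarrow> 'n) \<Rightarrow> bool" where
  "h_anti_invariant_submersion A gM I J K B gN F \<longleftrightarrow>
     riemannian_submersion A gM B gN F \<and>
     (\<forall>R\<in>{I, J, K}. \<forall>p. R p ` ker_diff A B F p \<subseteq> horizontal A gM B F p)"

definition vert_proj ::
    "('m::topological_space, 'e::euclidean_space) atlas \<Rightarrow> 'm metric \<Rightarrow>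
     ('n::topological_space, 'f::euclidean_space) atlas \<Rightarrow> ('m \<Rightarrow> 'n) \<Rightarrow>
     ('m \<Rightarrow> 'm tvec) \<Rightarrow> 'm \<Rightarrow> 'm tvec" where
  "vert_proj A g B F U = (\<lambda>p. orth_proj (g p) (ker_diff A B F p) (U p))"

definition hor_proj ::
    "('m::topological_space, 'e::euclidean_space) atlas \<Rightarrow> 'm metric \<Rightarrow>
     ('n::topological_space, 'f::euclidean_space) atlas \<Rightarrow> ('m \<Rightarrow> 'n) \<Rightarrow>
     ('m \<Rightarrow> 'm tvec) \<Rightarrow> 'm \<Rightarrow> 'm tvec" where
  "hor_proj A g B F U = (\<lambda>p. orth_proj (g p) (horizontal A g B F p) (U p))"

definition oneill_T ::
    "('m::topological_space, 'e::euclidean_space) atlas \<Rightarrow> 'm metric \<Rightarrow> ('m, 'm) connection \<Rightarrow>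
     ('n::topological_space, 'f::euclidean_space) atlas \<Rightarrow> ('m \<Rightarrow> 'n) \<Rightarrow>
     ('m \<Rightarrow> 'm tvec) \<Rightarrow> ('m \<Rightarrow> 'm tvec) \<Rightarrow> 'm \<Rightarrow> 'm tvec" where
  "oneill_T A g D B F U W =
     (let \<V> = vert_proj A g B F; \<H> = hor_proj A g B F; nabla = (\<lambda>X Y p. D p (X p) Y)
      in (\<lambda>p. \<H> (nabla (\<V> U) (\<V> W)) p + \<V> (nabla (\<V> U) (\<H> W)) p))"

definition mu_space ::
    "('m::topological_space, 'e::euclidean_space) atlas \<Rightarrow> 'm metric \<Rightarrow>
     ('n::topological_space, 'f::euclidean_space) atlas \<Rightarrow> ('m \<Rightarrow> 'n) \<Rightarrow>
     ('m \<Rightarrow> 'm tvec \<Rightarrow> 'm tvec) \<Rightarrow> 'm \<Rightarrow> 'm tvec set" where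
  "mu_space A g B F R p = orth_compl (g p) (R p ` ker_diff A B F p) (horizontal A g B F p)"

definition Q_proj ::
    "('m::topological_space, 'e::euclidean_space) atlas \<Rightarrow> 'm metric \<Rightarrow>
     ('n::topological_space, 'f::euclidean_space) atlas \<Rightarrow> ('m \<Rightarrow> 'n) \<Rightarrow>
     ('m \<Rightarrow> 'm tvec \<Rightarrow> 'm tvec) \<Rightarrow> 'm \<Rightarrow> 'm tvec \<Rightarrow> 'm tvec" where
  "Q_proj A g B F R p = orth_proj (g p) (mu_space A g B F R p)"


subsection \<open>Traces and harmonicity\<close>

definition orthonormal_frame ::
    "('m::topological_space, 'e::euclidean_space) atlas \<Rightarrow> 'm metric \<Rightarrow> ('m \<Rightarrow> 'm tvec set) \<Rightarrow>
     'm set \<Rightarrow> nat \<Rightarrow> (nat \<Rightarrow> 'm \<Rightarrow> 'm tvec) \<Rightarrow> bool" where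
  "orthonormal_frame A g E W k e \<longleftrightarrow>
     open W \<and> (\<forall>i<k. e i \<in> sections A E W) \<and>
     (\<forall>p\<in>W. (\<forall>i<k. \<forall>j<k. g p (e i p) (e j p) = (if i = j then 1 else 0)) \<and>
            span ((\<lambda>i. e i p) ` {..<k}) = E p)"

definition trace_T ::
    "('m::topological_space, 'e::euclidean_space) atlas \<Rightarrow> 'm metric \<Rightarrow> ('m, 'm) connection \<Rightarrow>
     ('n::topological_space, 'f::euclidean_space) atlas \<Rightarrow> ('m \<Rightarrow> 'n) \<Rightarrow>
     nat \<Rightarrow> (nat \<Rightarrow> 'm \<Rightarrow> 'm tvec) \<Rightarrow> 'm \<Rightarrow> 'm tvec" where
  "trace_T A g D B F k e p = (\<Sum>i<k. oneill_T A g D B F (e i) (e i) p)"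

definition trace_RT ::
    "('m::topological_space, 'e::euclidean_space) atlas \<Rightarrow> 'm metric \<Rightarrow> ('m, 'm) connection \<Rightarrow>
     ('n::topological_space, 'f::euclidean_space) atlas \<Rightarrow> ('m \<Rightarrow> 'n) \<Rightarrow>
     ('m \<Rightarrow> 'm tvec \<Rightarrow> 'm tvec) \<Rightarrow> ('m \<Rightarrow> 'm tvec) \<Rightarrow>
     nat \<Rightarrow> (nat \<Rightarrow> 'm \<Rightarrow> 'm tvec) \<Rightarrow> 'm \<Rightarrow> real" where
  "trace_RT A g D B F R V k e p = (\<Sum>i<k. g p (R p (oneill_T A g D B F V (e i) p)) (e i p))"

text \<open>Here \<open>DF\<close> is the pullback connection and \<open>DM\<close> the Levi-Civita connection of the source.\<close>

definition second_fundamental_form ::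
    "('n::topological_space, 'f::euclidean_space) atlas \<Rightarrow> ('m \<Rightarrow> 'n) \<Rightarrow>
     ('m, 'm) connection \<Rightarrow> ('m, 'n) connection \<Rightarrow>
     ('m \<Rightarrow> 'm tvec) \<Rightarrow> ('m \<Rightarrow> 'm tvec) \<Rightarrow> 'm \<Rightarrow> 'n tvec" where
  "second_fundamental_form B F DM DF U W p =
     DF p (U p) (\<lambda>q. differential B F q (W q)) - differential B F p (DM p (U p) W)"

text \<open>A trace is computed in a local orthonormal frame; the vanishing conditions are imposed for all of
  them, so that no choice of frame is involved.\<close>

definition harmonic ::
    "('m::topological_space, 'e::euclidean_space) atlas \<Rightarrow> 'm metric \<Rightarrow>
     ('n::topological_space, 'f::euclidean_space) atlas \<Rightarrow> ('m \<Rightarrow> 'n) \<Rightarrow>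
     ('m, 'm) connection \<Rightarrow> ('m, 'n) connection \<Rightarrow> bool" where
  "harmonic A g B F DM DF \<longleftrightarrow>
     (\<forall>W n e. orthonormal_frame A g (tangent_space A) W n e \<longrightarrow>
        (\<forall>p\<in>W. (\<Sum>i<n. second_fundamental_form B F DM DF (e i) (e i) p) = 0))"

definition Q_trace_T_vanishes ::
    "('m::topological_space, 'e::euclidean_space) atlas \<Rightarrow> 'm metric \<Rightarrow> ('m, 'm) connection \<Rightarrow>
     ('n::topological_space, 'f::euclidean_space) atlas \<Rightarrow> ('m \<Rightarrow> 'n) \<Rightarrow>
     ('m \<Rightarrow> 'm tvec \<Rightarrow> 'm tvec) \<Rightarrow> bool" where
  "Q_trace_T_vanishes A g D B F R \<longleftrightarrow>
     (\<forall>W k e. orthonormal_frame A g (ker_diff A B F) W k e \<longrightarrow>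
        (\<forall>p\<in>W. Q_proj A g B F R p (trace_T A g D B F k e p) = 0))"

definition trace_RT_vanishes ::
    "('m::topological_space, 'e::euclidean_space) atlas \<Rightarrow> 'm metric \<Rightarrow> ('m, 'm) connection \<Rightarrow>
     ('n::topological_space, 'f::euclidean_space) atlas \<Rightarrow> ('m \<Rightarrow> 'n) \<Rightarrow>
     ('m \<Rightarrow> 'm tvec \<Rightarrow> 'm tvec) \<Rightarrow> ('m \<Rightarrow> 'm tvec) \<Rightarrow> bool" where
  "trace_RT_vanishes A g D B F R V \<longleftrightarrow>
     (\<forall>W k e. orthonormal_frame A g (ker_diff A B F) W k e \<longrightarrow>
        (\<forall>p\<in>W. trace_RT A g D B F R V k e p = 0))"

end

theory Submission
  imports Defs
begin

text \<open>Near a point of \<open>M\<close> take an orthonormal frame consisting of the horizontal lifts of a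
  frame of \<open>N\<close> and of vertical fields. The second fundamental form of \<open>F\<close> vanishes on pairs of
  horizontal vectors, and on vertical \<open>U\<close> it is \<open>- F\<^sub>* (\<nabla>\<^sub>U U)\<close>; it is tensorial, so its trace
  may be computed in this frame and equals \<open>- F\<^sub>* (trace T)\<close>. As \<open>F\<^sub>*\<close> is injective on horizontal
  vectors, \<open>F\<close> is harmonic iff \<open>trace T = 0\<close>.

  For a parallel skew \<open>R\<close> with \<open>R (ker F\<^sub>*)\<close> horizontal, metric compatibility gives
  \<open>g (\<nabla>\<^sub>E E, R V) = g (R E, \<nabla>\<^sub>E V)\<close> for vertical \<open>E, V\<close>, and \<open>\<nabla>\<^sub>E V\<close> may be replaced by \<open>\<nabla>\<^sub>V E\<close>
  because \<open>[E, V]\<close> is vertical. Hence \<open>g (trace T, R V) = - trace (R T\<^sub>V)\<close>: the two conditions on \<open>R\<close>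
  say that the components of \<open>trace T\<close> in \<open>\<mu>\<^sub>R\<close> and in \<open>R (ker F\<^sub>*)\<close> vanish.\<close>

subsection \<open>Calculus of smooth functions\<close>

text \<open>One obstacle is a mismatch of scopes: traces are taken in local frames, while the trace
  condition tests only globally defined vertical fields \<open>V\<close>. A local frame field is
  therefore multiplied by a bump function, built from a flat function; a nonzero multiple of it at
  the point in question is enough.

  The other obstacle is the smoothness of horizontal lifts. A lift is determined pointwise, but its
  coefficients in an orthonormal frame \<open>E\<close> of \<open>M\<close> are the products of
  \<open>dF E_i\<close> with the frame \<open>y_j\<close> of \<open>N\<close>, and these are smooth.
  Gram-Schmidt completes the lifts, and what it adds is orthogonal to every horizontal vector, hence
  vertical.

  All conditions range over all local frames. The trace formula therefore allows an arbitrary frame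
  of \<open>TM\<close> on one side and uses the vertical part of an adapted frame on the other, and
  any given vertical frame can be inserted as that part.

  The vanishing on horizontal pairs is the index argument behind the uniqueness of the Levi-Civita
  connection: an array symmetric in one pair of indices and antisymmetric in an overlapping pair is
  zero.\<close>

lemma frechet_derivative_cong_open:
  assumes "open S" "x \<in> S" "\<And>y. y \<in> S \<Longrightarrow> f y = g y"
  shows "frechet_derivative f (at x) = frechet_derivative g (at x)"
proof -
  \<comment> \<open>Both functions have the same set of derivatives at \<open>x\<close>, so the
    choice operator returns the same value even where this set is empty.\<close>
  have "(f has_derivative D) (at x) \<longleftrightarrow> (g has_derivative D) (at x)" for D
    using has_derivative_transform_within_open[OF _ assms(1,2), of f D UNIV g]
      has_derivative_transform_within_open[OF _ assms(1,2), of g D UNIV f] assms(3) by auto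
  then show ?thesis
    by (simp add: frechet_derivative_def)
qed

lemma C_k_on_Suc_iff:
  assumes "open S"
  shows "C_k_on (Suc k) S f \<longleftrightarrow> (\<forall>x\<in>S. f differentiable (at x)) \<and>
    (\<forall>u. C_k_on k S (\<lambda>x. frechet_derivative f (at x) u))"
  using assms by (simp add: differentiable_on_eq_differentiable_at)

lemma C_k_on_cong:
  assumes "open S" "\<And>x. x \<in> S \<Longrightarrow> f x = g x"
  shows "C_k_on k S f \<longleftrightarrow> C_k_on k S g"
  using assms(2)
proof (induction k arbitrary: f g)
  case 0
  then show ?case by (simp cong: continuous_on_cong)
next
  case (Suc k)
  have "frechet_derivative f (at x) = frechet_derivative g (at x)" if "x \<in> S" for x
    using frechet_derivative_cong_open[OF assms(1) that] Suc.prems by blast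
  then have "C_k_on k S (\<lambda>x. frechet_derivative f (at x) u) \<longleftrightarrow>
      C_k_on k S (\<lambda>x. frechet_derivative g (at x) u)" for u
    by (intro Suc.IH) simp
  moreover have "f differentiable (at x) \<longleftrightarrow> g differentiable (at x)" if "x \<in> S" for x
    using has_derivative_transform_within_open[OF _ assms(1) that, of f _ UNIV g]
      has_derivative_transform_within_open[OF _ assms(1) that, of g _ UNIV f] Suc.prems
    unfolding differentiable_def by auto
  ultimately show ?case
    using assms(1) by (simp add: C_k_on_Suc_iff del: C_k_on.simps)
qed

text \<open>\<open>C_k_on\<close> refers to the derivative picked by
  \<open>frechet_derivative\<close>; uniqueness of derivatives lets an explicit formula
  \<open>f'\<close> stand in for it.\<close>

lemma C_k_on_SucI:
  assumes "open S" "\<And>x. x \<in> S \<Longrightarrow> (f has_derivative f' x) (at x)"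
    and "\<And>u. C_k_on k S (\<lambda>x. f' x u)"
  shows "C_k_on (Suc k) S f"
proof -
  have "C_k_on k S (\<lambda>x. frechet_derivative f (at x) u)" for u
    using assms(3)[of u] C_k_on_cong[OF assms(1), of "\<lambda>x. f' x u" "\<lambda>x. frechet_derivative f (at x) u"]
      frechet_derivative_at[OF assms(2)] by simp
  then show ?thesis
    using assms(1,2) by (auto simp: C_k_on_Suc_iff differentiable_def simp del: C_k_on.simps)
qed

lemma C_k_on_SucD:
  assumes "C_k_on (Suc k) S f" "open S"
  shows "x \<in> S \<Longrightarrow> (f has_derivative frechet_derivative f (at x)) (at x)"
    and "C_k_on k S (\<lambda>x. frechet_derivative f (at x) u)"
  using assms
  by (simp_all add: C_k_on_Suc_iff frechet_derivative_works[symmetric] del: C_k_on.simps)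

lemma C_k_on_less: "C_k_on (Suc k) S f \<Longrightarrow> C_k_on k S f"
  by (induction k arbitrary: f) (auto simp: differentiable_imp_continuous_on)

lemma C_k_on_subset:
  assumes "C_k_on k S f" "T \<subseteq> S"
  shows "C_k_on k T f"
  using assms(1)
  by (induction k arbitrary: f)
    (use assms(2) in \<open>auto intro: continuous_on_subset differentiable_on_subset\<close>)

lemma C_k_on_local:
  assumes "open S" "\<And>x. x \<in> S \<Longrightarrow> \<exists>T. open T \<and> x \<in> T \<and> C_k_on k T f"
  shows "C_k_on k S f"
  using assms(2)
proof (induction k arbitrary: f)
  case 0
  then show ?case
    by (metis C_k_on.simps(1) assms(1) continuous_on_eq_continuous_at)
next
  case (Suc k)
  have "f differentiable (at x)" if "x \<in> S" for x
    using Suc.prems[OF that] C_k_on_SucD(1) differentiable_def by metis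
  moreover have "C_k_on k S (\<lambda>x. frechet_derivative f (at x) u)" for u
    using Suc.prems by (intro Suc.IH) (metis C_k_on.simps(2))
  ultimately show ?case
    using assms(1) by (simp add: C_k_on_Suc_iff del: C_k_on.simps)
qed

section \<open>Closure properties of \<open>C_k_on\<close>, up to the chain rule\<close>

lemma C_k_on_const: "open S \<Longrightarrow> C_k_on k S (\<lambda>x. c)"
  by (induction k arbitrary: c)
    (simp_all add: differentiable_on_const frechet_derivative_const)

lemma C_k_on_bounded_linear_compose:
  assumes "open S" "bounded_linear L" "C_k_on k S f"
  shows "C_k_on k S (\<lambda>x. L (f x))"
  using assms(3)
proof (induction k arbitrary: f)
  case 0
  then show ?case
    using bounded_linear.continuous_on[OF assms(2)] by simp
next
  case (Suc k)
  show ?case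
  proof (rule C_k_on_SucI[OF assms(1)])
    show "((\<lambda>x. L (f x)) has_derivative (\<lambda>u. L (frechet_derivative f (at x) u))) (at x)"
      if "x \<in> S" for x
      using bounded_linear.has_derivative[OF assms(2)] C_k_on_SucD[OF Suc.prems assms(1)] that
      by blast
    show "C_k_on k S (\<lambda>x. L (frechet_derivative f (at x) u))" for u
      using Suc.IH C_k_on_SucD[OF Suc.prems assms(1)] by blast
  qed
qed

lemma C_k_on_ident:
  assumes "open S" shows "C_k_on k S (\<lambda>x. x)"
proof (cases k)
  case (Suc n)
  show ?thesis
    unfolding Suc by (rule C_k_on_SucI[OF assms has_derivative_ident]) (rule C_k_on_const[OF assms])
qed simp

lemma C_k_on_add:
  assumes "open S" "C_k_on k S f" "C_k_on k S g"
  shows "C_k_on k S (\<lambda>x. f x + g x)"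
  using assms(2,3)
proof (induction k arbitrary: f g)
  case 0
  then show ?case by (simp add: continuous_on_add)
next
  case (Suc k)
  note f = C_k_on_SucD[OF Suc.prems(1) assms(1)] and g = C_k_on_SucD[OF Suc.prems(2) assms(1)]
  show ?case
    by (rule C_k_on_SucI[OF assms(1) has_derivative_add[OF f(1) g(1)] Suc.IH[OF f(2) g(2)]])
qed

lemma C_k_on_sum:
  assumes "open S" "\<And>i. i \<in> X \<Longrightarrow> C_k_on k S (f i)"
  shows "C_k_on k S (\<lambda>x. \<Sum>i\<in>X. f i x)"
  using assms(2)
  by (induction X rule: infinite_finite_induct)
    (simp_all add: C_k_on_const[OF assms(1)] C_k_on_add[OF assms(1)])

lemma C_k_on_scaleR:
  fixes f :: "'a::euclidean_space \<Rightarrow> real"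
  assumes "open S" "C_k_on k S f" "C_k_on k S g"
  shows "C_k_on k S (\<lambda>x. f x *\<^sub>R g x)"
  using assms(2,3)
proof (induction k arbitrary: f g)
  case 0
  then show ?case by (simp add: continuous_on_scaleR)
next
  case (Suc k)
  note f = C_k_on_SucD[OF Suc.prems(1) assms(1)] and g = C_k_on_SucD[OF Suc.prems(2) assms(1)]
  show ?case
    by (rule C_k_on_SucI[OF assms(1) has_derivative_scaleR[OF f(1) g(1)]])
      (auto intro!: C_k_on_add assms(1) Suc.IH f(2) g(2) Suc.prems[THEN C_k_on_less])
qed

text \<open>\<open>C_k_on\<close> controls derivatives in fixed directions only, whereas the chain
  rule differentiates \<open>f\<close> in the moving direction \<open>?g' x u\<close>. Expanding
  this direction in \<open>Basis\<close> leaves products of functions of order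
  \<open>k\<close>.\<close>

lemma C_k_on_compose:
  fixes f :: "'b::euclidean_space \<Rightarrow> 'c::real_normed_vector" and g :: "'a::euclidean_space \<Rightarrow> 'b"
  assumes "open S" "open T" "g ` S \<subseteq> T" "C_k_on k T f" "C_k_on k S g"
  shows "C_k_on k S (\<lambda>x. f (g x))"
  using assms(4,5)
proof (induction k arbitrary: f)
  case 0
  then show ?case
    using assms(3) continuous_on_compose2 by auto
next
  case (Suc k)
  note f = C_k_on_SucD[OF Suc.prems(1) assms(2)] and g = C_k_on_SucD[OF Suc.prems(2) assms(1)]
  have gT: "x \<in> S \<Longrightarrow> g x \<in> T" for x
    using assms(3) by auto
  let ?f' = "\<lambda>y. frechet_derivative f (at y)" and ?g' = "\<lambda>x. frechet_derivative g (at x)"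
  have lin: "?f' (g x) (?g' x u) = (\<Sum>b\<in>Basis. (?g' x u \<bullet> b) *\<^sub>R ?f' (g x) b)" if "x \<in> S" for x u
  proof -
    interpret linear "?f' (g x)"
      using f(1)[OF gT[OF that]] has_derivative_linear by blast
    have "?f' (g x) (?g' x u) = ?f' (g x) (\<Sum>b\<in>Basis. (?g' x u \<bullet> b) *\<^sub>R b)"
      by (simp add: euclidean_representation)
    then show ?thesis by (simp add: sum scale)
  qed
  have der: "((\<lambda>x. f (g x)) has_derivative (\<lambda>u. ?f' (g x) (?g' x u))) (at x)" if "x \<in> S" for x
    using diff_chain_at[OF g(1)[OF that] f(1)[OF gT[OF that]]] by (simp add: o_def)
  have "C_k_on k S (\<lambda>x. \<Sum>b\<in>Basis. (?g' x u \<bullet> b) *\<^sub>R ?f' (g x) b)" for u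
  proof (intro C_k_on_sum C_k_on_scaleR assms(1))
    show "C_k_on k S (\<lambda>x. ?g' x u \<bullet> b)" for b
      using C_k_on_bounded_linear_compose[OF assms(1) bounded_linear_inner_left g(2)] .
    show "C_k_on k S (\<lambda>x. ?f' (g x) b)" for b
      \<comment> \<open>The inner function is as smooth as before, so only the order of the outer
        one drops; this is why the induction generalises \<open>f\<close> but keeps
        \<open>g\<close>.\<close>
      using Suc.IH[OF f(2) C_k_on_less[OF Suc.prems(2)]] .
  qed
  then have "C_k_on k S (\<lambda>x. ?f' (g x) (?g' x u))" for u
    by (subst C_k_on_cong[OF assms(1) lin])
  then show ?case
    by (intro C_k_on_SucI[OF assms(1) der])
qed

section \<open>Smoothness of real powers and of a flat function\<close>

lemma C_k_on_powr: "C_k_on k {0<..} (\<lambda>x::real. x powr a)"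
proof (induction k arbitrary: a)
  case 0
  then show ?case by (auto intro!: continuous_intros)
next
  case (Suc k)
  \<comment> \<open>The derivative is again a multiple of a power, with exponent
    \<open>a - 1\<close>; the induction hypothesis is available for every exponent.\<close>
  have "((\<lambda>x. x powr a) has_derivative (\<lambda>u. u *\<^sub>R (a *\<^sub>R x powr (a - 1)))) (at x)"
    if "x \<in> {0<..}" for x :: real
    using has_real_derivative_powr[of x a] that
    by (simp add: has_field_derivative_def mult_commute_abs)
  then show ?case
    by (rule C_k_on_SucI[rotated])
      (auto intro!: C_k_on_scaleR C_k_on_const Suc.IH simp del: real_scaleR_def)
qed

text \<open>The family of all \<open>exp (- 1 / x) / x ^ n\<close>, cut off at \<open>0\<close>, is closed under
  differentiation up to linear combinations, which gives the smoothness of the case \<open>n = 0\<close>.\<close>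

definition flat_exp :: "nat \<Rightarrow> real \<Rightarrow> real" where
  "flat_exp n x = (if x > 0 then exp (- 1 / x) / x ^ n else 0)"

lemma flat_exp_has_derivative:
  "(flat_exp n has_real_derivative (flat_exp (n + 2) x - real n * flat_exp (n + 1) x)) (at x)"
proof (cases x "0::real" rule: linorder_cases)
  case less
  have "((\<lambda>x. 0) has_real_derivative 0) (at x)" by simp
  then have "(flat_exp n has_real_derivative 0) (at x)"
    by (rule has_field_derivative_transform_within_open[of _ _ _ "{..<0}"]) (use less in \<open>auto simp: flat_exp_def\<close>)
  then show ?thesis using less by (simp add: flat_exp_def)
next
  case greater
  have "((\<lambda>x. exp (- 1 / x) / x ^ n) has_real_derivative
      (exp (- 1 / x) * (1 / x ^ 2) * x ^ n - exp (- 1 / x) * (real n * x ^ (n - 1))) / (x ^ n * x ^ n)) (at x)"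
    using greater by (auto intro!: derivative_eq_intros simp: power2_eq_square)
  also have "(exp (- 1 / x) * (1 / x ^ 2) * x ^ n - exp (- 1 / x) * (real n * x ^ (n - 1))) / (x ^ n * x ^ n)
      = flat_exp (n + 2) x - real n * flat_exp (n + 1) x"
    using greater by (cases n) (auto simp: flat_exp_def field_simps power2_eq_square)
  finally show ?thesis
    by (rule has_field_derivative_transform_within_open[of _ _ _ "{0<..}"]) (use greater in \<open>auto simp: flat_exp_def\<close>)
next
  case equal
  \<comment> \<open>With \<open>y = 1 / h\<close> the right difference quotient
    \<open>flat_exp n h / h\<close> is \<open>y ^ (n + 1) / exp y\<close>, and exponential growth
    wins. The left quotient is identically zero.\<close>
  have "((\<lambda>y::real. y ^ (n + 1) / exp y) \<longlongrightarrow> 0) at_top"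
    by (rule tendsto_power_div_exp_0)
  then have "((\<lambda>h::real. (inverse h) ^ (n + 1) / exp (inverse h)) \<longlongrightarrow> 0) (at_right 0)"
    by (rule filterlim_compose[OF _ filterlim_inverse_at_top_right])
  then have "((\<lambda>h. flat_exp n h / h) \<longlongrightarrow> 0) (at_right 0)"
    by (rule Lim_transform_eventually)
      (auto simp: eventually_at_filter flat_exp_def field_simps exp_minus power_inverse)
  moreover have "((\<lambda>h. flat_exp n h / h) \<longlongrightarrow> 0) (at_left 0)"
    by (rule Lim_transform_eventually[OF tendsto_const])
      (auto simp: eventually_at_filter flat_exp_def)
  ultimately have "((\<lambda>h. flat_exp n h / h) \<longlongrightarrow> 0) (at 0)"
    using filterlim_at_split by blast
  then show ?thesis
    using equal by (simp add: DERIV_def flat_exp_def)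
qed

lemma C_k_on_flat_exp: "C_k_on k UNIV (flat_exp n)"
proof (induction k arbitrary: n)
  case 0
  have "isCont (flat_exp n) x" for x
    using flat_exp_has_derivative DERIV_isCont by blast
  then show ?case
    by (simp add: continuous_on_eq_continuous_at)
next
  case (Suc k)
  have "(flat_exp n has_derivative
      (\<lambda>u. (flat_exp (n + 2) x + (- real n) *\<^sub>R flat_exp (n + 1) x) * u)) (at x)" for x
    using flat_exp_has_derivative[of n x] by (simp add: has_field_derivative_def)
  then have "(flat_exp n has_derivative
      (\<lambda>u. u *\<^sub>R (flat_exp (n + 2) x + (- real n) *\<^sub>R flat_exp (n + 1) x))) (at x)" for x
    by (subst (asm) mult.commute) simp
  then show ?case
    by (rule C_k_on_SucI[rotated])
      (intro C_k_on_scaleR C_k_on_const C_k_on_add Suc.IH open_UNIV)+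
qed

section \<open>The same rules for functions of all orders of differentiability\<close>

lemma smooth_on_cong:
  "open S \<Longrightarrow> (\<And>x. x \<in> S \<Longrightarrow> f x = g x) \<Longrightarrow> smooth_on S f \<longleftrightarrow> smooth_on S g"
  using C_k_on_cong unfolding smooth_on_def by blast

lemma smooth_on_subset: "smooth_on S f \<Longrightarrow> T \<subseteq> S \<Longrightarrow> smooth_on T f"
  using C_k_on_subset unfolding smooth_on_def by blast

lemma smooth_on_local:
  "open S \<Longrightarrow> (\<And>x. x \<in> S \<Longrightarrow> \<exists>T. open T \<and> x \<in> T \<and> smooth_on T f) \<Longrightarrow> smooth_on S f"
  using C_k_on_local[of S _ f] unfolding smooth_on_def by meson

lemma smooth_on_continuous_on: "smooth_on S f \<Longrightarrow> continuous_on S f"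
  unfolding smooth_on_def by (metis C_k_on.simps(1))

lemma smooth_on_has_derivative:
  "smooth_on S f \<Longrightarrow> open S \<Longrightarrow> x \<in> S \<Longrightarrow> (f has_derivative frechet_derivative f (at x)) (at x)"
  using C_k_on_SucD(1) unfolding smooth_on_def by blast

lemma smooth_on_frechet_derivative:
  "smooth_on S f \<Longrightarrow> open S \<Longrightarrow> smooth_on S (\<lambda>x. frechet_derivative f (at x) u)"
  using C_k_on_SucD(2) unfolding smooth_on_def by blast

lemma smooth_on_const: "open S \<Longrightarrow> smooth_on S (\<lambda>x. c)"
  by (simp add: smooth_on_def C_k_on_const)

lemma smooth_on_ident: "open S \<Longrightarrow> smooth_on S (\<lambda>x. x)"
  by (simp add: smooth_on_def C_k_on_ident)

lemma smooth_on_add: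
  "open S \<Longrightarrow> smooth_on S f \<Longrightarrow> smooth_on S g \<Longrightarrow> smooth_on S (\<lambda>x. f x + g x)"
  by (simp add: smooth_on_def C_k_on_add)

lemma smooth_on_mult:
  fixes f g :: "'a::euclidean_space \<Rightarrow> real"
  shows "open S \<Longrightarrow> smooth_on S f \<Longrightarrow> smooth_on S g \<Longrightarrow> smooth_on S (\<lambda>x. f x * g x)"
  using C_k_on_scaleR[of S _ f g] by (simp add: smooth_on_def)

lemma smooth_on_bounded_linear_compose:
  "open S \<Longrightarrow> bounded_linear L \<Longrightarrow> smooth_on S f \<Longrightarrow> smooth_on S (\<lambda>x. L (f x))"
  by (simp add: smooth_on_def C_k_on_bounded_linear_compose)

lemma smooth_on_compose:
  fixes f :: "'b::euclidean_space \<Rightarrow> 'c::real_normed_vector" and g :: "'a::euclidean_space \<Rightarrow> 'b"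
  assumes "open S" "open T" "g ` S \<subseteq> T" "smooth_on T f" "smooth_on S g"
  shows "smooth_on S (\<lambda>x. f (g x))"
  using C_k_on_compose[OF assms(1-3)] assms(4,5) unfolding smooth_on_def by blast

subsection \<open>Smooth functions on manifolds\<close>

lemma chart_facts:
  assumes "smooth_manifold A" "(U, \<phi>) \<in> A"
  shows chart_open: "open U"
    and chart_continuous: "continuous_on U \<phi>"
    and chart_inv_continuous: "continuous_on (\<phi> ` U) (inv_into U \<phi>)"
    and chart_image_open: "open (\<phi> ` U)"
    and chart_inv: "q \<in> U \<Longrightarrow> inv_into U \<phi> (\<phi> q) = q"
  using assms unfolding smooth_manifold_def is_chart_def homeomorphism_def by auto

lemma chart_exists:
  assumes "smooth_manifold A"
  obtains U \<phi> where "(U, \<phi>) \<in> A" "p \<in> U"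
  using assms unfolding smooth_manifold_def by blast

text \<open>The image is the preimage of \<open>W\<close> under the continuous inverse chart, inside
  the open image of the whole chart domain.\<close>

lemma chart_image_Int_open:
  assumes A: "smooth_manifold A" "(U, \<phi>) \<in> A" and "open W"
  shows "open (\<phi> ` (U \<inter> W))"
proof -
  have "\<phi> ` (U \<inter> W) = inv_into U \<phi> -` W \<inter> \<phi> ` U"
    using chart_inv[OF A] by auto
  then show ?thesis
    using continuous_on_open_vimage[OF chart_image_open[OF A]] chart_inv_continuous[OF A] \<open>open W\<close>
    by metis
qed

lemma smooth_transition:
  assumes "smooth_manifold A" "(U, \<phi>) \<in> A" "(V, \<psi>) \<in> A"
  shows "smooth_on (\<phi> ` (U \<inter> V)) (\<psi> \<circ> inv_into U \<phi>)"
  using assms unfolding smooth_manifold_def by fastforce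

lemma smooth_fun_in_chart:
  assumes "smooth_fun A W f" "(U, \<phi>) \<in> A"
  shows "smooth_on (\<phi> ` (U \<inter> W)) (f \<circ> inv_into U \<phi>)"
  using assms unfolding smooth_fun_def by auto

text \<open>One chart is enough when it contains \<open>W\<close>: any other chart sees the same
  representative composed with a smooth transition map.\<close>

lemma smooth_fun_chartI:
  assumes A: "smooth_manifold A" "(U, \<phi>) \<in> A" and W: "open W" "W \<subseteq> U"
    and f: "smooth_on (\<phi> ` W) (f \<circ> inv_into U \<phi>)"
  shows "smooth_fun A W f"
  unfolding smooth_fun_def
proof clarify
  fix V \<psi> assume V: "(V, \<psi>) \<in> A"
  note inv = chart_inv[OF A] chart_inv[OF A(1) V]
  let ?t = "\<phi> \<circ> inv_into V \<psi>"
  have op: "open (\<psi> ` (V \<inter> W))" "open (\<phi> ` W)"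
    using chart_image_Int_open[OF A(1) V W(1)] chart_image_Int_open[OF A W(1)] W(2)
    by (auto simp: Int_absorb1)
  have "smooth_on (\<psi> ` (V \<inter> W)) ?t"
    using smooth_transition[OF A(1) V A(2)] by (rule smooth_on_subset) (use W in auto)
  then have "smooth_on (\<psi> ` (V \<inter> W)) (\<lambda>x. (f \<circ> inv_into U \<phi>) (?t x))"
    by (rule smooth_on_compose[OF op _ f, rotated]) (use inv W in auto)
  then show "smooth_on (\<psi> ` (V \<inter> W)) (f \<circ> inv_into V \<psi>)"
    by (subst smooth_on_cong[OF op(1), of _ "\<lambda>x. (f \<circ> inv_into U \<phi>) (?t x)"]) (use inv W in auto)
qed

lemma smooth_fun_subset: "smooth_fun A W f \<Longrightarrow> W' \<subseteq> W \<Longrightarrow> smooth_fun A W' f"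
  unfolding smooth_fun_def by (fastforce intro: smooth_on_subset)

lemma smooth_fun_cong:
  assumes A: "smooth_manifold A" and "open W" "\<And>p. p \<in> W \<Longrightarrow> f p = g p"
  shows "smooth_fun A W f \<longleftrightarrow> smooth_fun A W g"
proof -
  have "smooth_on (\<phi> ` (U \<inter> W)) (f \<circ> inv_into U \<phi>) \<longleftrightarrow> smooth_on (\<phi> ` (U \<inter> W)) (g \<circ> inv_into U \<phi>)"
    if "(U, \<phi>) \<in> A" for U \<phi>
    by (rule smooth_on_cong) (use assms chart_image_Int_open[OF A that] chart_inv[OF A that] in auto)
  then show ?thesis
    unfolding smooth_fun_def by auto
qed

lemma smooth_fun_local:
  assumes A: "smooth_manifold A" and "open W"
    and loc: "\<And>p. p \<in> W \<Longrightarrow> \<exists>W'. open W' \<and> p \<in> W' \<and> smooth_fun A W' f"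
  shows "smooth_fun A W f"
  unfolding smooth_fun_def
proof clarify
  fix U \<phi> assume U: "(U, \<phi>) \<in> A"
  show "smooth_on (\<phi> ` (U \<inter> W)) (f \<circ> inv_into U \<phi>)"
  proof (rule smooth_on_local)
    show "open (\<phi> ` (U \<inter> W))"
      by (rule chart_image_Int_open[OF A U \<open>open W\<close>])
    fix x assume "x \<in> \<phi> ` (U \<inter> W)"
    then obtain p where p: "p \<in> U" "p \<in> W" "x = \<phi> p" by auto
    then obtain W' where "open W'" "p \<in> W'" "smooth_fun A W' f" using loc by blast
    then show "\<exists>T. open T \<and> x \<in> T \<and> smooth_on T (f \<circ> inv_into U \<phi>)"
      using chart_image_Int_open[OF A U, of W'] smooth_fun_in_chart[OF _ U, of W' f] p by blast
  qed
qed

lemma smooth_fun_const: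
  assumes "smooth_manifold A" "open W" shows "smooth_fun A W (\<lambda>p. c)"
  unfolding smooth_fun_def using smooth_on_const chart_image_Int_open[OF assms(1) _ assms(2)]
  by (auto simp: o_def)

lemma smooth_fun_add:
  assumes "smooth_manifold A" "open W" "smooth_fun A W f" "smooth_fun A W g"
  shows "smooth_fun A W (\<lambda>p. f p + g p)"
  using smooth_on_add chart_image_Int_open[OF assms(1) _ assms(2)] assms(3,4)
  unfolding smooth_fun_def o_def by fast

lemma smooth_fun_mult:
  assumes "smooth_manifold A" "open W" "smooth_fun A W f" "smooth_fun A W g"
  shows "smooth_fun A W (\<lambda>p. f p * g p)"
  using smooth_on_mult chart_image_Int_open[OF assms(1) _ assms(2)] assms(3,4)
  unfolding smooth_fun_def o_def by fast

lemma smooth_fun_sum: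
  assumes "smooth_manifold A" "open W" "\<And>i. i \<in> X \<Longrightarrow> smooth_fun A W (f i)"
  shows "smooth_fun A W (\<lambda>p. \<Sum>i\<in>X. f i p)"
  using assms(3)
  by (induction X rule: infinite_finite_induct)
    (simp_all add: smooth_fun_const[OF assms(1,2)] smooth_fun_add[OF assms(1,2)])

lemma smooth_fun_compose_real:
  assumes A: "smooth_manifold A" "open W" and f: "smooth_fun A W f" "f ` W \<subseteq> T"
    and h: "open T" "smooth_on T h"
  shows "smooth_fun A W (\<lambda>p. h (f p))"
  unfolding smooth_fun_def
proof clarify
  fix U \<phi> assume U: "(U, \<phi>) \<in> A"
  show "smooth_on (\<phi> ` (U \<inter> W)) ((\<lambda>p. h (f p)) \<circ> inv_into U \<phi>)"
    unfolding o_def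
    by (rule smooth_on_compose[OF chart_image_Int_open[OF A(1) U A(2)] h(1) _ h(2)
          smooth_fun_in_chart[OF f(1) U, unfolded o_def]])
      (use f(2) chart_inv[OF A(1) U] in auto)
qed

lemma smooth_fun_continuous_on:
  assumes A: "smooth_manifold A" "open W" and f: "smooth_fun A W f"
  shows "continuous_on W f"
proof -
  have "isCont f p" if "p \<in> W" for p
  proof -
    obtain U \<phi> where U: "(U, \<phi>) \<in> A" "p \<in> U" using chart_exists[OF A(1)] by blast
    have "continuous_on (U \<inter> W) (\<lambda>q. (f \<circ> inv_into U \<phi>) (\<phi> q))"
      by (rule continuous_on_compose2[OF smooth_on_continuous_on[OF smooth_fun_in_chart[OF f U(1)]]])
        (use chart_continuous[OF A(1) U(1)] in \<open>auto intro: continuous_on_subset\<close>)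
    then have "continuous_on (U \<inter> W) f"
      by (rule continuous_on_eq) (use chart_inv[OF A(1) U(1)] in auto)
    then show ?thesis
      using that U A(2) chart_open[OF A(1) U(1)] by (auto simp: continuous_on_eq_continuous_at open_Int)
  qed
  then show ?thesis
    using A(2) by (simp add: continuous_on_eq_continuous_at)
qed

text \<open>Coordinates are the test functions that read off the components of a tangent
  vector.\<close>

lemma smooth_fun_coordinate:
  assumes A: "smooth_manifold A" and U: "(U, \<phi>) \<in> A"
  shows "smooth_fun A U (\<lambda>q. \<phi> q \<bullet> b)"
proof (rule smooth_fun_chartI[OF A U chart_open[OF A U] order_refl])
  have "smooth_on (\<phi> ` U) (\<lambda>x. x \<bullet> b)"
    using smooth_on_bounded_linear_compose[OF _ bounded_linear_inner_left smooth_on_ident]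
      chart_image_open[OF A U] by blast
  then show "smooth_on (\<phi> ` U) ((\<lambda>q. \<phi> q \<bullet> b) \<circ> inv_into U \<phi>)"
    by (subst smooth_on_cong[OF chart_image_open[OF A U], of _ "\<lambda>x. x \<bullet> b"])
      (use chart_inv[OF A U] in auto)
qed

lemma smooth_fun_compose:
  assumes A: "smooth_manifold A" and B: "smooth_manifold B" and F: "smooth_map A B F"
    and f: "open O'" "smooth_fun B O' f"
  shows "smooth_fun A (F -` O') (\<lambda>p. f (F p))"
proof (rule smooth_fun_local[OF A])
  have cont: "open (F -` S)" if "open S" for S
    using F that unfolding smooth_map_def by (metis continuous_on_open_vimage open_UNIV inf_top_right)
  then show "open (F -` O')" using f by blast
  fix p assume p: "p \<in> F -` O'"
  obtain U \<phi> where U: "(U, \<phi>) \<in> A" "p \<in> U" using chart_exists[OF A] by blast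
  obtain V \<psi> where V: "(V, \<psi>) \<in> B" "F p \<in> V" using chart_exists[OF B] by blast
  \<comment> \<open>On this set a chart of each manifold is available, and \<open>f\<close> composed
    with \<open>F\<close> factors through the two coordinate representations.\<close>
  define W where "W = U \<inter> F -` (V \<inter> O')"
  have W: "open W" "p \<in> W" "W \<subseteq> U" "U \<inter> W = W"
    using cont[of "V \<inter> O'"] chart_open[OF A U(1)] chart_open[OF B V(1)] f U V p unfolding W_def by auto
  have opW: "open (\<phi> ` W)"
    using chart_image_Int_open[OF A U(1) W(1)] W(4) by simp
  have "smooth_on (\<phi> ` (U \<inter> F -` V)) (\<psi> \<circ> F \<circ> inv_into U \<phi>)"
    using F U(1) V(1) unfolding smooth_map_def by fast
  then have "smooth_on (\<phi> ` W) (\<psi> \<circ> F \<circ> inv_into U \<phi>)"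
    by (rule smooth_on_subset) (auto simp: W_def)
  then have "smooth_on (\<phi> ` W) (\<lambda>x. (f \<circ> inv_into V \<psi>) ((\<psi> \<circ> F \<circ> inv_into U \<phi>) x))"
    by (rule smooth_on_compose[OF opW _ _ smooth_fun_in_chart[OF f(2) V(1)], rotated 2])
      (use chart_image_Int_open[OF B V(1) f(1)] chart_inv[OF A U(1)] in \<open>auto simp: W_def\<close>)
  then have "smooth_on (\<phi> ` W) ((\<lambda>p. f (F p)) \<circ> inv_into U \<phi>)"
    by (subst smooth_on_cong[OF opW, of _ "\<lambda>x. (f \<circ> inv_into V \<psi>) ((\<psi> \<circ> F \<circ> inv_into U \<phi>) x)"])
      (use chart_inv[OF A U(1)] chart_inv[OF B V(1)] in \<open>auto simp: W_def\<close>)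
  then show "\<exists>W'. open W' \<and> p \<in> W' \<and> smooth_fun A W' (\<lambda>p. f (F p))"
    using smooth_fun_chartI[OF A U(1) W(1,3)] W by blast
qed

text \<open>Vector fields are fields along the identity; this fact makes the rules for fields along
  a smooth map available for them.\<close>

lemma smooth_map_ident: "smooth_manifold A \<Longrightarrow> smooth_map A A (\<lambda>p. p)"
  unfolding smooth_map_def smooth_manifold_def by (auto simp: o_def)

lemma smooth_map_open_vimage: "smooth_map A B F \<Longrightarrow> open S \<Longrightarrow> open (F -` S)"
  unfolding smooth_map_def by (metis continuous_on_open_vimage open_UNIV inf_top_right)

text \<open>Tangent vectors are set to zero on functions that are not smooth near the point. For
  them to depend on germs only, this case distinction has to depend on germs only.\<close>

lemma smooth_near_cong:
  assumes A: "smooth_manifold A" and W: "open W" "p \<in> W" "\<And>q. q \<in> W \<Longrightarrow> f q = g q"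
  shows "smooth_near A p f \<longleftrightarrow> smooth_near A p g"
proof -
  have "smooth_near A p g" if f: "smooth_near A p f" and W: "\<And>q. q \<in> W \<Longrightarrow> f q = g q" for f g
  proof -
    obtain W' where W': "open W'" "p \<in> W'" "smooth_fun A W' f"
      using f unfolding smooth_near_def by blast
    then have "smooth_fun A (W \<inter> W') g"
      using smooth_fun_cong[OF A, of "W \<inter> W'" f g] smooth_fun_subset[OF W'(3), of "W \<inter> W'"] W
        \<open>open W\<close> by auto
    then show ?thesis
      unfolding smooth_near_def using \<open>open W\<close> \<open>p \<in> W\<close> W' by blast
  qed
  then show ?thesis using W(3) by metis
qed

lemma smooth_nearI: "smooth_fun A W f \<Longrightarrow> open W \<Longrightarrow> p \<in> W \<Longrightarrow> smooth_near A p f"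
  unfolding smooth_near_def by blast


subsection \<open>Tangent spaces\<close>

lemma smooth_near_has_derivative:
  assumes A: "smooth_manifold A" and U: "(U, \<phi>) \<in> A" "p \<in> U" and f: "smooth_near A p f"
  shows "(f \<circ> inv_into U \<phi> has_derivative frechet_derivative (f \<circ> inv_into U \<phi>) (at (\<phi> p))) (at (\<phi> p))"
proof -
  obtain W where W: "open W" "p \<in> W" "smooth_fun A W f"
    using f unfolding smooth_near_def by blast
  show ?thesis
    by (rule smooth_on_has_derivative[OF smooth_fun_in_chart[OF W(3) U(1)]
          chart_image_Int_open[OF A U(1) W(1)]]) (use U W in auto)
qed

lemma dir_deriv_add:
  assumes A: "smooth_manifold A" and U: "(U, \<phi>) \<in> A" "p \<in> U"
  shows "dir_deriv A (U, \<phi>) p (u + v) = dir_deriv A (U, \<phi>) p u + dir_deriv A (U, \<phi>) p v"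
  using smooth_near_has_derivative[OF assms, THEN has_derivative_linear, THEN linear_add]
  by (auto simp: dir_deriv_def fun_eq_iff)

lemma dir_deriv_scaleR:
  assumes A: "smooth_manifold A" and U: "(U, \<phi>) \<in> A" "p \<in> U"
  shows "dir_deriv A (U, \<phi>) p (c *\<^sub>R u) = c *\<^sub>R dir_deriv A (U, \<phi>) p u"
  using smooth_near_has_derivative[OF assms, THEN has_derivative_linear, THEN linear_scale]
  by (auto simp: dir_deriv_def fun_eq_iff)

lemma dir_deriv_linear:
  assumes "smooth_manifold A" "(U, \<phi>) \<in> A" "p \<in> U"
  shows "linear (dir_deriv A (U, \<phi>) p)"
  by (rule linearI) (simp_all add: dir_deriv_add[OF assms] dir_deriv_scaleR[OF assms])

text \<open>This is the chain rule for the transition map. It lets a single chart describe the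
  tangent space, whose definition collects the vectors of all charts.\<close>

lemma dir_deriv_change_chart:
  assumes A: "smooth_manifold A" and U: "(U, \<phi>) \<in> A" "p \<in> U" and V: "(V, \<psi>) \<in> A" "p \<in> V"
  shows "dir_deriv A (V, \<psi>) p u =
    dir_deriv A (U, \<phi>) p (frechet_derivative (\<phi> \<circ> inv_into V \<psi>) (at (\<psi> p)) u)"
proof
  fix f
  let ?t = "\<phi> \<circ> inv_into V \<psi>"
  note inv = chart_inv[OF A U(1)] chart_inv[OF A V(1)]
  have op: "open (\<psi> ` (V \<inter> U))"
    using chart_image_Int_open[OF A V(1) chart_open[OF A U(1)]] .
  have p: "\<psi> p \<in> \<psi> ` (V \<inter> U)" using U V by auto
  have t: "(?t has_derivative frechet_derivative ?t (at (\<psi> p))) (at (\<psi> p))"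
    by (rule smooth_on_has_derivative[OF smooth_transition[OF A V(1) U(1)] op p])
  show "dir_deriv A (V, \<psi>) p u f = dir_deriv A (U, \<phi>) p (frechet_derivative ?t (at (\<psi> p)) u) f"
  proof (cases "smooth_near A p f")
    case True
    have "((f \<circ> inv_into U \<phi>) \<circ> ?t has_derivative
        frechet_derivative (f \<circ> inv_into U \<phi>) (at (\<phi> p)) \<circ> frechet_derivative ?t (at (\<psi> p))) (at (\<psi> p))"
      by (rule diff_chain_at[OF t]) (use smooth_near_has_derivative[OF A U True] inv V in auto)
    then have "(f \<circ> inv_into V \<psi> has_derivative
        frechet_derivative (f \<circ> inv_into U \<phi>) (at (\<phi> p)) \<circ> frechet_derivative ?t (at (\<psi> p))) (at (\<psi> p))"
      by (rule has_derivative_transform_within_open[OF _ op p]) (use inv in auto)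
    then show ?thesis
      using True by (simp add: dir_deriv_def frechet_derivative_at[symmetric])
  qed (simp add: dir_deriv_def)
qed

lemma tangent_space_chart:
  assumes A: "smooth_manifold A" and U: "(U, \<phi>) \<in> A" "p \<in> U"
  shows "tangent_space A p = range (dir_deriv A (U, \<phi>) p)"
proof
  show "range (dir_deriv A (U, \<phi>) p) \<subseteq> tangent_space A p"
    unfolding tangent_space_def using U by force
  show "tangent_space A p \<subseteq> range (dir_deriv A (U, \<phi>) p)"
    unfolding tangent_space_def using dir_deriv_change_chart[OF assms] by fastforce
qed

lemma subspace_tangent_space:
  assumes A: "smooth_manifold A" shows "subspace (tangent_space A p)"
proof -
  obtain U \<phi> where U: "(U, \<phi>) \<in> A" "p \<in> U" using chart_exists[OF A] by blast
  show ?thesis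
    unfolding tangent_space_chart[OF A U]
    by (rule linear_subspace_image[OF dir_deriv_linear[OF A U] subspace_UNIV])
qed

lemma tangent_local:
  assumes A: "smooth_manifold A" and v: "v \<in> tangent_space A p"
    and W: "open W" "p \<in> W" "\<And>q. q \<in> W \<Longrightarrow> f q = g q"
  shows "v f = v g"
proof -
  obtain U \<phi> where U: "(U, \<phi>) \<in> A" "p \<in> U" using chart_exists[OF A] by blast
  then obtain u where v: "v = dir_deriv A (U, \<phi>) p u"
    using v tangent_space_chart[OF A U] by auto
  have "frechet_derivative (f \<circ> inv_into U \<phi>) (at (\<phi> p)) = frechet_derivative (g \<circ> inv_into U \<phi>) (at (\<phi> p))"
    by (rule frechet_derivative_cong_open[OF chart_image_Int_open[OF A U(1) W(1)]])
      (use U W chart_inv[OF A U(1)] in auto)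
  then show ?thesis
    unfolding v dir_deriv_def using smooth_near_cong[OF A W] by simp
qed

lemma tangent_const:
  assumes A: "smooth_manifold A" and v: "v \<in> tangent_space A p"
  shows "v (\<lambda>q. c) = 0"
  using v by (auto simp: tangent_space_def dir_deriv_def o_def frechet_derivative_const)

lemma dir_deriv_coordinate:
  assumes A: "smooth_manifold A" and U: "(U, \<phi>) \<in> A" "p \<in> U"
  shows "dir_deriv A (U, \<phi>) p u (\<lambda>q. \<phi> q \<bullet> b) = u \<bullet> b"
proof -
  have "((\<lambda>x. x \<bullet> b) has_derivative (\<lambda>u. u \<bullet> b)) (at (\<phi> p))"
    by (intro bounded_linear_imp_has_derivative bounded_linear_inner_left)
  then have "((\<lambda>q. \<phi> q \<bullet> b) \<circ> inv_into U \<phi> has_derivative (\<lambda>u. u \<bullet> b)) (at (\<phi> p))"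
    by (rule has_derivative_transform_within_open[OF _ chart_image_open[OF A U(1)]])
      (use U chart_inv[OF A U(1)] in auto)
  then show ?thesis
    using smooth_nearI[OF smooth_fun_coordinate[OF A U(1)] chart_open[OF A U(1)] U(2)]
    by (simp add: dir_deriv_def frechet_derivative_at[symmetric])
qed

text \<open>The coordinate functions recover every component of \<open>u\<close>. Together with
  linearity this fixes the dimension of the tangent space.\<close>

lemma dir_deriv_inj:
  assumes A: "smooth_manifold A" and U: "(U, \<phi>) \<in> A" "p \<in> U"
  shows "inj (dir_deriv A (U, \<phi>) p)"
  by (rule injI) (metis dir_deriv_coordinate[OF assms] euclidean_eqI)

text \<open>The coefficients are values of \<open>v\<close> on fixed functions, hence smooth when
  \<open>v\<close> varies smoothly; the smoothness of products with pushed-forward fields rests on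
  this.\<close>

lemma tangent_coordinates:
  assumes A: "smooth_manifold A" and U: "(U, \<phi>) \<in> A" "p \<in> U" and v: "v \<in> tangent_space A p"
  shows "v = (\<Sum>b\<in>Basis. v (\<lambda>q. \<phi> q \<bullet> b) *\<^sub>R dir_deriv A (U, \<phi>) p b)"
proof -
  obtain u where u: "v = dir_deriv A (U, \<phi>) p u"
    using v tangent_space_chart[OF A U] by auto
  interpret linear "dir_deriv A (U, \<phi>) p" by (rule dir_deriv_linear[OF A U])
  have "v = dir_deriv A (U, \<phi>) p (\<Sum>b\<in>Basis. (u \<bullet> b) *\<^sub>R b)"
    by (simp add: u euclidean_representation)
  also have "\<dots> = (\<Sum>b\<in>Basis. (u \<bullet> b) *\<^sub>R dir_deriv A (U, \<phi>) p b)"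
    by (simp only: sum scale)
  also have "\<dots> = (\<Sum>b\<in>Basis. v (\<lambda>q. \<phi> q \<bullet> b) *\<^sub>R dir_deriv A (U, \<phi>) p b)"
    by (simp only: u dir_deriv_coordinate[OF A U])
  finally show ?thesis .
qed


subsection \<open>Vector fields\<close>

lemma fields_along_tangent: "Z \<in> fields_along A B F W \<Longrightarrow> p \<in> W \<Longrightarrow> Z p \<in> tangent_space B (F p)"
  unfolding fields_along_def by blast

lemma fields_along_smooth:
  "Z \<in> fields_along A B F W \<Longrightarrow> open O' \<Longrightarrow> smooth_fun B O' f \<Longrightarrow>
    smooth_fun A (W \<inter> F -` O') (\<lambda>p. Z p f)"
  unfolding fields_along_def by blast

lemma vector_fields_smooth:
  "X \<in> vector_fields A W \<Longrightarrow> open O' \<Longrightarrow> smooth_fun A O' f \<Longrightarrow> smooth_fun A (W \<inter> O') (\<lambda>p. X p f)"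
  using fields_along_smooth[of X A A "\<lambda>p. p" W O' f] by simp

lemma fields_along_cong:
  assumes A: "smooth_manifold A" and F: "smooth_map A B F"
    and W: "open W" "\<And>p. p \<in> W \<Longrightarrow> Z p = Z' p"
  shows "Z \<in> fields_along A B F W \<longleftrightarrow> Z' \<in> fields_along A B F W"
proof -
  have "smooth_fun A (W \<inter> F -` O') (\<lambda>p. Z p f) \<longleftrightarrow> smooth_fun A (W \<inter> F -` O') (\<lambda>p. Z' p f)"
    if "open O'" for O' f
    by (rule smooth_fun_cong[OF A]) (use W smooth_map_open_vimage[OF F that] in auto)
  then show ?thesis
    unfolding fields_along_def using W(2) by simp
qed

lemma fields_along_subset:
  assumes "Z \<in> fields_along A B F W" "W' \<subseteq> W"
  shows "Z \<in> fields_along A B F W'"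
proof -
  have "smooth_fun A (W' \<inter> F -` O') (\<lambda>p. Z p f)" if "open O'" "smooth_fun B O' f" for O' f
    by (rule smooth_fun_subset[OF fields_along_smooth[OF assms(1) that]]) (use assms(2) in auto)
  then show ?thesis
    unfolding fields_along_def using fields_along_tangent[OF assms(1)] assms(2) by auto
qed

lemma fields_along_local:
  assumes A: "smooth_manifold A" and F: "smooth_map A B F" and W: "open W"
    and loc: "\<And>p. p \<in> W \<Longrightarrow> \<exists>W'. open W' \<and> p \<in> W' \<and> Z \<in> fields_along A B F W'"
  shows "Z \<in> fields_along A B F W"
proof -
  have "smooth_fun A (W \<inter> F -` O') (\<lambda>p. Z p f)" if f: "open O'" "smooth_fun B O' f" for O' f
  proof (rule smooth_fun_local[OF A])
    show "open (W \<inter> F -` O')" using W smooth_map_open_vimage[OF F f(1)] by auto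
    fix p assume p: "p \<in> W \<inter> F -` O'"
    then obtain W' where W': "open W'" "p \<in> W'" "Z \<in> fields_along A B F W'" using loc by blast
    then show "\<exists>W'. open W' \<and> p \<in> W' \<and> smooth_fun A W' (\<lambda>p. Z p f)"
      using fields_along_smooth[OF W'(3) f] smooth_map_open_vimage[OF F f(1)] p
      by (metis IntD2 IntI open_Int)
  qed
  then show ?thesis
    unfolding fields_along_def using loc fields_along_tangent by fastforce
qed

lemma fields_along_zero:
  assumes A: "smooth_manifold A" and B: "smooth_manifold B" and F: "smooth_map A B F" and W: "open W"
  shows "(\<lambda>p. 0) \<in> fields_along A B F W"
  unfolding fields_along_def using subspace_0[OF subspace_tangent_space[OF B]]
    smooth_fun_const[OF A open_Int[OF W smooth_map_open_vimage[OF F]]] by simp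

lemma fields_along_add:
  assumes A: "smooth_manifold A" and B: "smooth_manifold B" and F: "smooth_map A B F" and W: "open W"
    and Z: "Z \<in> fields_along A B F W" "Z' \<in> fields_along A B F W"
  shows "(\<lambda>p. Z p + Z' p) \<in> fields_along A B F W"
proof -
  have "smooth_fun A (W \<inter> F -` O') (\<lambda>p. (Z p + Z' p) f)" if "open O'" "smooth_fun B O' f" for O' f
    using smooth_fun_add[OF A _ fields_along_smooth[OF Z(1) that] fields_along_smooth[OF Z(2) that]]
      W smooth_map_open_vimage[OF F that(1)] by auto
  then show ?thesis
    unfolding fields_along_def
    using Z[THEN fields_along_tangent] subspace_add[OF subspace_tangent_space[OF B]] by auto
qed

lemma fields_along_scaleR:
  assumes A: "smooth_manifold A" and B: "smooth_manifold B" and F: "smooth_map A B F" and W: "open W"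
    and h: "smooth_fun A W h" and Z: "Z \<in> fields_along A B F W"
  shows "(\<lambda>p. h p *\<^sub>R Z p) \<in> fields_along A B F W"
proof -
  have "smooth_fun A (W \<inter> F -` O') (\<lambda>p. (h p *\<^sub>R Z p) f)" if "open O'" "smooth_fun B O' f" for O' f
    using smooth_fun_mult[OF A _ smooth_fun_subset[OF h] fields_along_smooth[OF Z that]]
      W smooth_map_open_vimage[OF F that(1)] by auto
  then show ?thesis
    unfolding fields_along_def
    using fields_along_tangent[OF Z] subspace_scale[OF subspace_tangent_space[OF B]] by auto
qed

lemma fields_along_sum:
  assumes A: "smooth_manifold A" and B: "smooth_manifold B" and F: "smooth_map A B F" and W: "open W"
    and Z: "\<And>i. i \<in> X \<Longrightarrow> Z i \<in> fields_along A B F W"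
  shows "(\<lambda>p. \<Sum>i\<in>X. Z i p) \<in> fields_along A B F W"
  using Z
  by (induction X rule: infinite_finite_induct)
    (simp_all add: fields_along_zero[OF A B F W] fields_along_add[OF A B F W])

lemma fields_along_compose:
  assumes A: "smooth_manifold A" and B: "smooth_manifold B" and F: "smooth_map A B F"
    and Y: "Y \<in> vector_fields B W" "open W"
  shows "(\<lambda>p. Y (F p)) \<in> fields_along A B F (F -` W)"
proof -
  have "smooth_fun A (F -` W \<inter> F -` O') (\<lambda>p. Y (F p) f)" if "open O'" "smooth_fun B O' f" for O' f
    using smooth_fun_compose[OF A B F _ vector_fields_smooth[OF Y(1) that]] Y(2) that by auto
  then show ?thesis
    using fields_along_tangent[OF Y(1)] unfolding fields_along_def by auto
qed

lemma coordinate_field: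
  assumes A: "smooth_manifold A" and U: "(U, \<phi>) \<in> A"
  shows "(\<lambda>p. dir_deriv A (U, \<phi>) p u) \<in> vector_fields A U"
proof -
  have "smooth_fun A (U \<inter> O') (\<lambda>p. dir_deriv A (U, \<phi>) p u f)"
    if f: "open O'" "smooth_fun A O' f" for O' f
  proof (rule smooth_fun_chartI[OF A U])
    show "open (U \<inter> O')" using chart_open[OF A U] f by auto
    have op: "open (\<phi> ` (U \<inter> O'))" by (rule chart_image_Int_open[OF A U f(1)])
    have "smooth_on (\<phi> ` (U \<inter> O')) (\<lambda>x. frechet_derivative (f \<circ> inv_into U \<phi>) (at x) u)"
      by (rule smooth_on_frechet_derivative[OF smooth_fun_in_chart[OF f(2) U] op])
    then show "smooth_on (\<phi> ` (U \<inter> O')) ((\<lambda>p. dir_deriv A (U, \<phi>) p u f) \<circ> inv_into U \<phi>)"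
      by (subst smooth_on_cong[OF op, of _ "\<lambda>x. frechet_derivative (f \<circ> inv_into U \<phi>) (at x) u"])
        (use chart_inv[OF A U] smooth_nearI[OF f(2,1)] in \<open>auto simp: dir_deriv_def\<close>)
  qed auto
  then show ?thesis
    unfolding fields_along_def using tangent_space_chart[OF A U] by auto
qed

text \<open>The field is cut off by a bump function. Being a pointwise multiple of \<open>X\<close>,
  the result stays in any subbundle containing \<open>X\<close>, and since only a nonzero factor at
  \<open>p\<close> is asked for, no bump function equal to 1 near \<open>p\<close> has to be
  made.\<close>

lemma global_field_exists:
  assumes A: "smooth_manifold A" and W: "open W" "p \<in> W" and X: "X \<in> vector_fields A W"
  obtains V c where "V \<in> vector_fields A UNIV" "\<And>q. q \<notin> W \<Longrightarrow> V q = 0"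
    "\<And>q. q \<in> W \<Longrightarrow> \<exists>c. V q = c *\<^sub>R X q" "(c::real) \<noteq> 0" "V p = c *\<^sub>R X p"
proof -
  note id = smooth_map_ident[OF A]
  obtain U \<phi> where U: "(U, \<phi>) \<in> A" "p \<in> U" using chart_exists[OF A] by blast
  note inv = chart_inv[OF A U(1)]
  obtain r where r: "r > 0" "cball (\<phi> p) r \<subseteq> \<phi> ` (U \<inter> W)"
    using chart_image_Int_open[OF A U(1) W(1)] U W by (metis IntI imageI open_contains_cball)
  define h where "h q = (\<phi> q - \<phi> p) \<bullet> (\<phi> q - \<phi> p)" for q
  \<comment> \<open>Inside the chart \<open>h\<close> is the squared coordinate distance from
    \<open>p\<close>, so this factor is positive exactly on the coordinate ball of radius
    \<open>r\<close>.\<close>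
  define \<rho> where "\<rho> q = flat_exp 0 (r\<^sup>2 - h q)" for q
  define V where "V q = (if q \<in> U \<inter> W then \<rho> q *\<^sub>R X q else 0)" for q
  \<comment> \<open>A compact set in a Hausdorff space is closed. Hence \<open>U \<inter> W\<close>
    and the complement of \<open>S\<close> form an open cover: on the former \<open>V\<close> is a
    product of smooth objects, on the latter it is zero.\<close>
  define S where "S = inv_into U \<phi> ` cball (\<phi> p) r"
  have S: "closed S" "S \<subseteq> U \<inter> W"
    unfolding S_def using r(2) inv chart_inv_continuous[OF A U(1)]
    by (auto intro!: compact_imp_closed compact_continuous_image intro: continuous_on_subset)
  have opUW: "open (U \<inter> W)" using W chart_open[OF A U(1)] by auto
  have "smooth_fun A U (\<lambda>q. r\<^sup>2 + (-1) * (\<Sum>b\<in>Basis. (\<phi> q \<bullet> b + (- \<phi> p \<bullet> b)) * (\<phi> q \<bullet> b + (- \<phi> p \<bullet> b))))"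
    by (intro smooth_fun_add smooth_fun_mult smooth_fun_sum smooth_fun_const A chart_open[OF A U(1)]
        smooth_fun_coordinate U(1))
  then have "smooth_fun A U (\<lambda>q. r\<^sup>2 - h q)"
    unfolding h_def by (subst (1) euclidean_inner) (simp add: inner_diff_left)
  then have "smooth_fun A U \<rho>"
    unfolding \<rho>_def using smooth_fun_compose_real[OF A chart_open[OF A U(1)], of _ UNIV "flat_exp 0"]
    by (simp add: smooth_on_def C_k_on_flat_exp)
  then have "(\<lambda>q. \<rho> q *\<^sub>R X q) \<in> vector_fields A (U \<inter> W)"
    using fields_along_scaleR[OF A A id opUW smooth_fun_subset fields_along_subset[OF X]] by auto
  then have V1: "V \<in> vector_fields A (U \<inter> W)"
    by (subst fields_along_cong[OF A id opUW]) (auto simp: V_def)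
  have "V q = 0" if "q \<notin> S" for q
  proof (cases "q \<in> U \<inter> W")
    case True
    then have "\<phi> q \<notin> cball (\<phi> p) r"
      using that inv unfolding S_def by (metis IntD1 imageI)
    then have "dist (\<phi> q) (\<phi> p) > r" by (simp add: dist_commute)
    then have "h q > r\<^sup>2"
      unfolding h_def using r(1) by (simp add: power2_norm_eq_inner[symmetric] dist_norm power_strict_mono)
    then show ?thesis
      by (simp add: V_def \<rho>_def flat_exp_def)
  qed (auto simp: V_def)
  then have V2: "V \<in> vector_fields A (- S)"
    using fields_along_cong[OF A id, of "- S" V "\<lambda>_. 0"] fields_along_zero[OF A A id] S by auto
  have V: "V \<in> vector_fields A UNIV"
  proof (rule fields_along_local[OF A id open_UNIV])
    fix q show "\<exists>W'. open W' \<and> q \<in> W' \<and> V \<in> vector_fields A W'"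
      using V1 V2 S opUW by (cases "q \<in> S") auto
  qed
  show thesis
  proof (rule that[OF V])
    show "\<rho> p \<noteq> 0" using r by (simp add: \<rho>_def h_def flat_exp_def)
  qed (use U W in \<open>auto simp: V_def intro: exI[of _ 0]\<close>)
qed

subsection \<open>Inner products on subspaces\<close>

lemma linear_on_subspaceD:
  assumes "linear_on_subspace S L"
  shows "v \<in> S \<Longrightarrow> w \<in> S \<Longrightarrow> L (v + w) = L v + L w"
    and "v \<in> S \<Longrightarrow> L (c *\<^sub>R v) = c *\<^sub>R L v"
  using assms unfolding linear_on_subspace_def by auto

lemma linear_on_subspace_zero: "linear_on_subspace S L \<Longrightarrow> v \<in> S \<Longrightarrow> L 0 = 0"
  using linear_on_subspaceD(2)[of S L v 0] by simp

lemma linear_on_subspace_sum: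
  assumes "linear_on_subspace S L" "subspace S" "\<And>i. i \<in> X \<Longrightarrow> v i \<in> S"
  shows "L (\<Sum>i\<in>X. v i) = (\<Sum>i\<in>X. L (v i))"
  using assms(3)
  by (induction X rule: infinite_finite_induct)
    (auto simp: linear_on_subspace_zero[OF assms(1) subspace_0[OF assms(2)]]
      linear_on_subspaceD(1)[OF assms(1)] subspace_sum[OF assms(2)])

text \<open>A tangent space is a subspace of a space of functionals, and the metric is constrained
  only on that subspace. Linear algebra is therefore developed relative to a carrier
  \<open>S\<close>.\<close>

locale inner_on =
  fixes S :: "'v::real_vector set" and h :: "'v \<Rightarrow> 'v \<Rightarrow> real"
  assumes subspace: "subspace S"
    and linear_left: "w \<in> S \<Longrightarrow> linear_on_subspace S (\<lambda>v. h v w)"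
    and sym: "v \<in> S \<Longrightarrow> w \<in> S \<Longrightarrow> h v w = h w v"
    and pos: "v \<in> S \<Longrightarrow> v \<noteq> 0 \<Longrightarrow> h v v > 0"
begin

lemmas mem = subspace_0[OF subspace] subspace_add[OF subspace] subspace_scale[OF subspace]
  subspace_diff[OF subspace] subspace_neg[OF subspace]

lemma add_left: "v \<in> S \<Longrightarrow> v' \<in> S \<Longrightarrow> w \<in> S \<Longrightarrow> h (v + v') w = h v w + h v' w"
  using linear_on_subspaceD(1)[OF linear_left] by blast

lemma scale_left: "v \<in> S \<Longrightarrow> w \<in> S \<Longrightarrow> h (c *\<^sub>R v) w = c * h v w"
  using linear_on_subspaceD(2)[OF linear_left] by auto

lemma add_right: "v \<in> S \<Longrightarrow> v' \<in> S \<Longrightarrow> w \<in> S \<Longrightarrow> h w (v + v') = h w v + h w v'"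
  using add_left sym mem by metis

lemma scale_right: "v \<in> S \<Longrightarrow> w \<in> S \<Longrightarrow> h w (c *\<^sub>R v) = c * h w v"
  using scale_left sym mem by metis

lemma minus_left: "v \<in> S \<Longrightarrow> w \<in> S \<Longrightarrow> h (- v) w = - h v w"
  using scale_left[of v w "-1"] by simp

lemma minus_right: "v \<in> S \<Longrightarrow> w \<in> S \<Longrightarrow> h w (- v) = - h w v"
  using scale_right[of v w "-1"] by simp

lemma diff_left: "v \<in> S \<Longrightarrow> v' \<in> S \<Longrightarrow> w \<in> S \<Longrightarrow> h (v - v') w = h v w - h v' w"
  using add_left[of v "- v'" w] minus_left[of v' w] mem by simp

lemma zero_left: "w \<in> S \<Longrightarrow> h 0 w = 0"
  using scale_left[of w w 0] by simp

lemma sum_left: "(\<And>i. i \<in> X \<Longrightarrow> v i \<in> S) \<Longrightarrow> w \<in> S \<Longrightarrow> h (\<Sum>i\<in>X. v i) w = (\<Sum>i\<in>X. h (v i) w)"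
  using linear_on_subspace_sum[OF linear_left subspace] by blast

lemma sum_right:
  assumes "\<And>i. i \<in> X \<Longrightarrow> v i \<in> S" "w \<in> S"
  shows "h w (\<Sum>i\<in>X. v i) = (\<Sum>i\<in>X. h w (v i))"
proof -
  have "h w (\<Sum>i\<in>X. v i) = h (\<Sum>i\<in>X. v i) w"
    using assms by (intro sym subspace_sum[OF subspace])
  also have "\<dots> = (\<Sum>i\<in>X. h (v i) w)"
    by (rule sum_left[OF assms])
  also have "\<dots> = (\<Sum>i\<in>X. h w (v i))"
    using assms sym by (intro sum.cong refl) blast
  finally show ?thesis .
qed

lemma eq_zero: "v \<in> S \<Longrightarrow> h v v = 0 \<Longrightarrow> v = 0"
  using pos by fastforce

section \<open>Orthonormal families: expansion, Parseval identity, traces\<close>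

definition orthonormal :: "'i set \<Rightarrow> ('i \<Rightarrow> 'v) \<Rightarrow> bool" where
  "orthonormal X e \<longleftrightarrow> finite X \<and> (\<forall>i\<in>X. e i \<in> S) \<and>
    (\<forall>i\<in>X. \<forall>j\<in>X. h (e i) (e j) = (if i = j then 1 else 0))"

lemma orthonormalD:
  assumes "orthonormal X e"
  shows "finite X" "i \<in> X \<Longrightarrow> e i \<in> S"
    "i \<in> X \<Longrightarrow> j \<in> X \<Longrightarrow> h (e i) (e j) = (if i = j then 1 else 0)"
  using assms unfolding orthonormal_def by auto

lemma combination_mem:
  assumes "orthonormal X e" shows "(\<Sum>i\<in>X. c i *\<^sub>R e i) \<in> S"
  using orthonormalD[OF assms] mem by (intro subspace_sum[OF subspace]) auto

lemma orthonormal_coefficient: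
  assumes e: "orthonormal X e" and i: "i \<in> X"
  shows "h (\<Sum>j\<in>X. c j *\<^sub>R e j) (e i) = c i"
proof -
  have "h (\<Sum>j\<in>X. c j *\<^sub>R e j) (e i) = (\<Sum>j\<in>X. h (c j *\<^sub>R e j) (e i))"
    using orthonormalD[OF e] i mem by (intro sum_left) auto
  also have "\<dots> = (\<Sum>j\<in>X. if j = i then c j else 0)"
    using orthonormalD[OF e] i by (intro sum.cong refl) (simp add: scale_left)
  finally show ?thesis
    using orthonormalD(1)[OF e] i by simp
qed

lemma orthonormal_expand:
  assumes e: "orthonormal X e" and v: "v \<in> span (e ` X)"
  shows "v = (\<Sum>i\<in>X. h v (e i) *\<^sub>R e i)"
proof -
  note e' = orthonormalD[OF e]
  \<comment> \<open>The vectors equal to their own expansion form a subspace containing every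
    \<open>e i\<close>, hence the whole span.\<close>
  let ?T = "{v \<in> S. v = (\<Sum>i\<in>X. h v (e i) *\<^sub>R e i)}"
  have "e i \<in> ?T" if "i \<in> X" for i
  proof -
    have "(\<Sum>j\<in>X. h (e i) (e j) *\<^sub>R e j) = (\<Sum>j\<in>X. if j = i then e j else 0)"
      using e'(3) that by (intro sum.cong) auto
    then show ?thesis
      using that e'(1,2) by simp
  qed
  moreover have "subspace ?T"
  proof (rule subspaceI)
    show "0 \<in> ?T"
      using e'(2) by (simp add: mem zero_left)
    show "v + w \<in> ?T" if "v \<in> ?T" "w \<in> ?T" for v w
    proof -
      have "(\<Sum>i\<in>X. h (v + w) (e i) *\<^sub>R e i) = (\<Sum>i\<in>X. h v (e i) *\<^sub>R e i) + (\<Sum>i\<in>X. h w (e i) *\<^sub>R e i)"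
        unfolding sum.distrib[symmetric] using that e'(2)
        by (intro sum.cong) (auto simp: add_left scaleR_add_left)
      then show ?thesis using that by (auto simp: mem)
    qed
    show "c *\<^sub>R v \<in> ?T" if "v \<in> ?T" for v c
    proof -
      have "(\<Sum>i\<in>X. h (c *\<^sub>R v) (e i) *\<^sub>R e i) = c *\<^sub>R (\<Sum>i\<in>X. h v (e i) *\<^sub>R e i)"
        unfolding scaleR_sum_right using that e'(2) by (intro sum.cong) (auto simp: scale_left)
      then show ?thesis using that by (auto simp: mem)
    qed
  qed
  ultimately have "span (e ` X) \<subseteq> ?T"
    by (intro span_minimal) auto
  then show ?thesis using v by blast
qed

lemma orthonormal_inj: "orthonormal X e \<Longrightarrow> inj_on e X"
  using orthonormalD(3)[of X e] by (intro inj_onI) (metis zero_neq_one)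

lemma orthonormal_independent:
  assumes e: "orthonormal X e" shows "independent (e ` X)"
proof (rule independent_if_scalars_zero)
  show "finite (e ` X)" using orthonormalD(1)[OF e] by blast
  fix c x assume 0: "(\<Sum>x\<in>e ` X. c x *\<^sub>R x) = 0" and "x \<in> e ` X"
  then obtain i where i: "i \<in> X" "x = e i" by blast
  have "(\<Sum>j\<in>X. c (e j) *\<^sub>R e j) = 0"
    using 0 by (simp add: sum.reindex[OF orthonormal_inj[OF e]])
  then show "c x = 0"
    using orthonormal_coefficient[OF e i(1), of "\<lambda>j. c (e j)"] zero_left orthonormalD(2)[OF e i(1)] i
    by simp
qed

lemma orthonormal_parseval:
  assumes e: "orthonormal X e" and v: "v \<in> S" "w \<in> span (e ` X)"
  shows "(\<Sum>i\<in>X. h (e i) v * h (e i) w) = h v w"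
proof -
  note e' = orthonormalD[OF e]
  have w: "w \<in> S"
    using v(2) span_minimal[OF _ subspace, of "e ` X"] e'(2) by blast
  have "h v w = h v (\<Sum>i\<in>X. h w (e i) *\<^sub>R e i)"
    using orthonormal_expand[OF e v(2)] by simp
  also have "\<dots> = (\<Sum>i\<in>X. h w (e i) * h v (e i))"
    using e'(2) v(1) by (subst sum_right) (auto simp: mem scale_right)
  finally show ?thesis
    using e'(2) v(1) w sym by (simp add: mult.commute)
qed

text \<open>The trace of a bilinear form does not depend on the orthonormal basis: by Parseval in
  \<open>f\<close>, the sum over \<open>i\<close> of the coefficient products is
  \<open>h (e a) (e b)\<close>. Bilinearity enters as the expansion \<open>expand\<close>, because
  the form to be traced is given on fields rather than on vectors.\<close>

lemma orthonormal_trace: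
  assumes e: "orthonormal X e" and f: "orthonormal Y f" and span: "S = span (e ` X)" "S = span (f ` Y)"
    and expand: "\<And>i. i \<in> Y \<Longrightarrow> \<beta> i = (\<Sum>a\<in>X. \<Sum>b\<in>X. (h (f i) (e a) * h (f i) (e b)) *\<^sub>R \<gamma> a b)"
  shows "(\<Sum>i\<in>Y. \<beta> i) = (\<Sum>a\<in>X. \<gamma> a a :: 'w::real_vector)"
proof -
  note e' = orthonormalD[OF e]
  have "(\<Sum>i\<in>Y. \<beta> i) = (\<Sum>i\<in>Y. \<Sum>a\<in>X. \<Sum>b\<in>X. (h (f i) (e a) * h (f i) (e b)) *\<^sub>R \<gamma> a b)"
    using expand by simp
  also have "\<dots> = (\<Sum>a\<in>X. \<Sum>b\<in>X. (\<Sum>i\<in>Y. h (f i) (e a) * h (f i) (e b)) *\<^sub>R \<gamma> a b)"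
    by (simp add: scaleR_sum_left sum.swap[of _ X Y])
  also have "\<dots> = (\<Sum>a\<in>X. \<Sum>b\<in>X. if b = a then \<gamma> a b else 0)"
    using e'(2) span by (intro sum.cong refl) (simp add: orthonormal_parseval[OF f] e'(3))
  also have "\<dots> = (\<Sum>a\<in>X. \<gamma> a a)"
    using e'(1) by simp
  finally show ?thesis .
qed

section \<open>Orthogonal projections and complements\<close>

lemma orth_proj_eq:
  assumes T: "subspace T" "T \<subseteq> S" and v: "v \<in> S" and w: "w \<in> T" "\<And>u. u \<in> T \<Longrightarrow> h (v - w) u = 0"
  shows "orth_proj h T v = w"
  unfolding orth_proj_def
proof (rule the_equality)
  fix w' assume w': "w' \<in> T \<and> (\<forall>u\<in>T. h (v - w') u = 0)"
  have d: "w' - w \<in> T" using subspace_diff[OF T(1)] w' w(1) by blast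
  \<comment> \<open>Two candidates differ by an element of \<open>T\<close> that is orthogonal to
    \<open>T\<close>, in particular to itself.\<close>
  have "h ((v - w) - (v - w')) (w' - w) = h (v - w) (w' - w) - h (v - w') (w' - w)"
    using v w' w(1) d T(2) by (intro diff_left) (auto intro: mem)
  also have "\<dots> = 0" using w w' d by simp
  finally show "w' = w"
    using eq_zero[of "w' - w"] d T(2) by auto
qed (use w in blast)

lemma orth_proj_self: "subspace T \<Longrightarrow> T \<subseteq> S \<Longrightarrow> v \<in> T \<Longrightarrow> orth_proj h T v = v"
  by (rule orth_proj_eq) (auto simp: zero_left)

lemma subspace_orth_compl:
  assumes "subspace E" "E \<subseteq> S" "T \<subseteq> S" shows "subspace (orth_compl h T E)"
  unfolding orth_compl_def
  by (rule subspaceI)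
    (use assms in \<open>auto simp: add_left scale_left zero_left subset_iff
        subspace_0 subspace_add subspace_scale\<close>)

text \<open>This serves both the Gram-Schmidt step and the projection that removes the components
  along the image of the vertical space under \<open>R\<close>.\<close>

lemma orthonormal_residual:
  assumes e: "orthonormal X e" and v: "v \<in> S" and u: "u \<in> span (e ` X)"
  shows "h (v - (\<Sum>i\<in>X. h v (e i) *\<^sub>R e i)) u = 0"
proof -
  let ?w = "v - (\<Sum>i\<in>X. h v (e i) *\<^sub>R e i)"
  note e' = orthonormalD[OF e]
  have w: "?w \<in> S" using mem(4)[OF v combination_mem[OF e]] .
  have "h ?w (e i) = 0" if "i \<in> X" for i
    using diff_left[OF v combination_mem[OF e] e'(2)[OF that]] orthonormal_coefficient[OF e that] by simp
  then have "h ?w (\<Sum>i\<in>X. h u (e i) *\<^sub>R e i) = 0"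
    using e'(2) w by (subst sum_right) (auto simp: mem(3) scale_right)
  then show ?thesis
    using orthonormal_expand[OF e u] by simp
qed

end

lemma riemannian_inner_on:
  assumes "riemannian_manifold A g"
  shows "inner_on (tangent_space A p) (g p)"
  using assms subspace_tangent_space[of A p]
  unfolding inner_on_def riemannian_manifold_def riemannian_metric_def by meson

lemma smooth_metric:
  "riemannian_manifold A g \<Longrightarrow> open W \<Longrightarrow> X \<in> vector_fields A W \<Longrightarrow> Y \<in> vector_fields A W \<Longrightarrow>
    smooth_fun A W (\<lambda>p. g p (X p) (Y p))"
  unfolding riemannian_manifold_def riemannian_metric_def by blast


subsection \<open>Local orthonormal frames\<close>

text \<open>In contrast to \<open>orthonormal_frame\<close> no span is prescribed, so that the
  incomplete families met during Gram-Schmidt are covered.\<close>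

definition orthonormal_fields ::
    "('m::topological_space, 'e::euclidean_space) atlas \<Rightarrow> 'm metric \<Rightarrow> 'm set \<Rightarrow> nat \<Rightarrow>
     (nat \<Rightarrow> 'm \<Rightarrow> 'm tvec) \<Rightarrow> bool" where
  "orthonormal_fields A g W n e \<longleftrightarrow> open W \<and> (\<forall>i<n. e i \<in> vector_fields A W) \<and>
     (\<forall>p\<in>W. inner_on.orthonormal (tangent_space A p) (g p) {..<n} (\<lambda>i. e i p))"

lemma orthonormal_fieldsD:
  assumes "orthonormal_fields A g W n e"
  shows "open W" "i < n \<Longrightarrow> e i \<in> vector_fields A W"
    "p \<in> W \<Longrightarrow> inner_on.orthonormal (tangent_space A p) (g p) {..<n} (\<lambda>i. e i p)"
  using assms unfolding orthonormal_fields_def by auto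

lemma orthonormal_fields_subset:
  "orthonormal_fields A g W n e \<Longrightarrow> open W' \<Longrightarrow> W' \<subseteq> W \<Longrightarrow> orthonormal_fields A g W' n e"
  unfolding orthonormal_fields_def using fields_along_subset by blast

lemma orthonormal_fields_frame:
  assumes g: "riemannian_manifold A g" and e: "orthonormal_frame A g E W n e"
  shows "orthonormal_fields A g W n e"
  unfolding orthonormal_fields_def
proof (intro conjI ballI)
  fix p assume p: "p \<in> W"
  interpret inner_on "tangent_space A p" "g p" by (rule riemannian_inner_on[OF g])
  show "orthonormal {..<n} (\<lambda>i. e i p)"
    using e p fields_along_tangent[of "e _" A A "\<lambda>p. p" W p]
    unfolding orthonormal_def orthonormal_frame_def sections_def by auto
qed (use e in \<open>auto simp: orthonormal_frame_def sections_def\<close>)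

lemma tangent_space_dim:
  assumes A: "smooth_manifold (A :: ('m::{t2_space, second_countable_topology}, 'e::euclidean_space) atlas)"
  obtains T where "finite T" "card T = DIM('e)" "span T = tangent_space A p" "independent T"
proof -
  obtain U \<phi> where U: "(U, \<phi>) \<in> A" "p \<in> U" using chart_exists[OF A] by blast
  note lin = dir_deriv_linear[OF A U]
  show thesis
  proof
    show "card (dir_deriv A (U, \<phi>) p ` Basis) = DIM('e)"
      using dir_deriv_inj[OF A U] by (intro card_image) (meson inj_on_subset subset_UNIV)
    show "span (dir_deriv A (U, \<phi>) p ` Basis) = tangent_space A p"
      by (simp add: linear_span_image[OF lin] tangent_space_chart[OF A U])
    show "independent (dir_deriv A (U, \<phi>) p ` Basis)"
      by (rule linear_independent_injective_image[OF lin independent_Basis])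
        (meson dir_deriv_inj[OF A U] inj_on_subset subset_UNIV)
  qed simp
qed

lemma orthonormal_card_le:
  fixes A :: "('m::{t2_space, second_countable_topology}, 'e::euclidean_space) atlas"
  assumes g: "riemannian_manifold A g" and e: "inner_on.orthonormal (tangent_space A p) (g p) X e"
  shows "card X \<le> DIM('e)"
proof -
  interpret inner_on "tangent_space A p" "g p" by (rule riemannian_inner_on[OF g])
  obtain T where T: "finite T" "card T = DIM('e)" "span T = tangent_space A p"
    using tangent_space_dim g unfolding riemannian_manifold_def by metis
  have "card (e ` X) \<le> card T"
    using independent_span_bound[OF T(1) orthonormal_independent[OF e]] T(3) orthonormalD(2)[OF e] by auto
  then show ?thesis
    using T(2) card_image[OF orthonormal_inj[OF e]] by simp
qed

text \<open>A vector outside the span would give an independent set with more elements than the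
  dimension.\<close>

lemma orthonormal_span:
  fixes A :: "('m::{t2_space, second_countable_topology}, 'e::euclidean_space) atlas"
  assumes g: "riemannian_manifold A g" and e: "inner_on.orthonormal (tangent_space A p) (g p) X e"
    and X: "card X = DIM('e)"
  shows "span (e ` X) = tangent_space A p"
proof -
  interpret inner_on "tangent_space A p" "g p" by (rule riemannian_inner_on[OF g])
  note e' = orthonormalD[OF e]
  obtain T where T: "finite T" "card T = DIM('e)" "span T = tangent_space A p"
    using tangent_space_dim g unfolding riemannian_manifold_def by metis
  have "v \<in> span (e ` X)" if v: "v \<in> tangent_space A p" for v
  proof (rule ccontr)
    assume "v \<notin> span (e ` X)"
    then have "independent (insert v (e ` X))" "v \<notin> e ` X"
      using orthonormal_independent[OF e] span_base[of v "e ` X"] by (auto simp: independent_insert)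
    moreover from this have "card (insert v (e ` X)) \<le> card T"
      using independent_span_bound[OF T(1)] T(3) e'(2) v by auto
    ultimately show False
      using T(2) X card_image[OF orthonormal_inj[OF e]] e'(1) by simp
  qed
  moreover have "span (e ` X) \<subseteq> tangent_space A p"
    using e'(2) by (intro span_minimal subspace) auto
  ultimately show ?thesis by blast
qed

text \<open>One step of the Gram--Schmidt process, applied to a coordinate field.\<close>

lemma orthonormal_fields_step:
  fixes A :: "('m::{t2_space, second_countable_topology}, 'e::euclidean_space) atlas"
  assumes g: "riemannian_manifold A g" and e: "orthonormal_fields A g W m e"
    and p: "p \<in> W" and m: "m < DIM('e)"
  obtains W' x where "p \<in> W'" "W' \<subseteq> W" "orthonormal_fields A g W' (Suc m) (e(m := x))"
proof -
  have A: "smooth_manifold A" using g unfolding riemannian_manifold_def by blast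
  note id = smooth_map_ident[OF A]
  note inner = riemannian_inner_on[OF g]
  note e' = orthonormal_fieldsD[OF e]
  obtain U \<phi> where U: "(U, \<phi>) \<in> A" "p \<in> U" using chart_exists[OF A] by blast
  define X where "X u q = dir_deriv A (U, \<phi>) q u" for u q
  have X: "X u \<in> vector_fields A U" for u
    unfolding X_def by (rule coordinate_field[OF A U(1)])
  \<comment> \<open>The \<open>DIM('e)\<close> coordinate vectors at \<open>p\<close> are
    independent, so they cannot all lie in the span of \<open>m\<close> vectors. The direction is
    chosen at \<open>p\<close> alone and kept nearby.\<close>
  obtain b where b: "b \<in> Basis" "X b p \<notin> span ((\<lambda>i. e i p) ` {..<m})"
  proof (rule ccontr)
    assume "\<not> thesis"
    then have sub: "dir_deriv A (U, \<phi>) p ` Basis \<subseteq> span ((\<lambda>i. e i p) ` {..<m})"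
      using that X_def by auto
    have inj: "inj_on (dir_deriv A (U, \<phi>) p) Y" for Y
      using dir_deriv_inj[OF A U] inj_on_subset by blast
    have "card (dir_deriv A (U, \<phi>) p ` Basis) \<le> card ((\<lambda>i. e i p) ` {..<m})"
      using independent_span_bound[OF _ linear_independent_injective_image[OF
            dir_deriv_linear[OF A U] independent_Basis inj] sub] by simp
    also have "\<dots> \<le> m" using card_image_le[of "{..<m}"] by fastforce
    finally show False using m card_image[OF inj, of Basis] by simp
  qed
  \<comment> \<open>The projection is subtracted by adding it with the factor \<open>- 1\<close>, so
    that smoothness follows from closure under sums and products.\<close>
  define Y where "Y q = X b q + (\<Sum>i<m. (- 1 * g q (X b q) (e i q)) *\<^sub>R e i q)" for q
  have UW: "open (U \<inter> W)" using chart_open[OF A U(1)] e'(1) by blast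
  have Xe: "X b \<in> vector_fields A (U \<inter> W)" "i < m \<Longrightarrow> e i \<in> vector_fields A (U \<inter> W)" for i
    using X e'(2) fields_along_subset by blast+
  have Y: "Y \<in> vector_fields A (U \<inter> W)"
    unfolding Y_def
    by (intro fields_along_add[OF A A id UW] fields_along_sum[OF A A id UW]
        fields_along_scaleR[OF A A id UW] smooth_fun_mult[OF A UW] smooth_fun_const[OF A UW]
        smooth_metric[OF g UW] Xe) auto
  define r where "r q = g q (Y q) (Y q)" for q
  have r: "smooth_fun A (U \<inter> W) r"
    unfolding r_def by (rule smooth_metric[OF g UW Y Y])
  have Ye: "g q (Y q) (e i q) = 0" if q: "q \<in> U \<inter> W" and i: "i < m" for q i
  proof -
    interpret inner_on "tangent_space A q" "g q" by (rule inner)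
    have eq: "orthonormal {..<m} (\<lambda>i. e i q)" using e'(3) q by blast
    have Yq: "Y q = X b q - (\<Sum>i<m. g q (X b q) (e i q) *\<^sub>R e i q)"
      by (simp add: Y_def sum_negf)
    show ?thesis
      unfolding Yq by (rule orthonormal_residual[OF eq])
        (use i fields_along_tangent[OF Xe(1) q] in \<open>auto intro: span_base\<close>)
  qed
  have "Y p \<noteq> 0"
  proof
    assume "Y p = 0"
    then have "X b p = (\<Sum>i<m. g p (X b p) (e i p) *\<^sub>R e i p)"
      by (simp add: Y_def sum_negf)
    moreover have "\<dots> \<in> span ((\<lambda>i. e i p) ` {..<m})"
      by (intro span_sum span_scale span_base) auto
    ultimately show False using b by metis
  qed
  then have rp: "r p > 0"
    unfolding r_def using inner_on.pos[OF inner] fields_along_tangent[OF Y] U p by blast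
  \<comment> \<open>The choice of \<open>b\<close> makes \<open>Y\<close> nonzero only at
    \<open>p\<close>; continuity of its squared length \<open>r\<close> provides the neighbourhood
    on which it can be normalised.\<close>
  define W' where "W' = (U \<inter> W) \<inter> r -` {0<..}"
  have W': "open W'" "p \<in> W'" "W' \<subseteq> U \<inter> W"
    using continuous_on_open_vimage[OF UW, of r] smooth_fun_continuous_on[OF A UW r] U p rp
    unfolding W'_def by (auto simp: Int_commute)
  define x where "x q = r q powr (- 1 / 2) *\<^sub>R Y q" for q
  have "smooth_on {0<..} (\<lambda>t::real. t powr (- 1 / 2))"
    by (simp add: smooth_on_def C_k_on_powr)
  then have "smooth_fun A W' (\<lambda>q. r q powr (- 1 / 2))"
    by (rule smooth_fun_compose_real[OF A W'(1) smooth_fun_subset[OF r W'(3)] _ open_greaterThan, rotated])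
      (auto simp: W'_def)
  then have x: "x \<in> vector_fields A W'"
    unfolding x_def by (rule fields_along_scaleR[OF A A id W'(1) _ fields_along_subset[OF Y W'(3)]])
  have "inner_on.orthonormal (tangent_space A q) (g q) {..<Suc m} (\<lambda>i. (e(m := x)) i q)" if q: "q \<in> W'" for q
  proof -
    interpret inner_on "tangent_space A q" "g q" by (rule inner)
    have q': "q \<in> U \<inter> W" "q \<in> W" using q W'(3) by auto
    note eq = orthonormalD[OF e'(3)[OF q'(2)]]
    have t: "Y q \<in> tangent_space A q" "x q \<in> tangent_space A q"
      using fields_along_tangent[OF Y] fields_along_tangent[OF x] q q' by auto
    have "r q > 0" using q W'_def by auto
    then have "r q powr (- 1 / 2) * (r q powr (- 1 / 2) * r q) = 1"
      using powr_add[of "r q" "- 1 / 2" "- 1 / 2", symmetric] powr_neg_one[of "r q"]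
      by (simp only: mult.assoc[symmetric]) simp
    then have "g q (x q) (x q) = 1"
      using t(1) by (simp add: x_def scale_left scale_right mem r_def)
    moreover have xe: "g q (x q) (e i q) = 0" if "i < m" for i
      using Ye[OF q'(1) that] t(1) eq(2) that by (simp add: x_def scale_left)
    moreover have "g q (e i q) (x q) = 0" if "i < m" for i
      using xe[OF that] sym[OF t(2) eq(2)] that by simp
    ultimately show ?thesis
      unfolding orthonormal_def using eq t by (auto simp: less_Suc_eq)
  qed
  moreover have "(e(m := x)) i \<in> vector_fields A W'" if "i < Suc m" for i
    using that x fields_along_subset[OF e'(2)] W'(3) by (auto simp: less_Suc_eq)
  ultimately have "orthonormal_fields A g W' (Suc m) (e(m := x))"
    unfolding orthonormal_fields_def using W'(1) by blast
  then show thesis using that W' by blast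
qed

lemma orthonormal_fields_extend:
  fixes A :: "('m::{t2_space, second_countable_topology}, 'e::euclidean_space) atlas"
  assumes g: "riemannian_manifold A g" and e: "orthonormal_fields A g W m e" and p: "p \<in> W"
  obtains W' e' where "p \<in> W'" "W' \<subseteq> W" "orthonormal_fields A g W' (DIM('e)) e'"
    "\<And>i. i < m \<Longrightarrow> e' i = e i" "m \<le> DIM('e)"
proof -
  have "\<exists>W' e'. p \<in> W' \<and> W' \<subseteq> W \<and> orthonormal_fields A g W' (DIM('e)) e' \<and> (\<forall>i<m. e' i = e i)"
    if "m \<le> DIM('e)"
    using that e p
  \<comment> \<open>The induction runs downwards from \<open>DIM('e)\<close>: a family of
    \<open>m\<close> fields is enlarged by one and then completed by the claim for
    \<open>Suc m\<close>. The domain is generalised because each step shrinks it.\<close>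
  proof (induction m arbitrary: W e rule: inc_induct)
    case base
    then show ?case by blast
  next
    case (step m)
    obtain W1 x where 1: "p \<in> W1" "W1 \<subseteq> W" "orthonormal_fields A g W1 (Suc m) (e(m := x))"
      by (rule orthonormal_fields_step[OF g step.prems step.hyps(2)])
    obtain W' e' where "p \<in> W'" "W' \<subseteq> W1" "orthonormal_fields A g W' (DIM('e)) e'"
      "\<forall>i<Suc m. e' i = (e(m := x)) i"
      using step.IH[OF 1(3,1)] by metis
    then have "p \<in> W' \<and> W' \<subseteq> W \<and> orthonormal_fields A g W' (DIM('e)) e' \<and> (\<forall>i<m. e' i = e i)"
      using 1(2) by auto
    then show ?case by blast
  qed
  moreover have "m \<le> DIM('e)"
    using orthonormal_card_le[OF g orthonormal_fieldsD(3)[OF e p]] by simp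
  ultimately show thesis using that by blast
qed

lemma orthonormal_fields_exist:
  fixes A :: "('m::{t2_space, second_countable_topology}, 'e::euclidean_space) atlas"
  assumes g: "riemannian_manifold A g"
  obtains W e where "p \<in> W" "orthonormal_fields A g W (DIM('e)) e"
proof -
  have "inner_on.orthonormal (tangent_space A q) (g q) ({} :: nat set) (\<lambda>i. 0)" for q
    by (simp add: inner_on.orthonormal_def[OF riemannian_inner_on[OF g]])
  then have "orthonormal_fields A g UNIV 0 (\<lambda>_ _. 0)"
    by (simp add: orthonormal_fields_def)
  then obtain W' e' where "p \<in> W'" "orthonormal_fields A g W' (DIM('e)) e'"
    by (rule orthonormal_fields_extend[OF g _ UNIV_I])
  then show thesis by (rule that)
qed


subsection \<open>Connections\<close>

context
  fixes A :: "('m::{t2_space, second_countable_topology}, 'e::euclidean_space) atlas"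
    and B :: "('n::{t2_space, second_countable_topology}, 'f::euclidean_space) atlas"
    and F :: "'m \<Rightarrow> 'n" and D :: "('m, 'n) connection"
  assumes A: "smooth_manifold A" and B: "smooth_manifold B" and F: "smooth_map A B F"
    and D: "connection_along A B F D"
begin

context
  fixes W :: "'m set" and p :: 'm
  assumes W: "open W" "p \<in> W"
begin

lemmas connection_along_unfold = D[unfolded connection_along_def, THEN spec, THEN mp, OF W(1)]

lemma connection_along_tangent:
  assumes "v \<in> tangent_space A p" "Z \<in> fields_along A B F W"
  shows "D p v Z \<in> tangent_space B (F p)"
  using connection_along_unfold[THEN conjunct2, THEN conjunct1, THEN bspec, OF W(2), THEN bspec,
      OF assms(2), THEN conjunct1, THEN bspec, OF assms(1)] .

lemma connection_along_linear:
  assumes "Z \<in> fields_along A B F W"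
  shows "linear_on_subspace (tangent_space A p) (\<lambda>v. D p v Z)"
  using connection_along_unfold[THEN conjunct2, THEN conjunct1, THEN bspec, OF W(2), THEN bspec,
      OF assms, THEN conjunct2] .

text \<open>The axiom asks for two smooth fields; the smoothness of \<open>Z'\<close> is inherited
  from \<open>Z\<close>, which lets fields of unknown regularity be replaced.\<close>

lemma connection_along_cong:
  assumes v: "v \<in> tangent_space A p" and Z: "Z \<in> fields_along A B F W"
    and eq: "\<And>q. q \<in> W \<Longrightarrow> Z q = Z' q"
  shows "D p v Z = D p v Z'"
proof -
  have Z': "Z' \<in> fields_along A B F W"
    using fields_along_cong[OF A F W(1), of Z Z'] Z eq by simp
  show ?thesis
    using connection_along_unfold[THEN conjunct2, THEN conjunct2, THEN conjunct1, THEN bspec, OF W(2),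
        THEN bspec, OF v, THEN bspec, OF Z, THEN bspec, OF Z'] eq by simp
qed

lemma connection_along_add:
  assumes "v \<in> tangent_space A p" "Z \<in> fields_along A B F W" "Z' \<in> fields_along A B F W"
  shows "D p v (\<lambda>q. Z q + Z' q) = D p v Z + D p v Z'"
  using connection_along_unfold[THEN conjunct2, THEN conjunct2, THEN conjunct2, THEN conjunct1,
      THEN bspec, OF W(2), THEN bspec, OF assms(1), THEN bspec, OF assms(2), THEN bspec, OF assms(3)] .

lemma connection_along_scaleR:
  assumes "v \<in> tangent_space A p" "Z \<in> fields_along A B F W" "smooth_fun A W f"
  shows "D p v (\<lambda>q. f q *\<^sub>R Z q) = v f *\<^sub>R Z p + f p *\<^sub>R D p v Z"
  using connection_along_unfold[THEN conjunct2, THEN conjunct2, THEN conjunct2, THEN conjunct2,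
      THEN bspec, OF W(2), THEN bspec, OF assms(1), THEN bspec, OF assms(2), THEN spec, THEN mp,
      OF assms(3)] .

lemma connection_along_zero:
  "v \<in> tangent_space A p \<Longrightarrow> D p v (\<lambda>q. 0) = 0"
  using connection_along_add[OF _ fields_along_zero[OF A B F W(1)] fields_along_zero[OF A B F W(1)]]
  by simp

lemma connection_along_sum:
  assumes v: "v \<in> tangent_space A p" and Z: "\<And>i. i \<in> X \<Longrightarrow> Z i \<in> fields_along A B F W"
  shows "D p v (\<lambda>q. \<Sum>i\<in>X. Z i q) = (\<Sum>i\<in>X. D p v (Z i))"
  using Z
  by (induction X rule: infinite_finite_induct)
    (simp_all add: connection_along_zero[OF v] connection_along_add[OF v]
      fields_along_sum[OF A B F W(1)])

end

end

lemma levi_civitaD: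
  assumes "levi_civita A g D"
  shows levi_civita_connection: "connection_along A A (\<lambda>p. p) D"
    and levi_civita_metric: "open W \<Longrightarrow> p \<in> W \<Longrightarrow> v \<in> tangent_space A p \<Longrightarrow>
      Y \<in> vector_fields A W \<Longrightarrow> Z \<in> vector_fields A W \<Longrightarrow>
      v (\<lambda>q. g q (Y q) (Z q)) = g p (D p v Y) (Z p) + g p (Y p) (D p v Z)"
    and levi_civita_torsion: "open W \<Longrightarrow> p \<in> W \<Longrightarrow> X \<in> vector_fields A W \<Longrightarrow>
      Y \<in> vector_fields A W \<Longrightarrow> D p (X p) Y - D p (Y p) X = lie_bracket A X Y p"
proof -
  show "connection_along A A (\<lambda>p. p) D"
    using assms[unfolded levi_civita_def, THEN conjunct1] .
next
  assume W: "open W" "p \<in> W"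
  note D = assms[unfolded levi_civita_def, THEN conjunct2, THEN spec, THEN mp, OF W(1)]
  show "v (\<lambda>q. g q (Y q) (Z q)) = g p (D p v Y) (Z p) + g p (Y p) (D p v Z)"
    if "v \<in> tangent_space A p" "Y \<in> vector_fields A W" "Z \<in> vector_fields A W"
    using D[THEN conjunct1, THEN bspec, OF W(2), THEN bspec, OF that(1), THEN bspec, OF that(2),
        THEN bspec, OF that(3)] .
  show "D p (X p) Y - D p (Y p) X = lie_bracket A X Y p"
    if "X \<in> vector_fields A W" "Y \<in> vector_fields A W"
    using D[THEN conjunct2, THEN bspec, OF W(2), THEN bspec, OF that(1), THEN bspec, OF that(2)] .
qed

section \<open>Linearity of the differential and brackets of related fields\<close>

lemma sum_lessThan_add:
  "(\<Sum>a<m + k. f a) = (\<Sum>a<m. f a) + (\<Sum>i<k. f (m + i :: nat) :: 'a::comm_monoid_add)"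
  by (induction k) (simp_all add: add.assoc)

lemma differential_add: "differential B F p (v + w) = differential B F p v + differential B F p w"
  by (simp add: differential_def fun_eq_iff)

lemma differential_scaleR: "differential B F p (c *\<^sub>R v) = c *\<^sub>R differential B F p v"
  by (simp add: differential_def fun_eq_iff)

lemma differential_zero: "differential B F p 0 = 0"
  by (simp add: differential_def fun_eq_iff)

lemma differential_diff: "differential B F p (v - w) = differential B F p v - differential B F p w"
  by (simp add: differential_def fun_eq_iff)

lemma differential_sum: "differential B F p (\<Sum>i\<in>X. v i) = (\<Sum>i\<in>X. differential B F p (v i))"
  using sum_comp_morphism[of "differential B F p" v X, OF differential_zero differential_add]
  unfolding o_def by (rule sym)

text \<open>Relatedness says that applying \<open>X\<close> to a function pulled back by
  \<open>F\<close> amounts to pulling back the result of applying \<open>X'\<close>; doing this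
  twice transports each half of the commutator. Horizontal lifts use it with a frame of the target,
  vertical fields with the zero field.\<close>

lemma lie_bracket_related:
  assumes A: "smooth_manifold A" and B: "smooth_manifold B" and F: "smooth_map A B F"
    and W: "open W" "p \<in> W" and W': "open W'" "F ` W \<subseteq> W'"
    and X: "X \<in> vector_fields A W" "X' \<in> vector_fields B W'"
      "\<And>q. q \<in> W \<Longrightarrow> differential B F q (X q) = X' (F q)"
    and Y: "Y \<in> vector_fields A W" "Y' \<in> vector_fields B W'"
      "\<And>q. q \<in> W \<Longrightarrow> differential B F q (Y q) = Y' (F q)"
  shows "differential B F p (lie_bracket A X Y p) = lie_bracket B X' Y' (F p)"
proof
  fix f
  show "differential B F p (lie_bracket A X Y p) f = lie_bracket B X' Y' (F p) f"
  proof (cases "smooth_near B (F p) f")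
    case True
    then obtain O' where O': "open O'" "F p \<in> O'" "smooth_fun B O' f"
      unfolding smooth_near_def by blast
    \<comment> \<open>The bracket is cut off on functions that are not smooth near the point, so the
      pullback of \<open>f\<close> has to be kept out of this default case.\<close>
    have near: "smooth_near A p (f \<circ> F)"
      using smooth_fun_compose[OF A B F O'(1,3)] smooth_map_open_vimage[OF F O'(1)] O'(2)
      unfolding smooth_near_def o_def by blast
    \<comment> \<open>Stated for arbitrary pairs, since the commutator needs it in both
      orders.\<close>
    have iter: "X p (\<lambda>q. Y q (f \<circ> F)) = X' (F p) (\<lambda>r. Y' r f)"
      if X: "X \<in> vector_fields A W" "\<And>q. q \<in> W \<Longrightarrow> differential B F q (X q) = X' (F q)"
        and Y: "Y' \<in> vector_fields B W'" "\<And>q. q \<in> W \<Longrightarrow> differential B F q (Y q) = Y' (F q)"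
      for X X' Y Y'
    proof -
      have op: "open (W \<inter> F -` O')" using W smooth_map_open_vimage[OF F O'(1)] by auto
      have eq: "Y q (f \<circ> F) = Y' (F q) f" if "q \<in> W \<inter> F -` O'" for q
      proof -
        have q: "q \<in> W" "F q \<in> O'" using that by auto
        have "Y q (f \<circ> F) = differential B F q (Y q) f"
          using smooth_nearI[OF O'(3,1) q(2)] by (simp add: differential_def)
        then show ?thesis by (simp only: Y(2)[OF q(1)])
      qed
      have "X p (\<lambda>q. Y q (f \<circ> F)) = X p (\<lambda>q. Y' (F q) f)"
        by (rule tangent_local[OF A fields_along_tangent[OF X(1) W(2)] op _ eq]) (use W(2) O'(2) in simp)
      also have "X p (\<lambda>q. Y' (F q) f) = differential B F p (X p) (\<lambda>r. Y' r f)"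
      proof -
        have "open (W' \<inter> O')" "F p \<in> W' \<inter> O'" using W(2) W' O'(1,2) by auto
        then have "smooth_near B (F p) (\<lambda>r. Y' r f)"
          by (rule smooth_nearI[OF vector_fields_smooth[OF Y(1) O'(1,3)]])
        then show ?thesis by (simp add: differential_def o_def)
      qed
      finally show ?thesis using X(2) W(2) by simp
    qed
    show ?thesis
      using iter[OF X(1,3) Y(2,3)] iter[OF Y(1,3) X(2,3)] True near
      by (simp add: differential_def lie_bracket_def o_def)
  qed (simp add: differential_def lie_bracket_def)
qed


subsection \<open>Riemannian submersions\<close>

text \<open>The relation between harmonicity and the trace of the O'Neill tensor concerns the
  submersion alone; a complex structure enters afterwards as one parameter \<open>R\<close>.\<close>

locale submersion =
  fixes A :: "('m::{t2_space, second_countable_topology}, 'e::euclidean_space) atlas"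
    and B :: "('n::{t2_space, second_countable_topology}, 'f::euclidean_space) atlas"
    and gM :: "'m metric" and gN :: "'n metric" and F :: "'m \<Rightarrow> 'n"
    and DM :: "('m, 'm) connection" and DN :: "('n, 'n) connection" and DF :: "('m, 'n) connection"
  assumes gM: "riemannian_manifold A gM" and LM: "levi_civita A gM DM"
    and gN: "riemannian_manifold B gN" and LN: "levi_civita B gN DN"
    and pullback: "pullback_connection A B F DN DF"
    and submersion: "riemannian_submersion A gM B gN F"
begin

sublocale M: inner_on "tangent_space A p" "gM p" for p
  by (rule riemannian_inner_on[OF gM])

sublocale N: inner_on "tangent_space B r" "gN r" for r
  by (rule riemannian_inner_on[OF gN])

abbreviation "dF \<equiv> differential B F"
abbreviation "vert \<equiv> ker_diff A B F"
abbreviation "hor \<equiv> horizontal A gM B F"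

lemma A: "smooth_manifold A" and B: "smooth_manifold B"
  using gM gN unfolding riemannian_manifold_def by auto

lemma F: "smooth_map A B F"
  using submersion unfolding riemannian_submersion_def by blast

lemma DF: "connection_along A B F DF"
  using pullback[unfolded pullback_connection_def, THEN conjunct1] .

lemma DF_pullback:
  assumes "open W" "Z \<in> vector_fields B W" "F p \<in> W" "u \<in> tangent_space A p"
  shows "DF p u (\<lambda>q. Z (F q)) = DN (F p) (dF p u) Z"
proof -
  have "p \<in> F -` W" using assms(3) by simp
  from pullback[unfolded pullback_connection_def, THEN conjunct2, THEN spec, THEN mp, OF assms(1),
      THEN bspec, OF assms(2), THEN bspec, OF this, THEN bspec, OF assms(4)]
  show ?thesis by (simp add: o_def)
qed

lemmas id = smooth_map_ident[OF A]
lemmas DM = levi_civita_connection[OF LM]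

section \<open>Vertical and horizontal spaces\<close>

lemma dF_tangent: "v \<in> tangent_space A p \<Longrightarrow> dF p v \<in> tangent_space B (F p)"
  using submersion unfolding riemannian_submersion_def by blast

lemma vertD: "v \<in> vert p \<Longrightarrow> v \<in> tangent_space A p" "v \<in> vert p \<Longrightarrow> dF p v = 0"
  unfolding ker_diff_def by auto

lemma horD: "x \<in> hor p \<Longrightarrow> x \<in> tangent_space A p" "x \<in> hor p \<Longrightarrow> v \<in> vert p \<Longrightarrow> gM p x v = 0"
  unfolding horizontal_def orth_compl_def by auto

lemma horD': "x \<in> hor p \<Longrightarrow> v \<in> vert p \<Longrightarrow> gM p v x = 0"
  using M.sym horD vertD by metis

lemma subspace_vert: "subspace (vert p)"
  by (rule subspaceI)
    (auto simp: ker_diff_def differential_zero differential_add differential_scaleR M.mem)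

lemma subspace_hor: "subspace (hor p)"
  unfolding horizontal_def using M.subspace_orth_compl[OF M.subspace order_refl] vertD by blast

lemma hor_exists:
  assumes "w \<in> tangent_space B (F p)" obtains x where "x \<in> hor p" "dF p x = w"
  using submersion assms unfolding riemannian_submersion_def by (metis bij_betw_imp_surj_on imageE)

lemma hor_isometry: "x \<in> hor p \<Longrightarrow> y \<in> hor p \<Longrightarrow> gN (F p) (dF p x) (dF p y) = gM p x y"
  using submersion unfolding riemannian_submersion_def by blast

text \<open>The horizontal part is the horizontal vector with the same image, so the splitting comes
  from the surjectivity of \<open>dF\<close> on horizontal vectors and not from a projection
  theorem.\<close>

lemma decompose:
  assumes "v \<in> tangent_space A p"
  obtains x y where "x \<in> hor p" "y \<in> vert p" "v = x + y" "dF p v = dF p x"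
proof -
  obtain x where x: "x \<in> hor p" "dF p x = dF p v" using hor_exists dF_tangent[OF assms] by metis
  then have "v - x \<in> vert p"
    using assms horD(1) M.mem unfolding ker_diff_def by (simp add: differential_diff)
  then show thesis using that[of x "v - x"] x by simp
qed

lemma hor_zero: "x \<in> hor p \<Longrightarrow> dF p x = 0 \<Longrightarrow> x = 0"
  using hor_isometry[of x p x] horD(1) dF_tangent N.zero_left M.eq_zero by metis

text \<open>The vertical part of \<open>v\<close> contributes nothing on either side, so the
  isometry on horizontal vectors extends to an arbitrary second argument.\<close>

lemma hor_adjoint:
  assumes "x \<in> hor p" "v \<in> tangent_space A p"
  shows "gN (F p) (dF p x) (dF p v) = gM p x v"
proof -
  obtain y z where "y \<in> hor p" "z \<in> vert p" "v = y + z" "dF p v = dF p y"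
    using decompose[OF assms(2)] .
  then show ?thesis
    using assms(1) hor_isometry horD vertD M.add_right by auto
qed

text \<open>The horizontal part of such a vector is orthogonal to itself.\<close>

lemma vert_if_orthogonal:
  assumes "v \<in> tangent_space A p" "\<And>x. x \<in> hor p \<Longrightarrow> gM p v x = 0"
  shows "v \<in> vert p"
proof -
  obtain x y where xy: "x \<in> hor p" "y \<in> vert p" "v = x + y" "dF p v = dF p x"
    using decompose[OF assms(1)] .
  then have "gM p x x = 0"
    using assms(2)[OF xy(1)] horD[OF xy(1)] vertD[OF xy(2)] horD'[OF xy(1,2)] M.add_left by auto
  then have "x = 0"
    using M.eq_zero[OF horD(1)[OF xy(1)]] by blast
  then show ?thesis using xy by simp
qed

lemma hor_proj:
  assumes "v \<in> tangent_space A p"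
  shows "orth_proj (gM p) (hor p) v \<in> hor p" "dF p (orth_proj (gM p) (hor p) v) = dF p v"
    "x \<in> hor p \<Longrightarrow> gM p x (orth_proj (gM p) (hor p) v) = gM p x v"
proof -
  obtain y z where v: "y \<in> hor p" "z \<in> vert p" "v = y + z" "dF p v = dF p y"
    using decompose[OF assms] .
  have "orth_proj (gM p) (hor p) v = y"
    by (rule M.orth_proj_eq[OF subspace_hor _ assms v(1)]) (use v horD horD' in auto)
  then show "orth_proj (gM p) (hor p) v \<in> hor p" "dF p (orth_proj (gM p) (hor p) v) = dF p v"
    "x \<in> hor p \<Longrightarrow> gM p x (orth_proj (gM p) (hor p) v) = gM p x v"
    using v horD vertD by (auto simp: M.add_right)
qed

section \<open>Adapted frames: horizontal lifts followed by vertical fields\<close>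

definition adapted :: "'m set \<Rightarrow> 'n set \<Rightarrow> (nat \<Rightarrow> 'n \<Rightarrow> 'n tvec) \<Rightarrow> nat \<Rightarrow> nat \<Rightarrow>
    (nat \<Rightarrow> 'm \<Rightarrow> 'm tvec) \<Rightarrow> bool" where
  "adapted W W' y m k \<epsilon> \<longleftrightarrow> orthonormal_fields A gM W (m + k) \<epsilon> \<and> orthonormal_fields B gN W' m y \<and>
     F ` W \<subseteq> W' \<and>
     (\<forall>q\<in>W. span ((\<lambda>i. \<epsilon> i q) ` {..<m + k}) = tangent_space A q) \<and>
     (\<forall>r\<in>W'. span ((\<lambda>i. y i r) ` {..<m}) = tangent_space B r) \<and>
     (\<forall>q\<in>W. \<forall>i<m. \<epsilon> i q \<in> hor q \<and> dF q (\<epsilon> i q) = y i (F q)) \<and>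
     (\<forall>q\<in>W. \<forall>i. m \<le> i \<longrightarrow> i < m + k \<longrightarrow> \<epsilon> i q \<in> vert q)"

lemma adapted_exists:
  obtains W W' y m k \<epsilon> where "p \<in> W" "adapted W W' y m k \<epsilon>"
proof -
  obtain U E where U: "p \<in> U" "orthonormal_fields A gM U (DIM('e)) E"
    using orthonormal_fields_exist[OF gM] .
  obtain W0 y where W0: "F p \<in> W0" "orthonormal_fields B gN W0 (DIM('f)) y"
    using orthonormal_fields_exist[OF gN] .
  obtain V \<psi> where V: "(V, \<psi>) \<in> B" "F p \<in> V" using chart_exists[OF B] .
  note E = orthonormal_fieldsD[OF U(2)]
  \<comment> \<open>Staying in one chart of the target provides coordinate fields in which images
    under \<open>dF\<close> can be expanded.\<close>
  define W' where "W' = V \<inter> W0"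
  have y: "orthonormal_fields B gN W' (DIM('f)) y"
    using orthonormal_fields_subset[OF W0(2)] orthonormal_fieldsD(1)[OF W0(2)] chart_open[OF B V(1)]
    unfolding W'_def by auto
  note y' = orthonormal_fieldsD[OF y]
  define W where "W = U \<inter> F -` W'"
  have W: "open W" "p \<in> W" "W \<subseteq> U" "F ` W \<subseteq> W'"
    using E(1) smooth_map_open_vimage[OF F y'(1)] U V W0 by (auto simp: W_def W'_def)
  have EW: "E i \<in> vector_fields A W" if "i < DIM('e)" for i
    using E(2)[OF that] W(3) by (rule fields_along_subset)
  \<comment> \<open>By adjointness these are the coefficients, in the frame \<open>E\<close>, of the
    horizontal lift of \<open>y j\<close>.\<close>
  define c where "c i j q = gN (F q) (dF q (E i q)) (y j (F q))" for i j q
  define X where "X j q = (\<Sum>i<DIM('e). c i j q *\<^sub>R E i q)" for j q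
  \<comment> \<open>The image of \<open>E i\<close> under \<open>dF\<close> is a field along
    \<open>F\<close> and not a vector field on the target, so smoothness of the metric does not
    apply to it directly. It is expanded in coordinate fields, whose products with
    \<open>y j\<close> are smooth on the target and are then pulled back.\<close>
  have c: "smooth_fun A W (c i j)" if i: "i < DIM('e)" and j: "j < DIM('f)" for i j
  proof -
    define d where "d b r = dir_deriv B (V, \<psi>) r b" for b r
    have d: "d b \<in> vector_fields B W'" for b
      using fields_along_subset[OF coordinate_field[OF B V(1)]] unfolding d_def W'_def by blast
    have "c i j q = (\<Sum>b\<in>Basis. E i q (\<lambda>q. \<psi> (F q) \<bullet> b) * gN (F q) (d b (F q)) (y j (F q)))"
      if q: "q \<in> W" for q
    proof -
      have Fq: "F q \<in> V" "F q \<in> W'" using q by (auto simp: W_def W'_def)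
      have t: "dF q (E i q) \<in> tangent_space B (F q)"
        by (rule dF_tangent[OF fields_along_tangent[OF EW[OF i] q]])
      have "dF q (E i q) (\<lambda>r. \<psi> r \<bullet> b) = E i q (\<lambda>q. \<psi> (F q) \<bullet> b)" for b
        using smooth_nearI[OF smooth_fun_coordinate[OF B V(1)] chart_open[OF B V(1)] Fq(1)]
        by (simp add: differential_def o_def)
      then have "dF q (E i q) = (\<Sum>b\<in>Basis. E i q (\<lambda>q. \<psi> (F q) \<bullet> b) *\<^sub>R d b (F q))"
        using tangent_coordinates[OF B V(1) Fq(1) t] unfolding d_def by simp
      then show ?thesis
        unfolding c_def using fields_along_tangent[OF d Fq(2)] fields_along_tangent[OF y'(2)[OF j] Fq(2)]
        by (simp add: N.sum_left N.scale_left N.mem)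
    qed
    moreover have "smooth_fun A W (\<lambda>q. \<Sum>b\<in>Basis. E i q (\<lambda>q. \<psi> (F q) \<bullet> b) * gN (F q) (d b (F q)) (y j (F q)))"
    proof (intro smooth_fun_sum[OF A W(1)] smooth_fun_mult[OF A W(1)])
      fix b
      have "smooth_fun A (F -` V) (\<lambda>q. \<psi> (F q) \<bullet> b)"
        by (rule smooth_fun_compose[OF A B F chart_open[OF B V(1)] smooth_fun_coordinate[OF B V(1)]])
      from vector_fields_smooth[OF EW[OF i] smooth_map_open_vimage[OF F chart_open[OF B V(1)]] this]
      show "smooth_fun A W (\<lambda>q. E i q (\<lambda>q. \<psi> (F q) \<bullet> b))"
        by (rule smooth_fun_subset) (auto simp: W_def W'_def)
      have "smooth_fun A (F -` W') (\<lambda>q. gN (F q) (d b (F q)) (y j (F q)))"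
        by (rule smooth_fun_compose[OF A B F y'(1) smooth_metric[OF gN y'(1) d y'(2)[OF j]]])
      then show "smooth_fun A W (\<lambda>q. gN (F q) (d b (F q)) (y j (F q)))"
        by (rule smooth_fun_subset) (auto simp: W_def)
    qed
    ultimately show ?thesis
      using smooth_fun_cong[OF A W(1), of "c i j"] by simp
  qed
  have X: "X j q \<in> hor q" "dF q (X j q) = y j (F q)" if q: "q \<in> W" and j: "j < DIM('f)" for j q
  proof -
    have Eq: "M.orthonormal q {..<DIM('e)} (\<lambda>i. E i q)" using E(3) q W(3) by blast
    have yt: "y j (F q) \<in> tangent_space B (F q)"
      using fields_along_tangent[OF y'(2)[OF j]] q W(4) by blast
    obtain x where x: "x \<in> hor q" "dF q x = y j (F q)" using hor_exists[OF yt] .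
    have "x = (\<Sum>i<DIM('e). gM q x (E i q) *\<^sub>R E i q)"
      using M.orthonormal_expand[OF Eq] orthonormal_span[OF gM Eq] horD(1)[OF x(1)] by simp
    also have "\<dots> = X j q"
      unfolding X_def c_def
    proof (intro sum.cong refl arg_cong2[of _ _ _ _ scaleR])
      fix i assume "i \<in> {..<DIM('e)}"
      then have Ei: "E i q \<in> tangent_space A q" using M.orthonormalD(2)[OF Eq] by blast
      show "gM q x (E i q) = gN (F q) (dF q (E i q)) (y j (F q))"
        using hor_adjoint[OF x(1) Ei] N.sym[OF dF_tangent[OF Ei] yt] x(2) by simp
    qed
    finally show "X j q \<in> hor q" "dF q (X j q) = y j (F q)" using x by auto
  qed
  have Xf: "X j \<in> vector_fields A W" if "j < DIM('f)" for j
    unfolding X_def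
    by (intro fields_along_sum[OF A A id W(1)] fields_along_scaleR[OF A A id W(1)] c[OF _ that] EW) auto
  have "M.orthonormal q {..<DIM('f)} (\<lambda>j. X j q)" if q: "q \<in> W" for q
  proof -
    have "N.orthonormal (F q) {..<DIM('f)} (\<lambda>j. y j (F q))" using y'(3) q W(4) by blast
    then show ?thesis
      unfolding M.orthonormal_def N.orthonormal_def
      using X[OF q] hor_isometry[of _ q] horD(1) by (metis lessThan_iff)
  qed
  then have "orthonormal_fields A gM W (DIM('f)) X"
    unfolding orthonormal_fields_def using W(1) Xf by blast
  then obtain W1 \<epsilon> where W1: "p \<in> W1" "W1 \<subseteq> W" "orthonormal_fields A gM W1 (DIM('e)) \<epsilon>"
    and eps: "\<And>i. i < DIM('f) \<Longrightarrow> \<epsilon> i = X i" and le: "DIM('f) \<le> DIM('e)"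
    using orthonormal_fields_extend[OF gM _ W(2)] by metis
  note e = orthonormal_fieldsD[OF W1(3)]
  have vert: "\<epsilon> i q \<in> vert q" if q: "q \<in> W1" and i: "DIM('f) \<le> i" "i < DIM('e)" for i q
  proof (rule vert_if_orthogonal)
    note eq = M.orthonormalD[OF e(3)[OF q]]
    show t: "\<epsilon> i q \<in> tangent_space A q" using eq(2) i by auto
    have qW: "q \<in> W" using q W1(2) by blast
    fix x assume x: "x \<in> hor q"
    have yo: "N.orthonormal (F q) {..<DIM('f)} (\<lambda>j. y j (F q))" using y'(3) qW W(4) by blast
    \<comment> \<open>The combination of the lifts with the same image as \<open>x\<close>;
      injectivity of \<open>dF\<close> on horizontal vectors identifies the two.\<close>
    define z where "z = (\<Sum>j<DIM('f). gN (F q) (dF q x) (y j (F q)) *\<^sub>R X j q)"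
    have z: "z \<in> hor q"
      unfolding z_def using X[OF qW] by (intro subspace_sum[OF subspace_hor] subspace_scale[OF subspace_hor]) auto
    have "dF q x = (\<Sum>j<DIM('f). gN (F q) (dF q x) (y j (F q)) *\<^sub>R y j (F q))"
      using N.orthonormal_expand[OF yo] orthonormal_span[OF gN yo] dF_tangent[OF horD(1)[OF x]] by simp
    also have "\<dots> = dF q z"
      unfolding z_def differential_sum differential_scaleR using X[OF qW] by simp
    finally have "x = z"
      using hor_zero[of "x - z" q] subspace_diff[OF subspace_hor x z] by (simp add: differential_diff)
    moreover have "gM q (\<epsilon> i q) (X j q) = 0" if "j < DIM('f)" for j
      using eq(3)[of i j] eps[OF that] that i by simp
    then have "gM q (\<epsilon> i q) z = 0"
      unfolding z_def using horD(1)[OF X(1)[OF qW]] t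
      by (subst M.sum_right) (auto simp: M.scale_right M.mem(3))
    ultimately show "gM q (\<epsilon> i q) x = 0" by simp
  qed
  have "F ` W1 \<subseteq> W'" using W1(2) W(4) by blast
  \<comment> \<open>The bound \<open>le\<close>, a by-product of the extension, makes the truncated
    subtraction exact.\<close>
  then have "adapted W1 W' y (DIM('f)) (DIM('e) - DIM('f)) \<epsilon>"
    unfolding adapted_def
    using W1 y le eps X W vert orthonormal_span[OF gM e(3)] orthonormal_span[OF gN y'(3)] by auto
  then show thesis using that W1(1) by blast
qed

context
  fixes W W' y m k \<epsilon>
  assumes adapted: "adapted W W' y m k \<epsilon>"
begin

lemma adapted_fields:
  shows "orthonormal_fields A gM W (m + k) \<epsilon>" "orthonormal_fields B gN W' m y" "F ` W \<subseteq> W'"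
    and adapted_span: "q \<in> W \<Longrightarrow> span ((\<lambda>i. \<epsilon> i q) ` {..<m + k}) = tangent_space A q"
    and adapted_span_target: "r \<in> W' \<Longrightarrow> span ((\<lambda>i. y i r) ` {..<m}) = tangent_space B r"
    and adapted_hor: "q \<in> W \<Longrightarrow> i < m \<Longrightarrow> \<epsilon> i q \<in> hor q"
    and adapted_related: "q \<in> W \<Longrightarrow> i < m \<Longrightarrow> dF q (\<epsilon> i q) = y i (F q)"
    and adapted_vert: "q \<in> W \<Longrightarrow> m \<le> i \<Longrightarrow> i < m + k \<Longrightarrow> \<epsilon> i q \<in> vert q"
  using adapted unfolding adapted_def by simp_all

lemmas ad = orthonormal_fieldsD[OF adapted_fields(1)]
lemmas ad' = orthonormal_fieldsD[OF adapted_fields(2)]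

lemma adapted_expand: "q \<in> W \<Longrightarrow> v \<in> tangent_space A q \<Longrightarrow> v = (\<Sum>i<m + k. gM q v (\<epsilon> i q) *\<^sub>R \<epsilon> i q)"
  using M.orthonormal_expand[OF ad(3)] adapted_span by blast

text \<open>On an adapted frame the pushed-forward field is either the pullback of some
  \<open>y a\<close> or zero, so its smoothness along \<open>F\<close> is immediate.\<close>

lemma adapted_push:
  assumes "a < m + k"
  shows "(\<lambda>q. dF q (\<epsilon> a q)) \<in> fields_along A B F W"
proof (cases "a < m")
  case True
  have "(\<lambda>q. y a (F q)) \<in> fields_along A B F W"
    by (rule fields_along_subset[OF fields_along_compose[OF A B F ad'(2)[OF True] ad'(1)]])
      (use adapted_fields(3) in auto)
  then show ?thesis
    by (rule iffD2[OF fields_along_cong[OF A F ad(1)], rotated]) (rule adapted_related[OF _ True])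
next
  case False
  then have "dF q (\<epsilon> a q) = 0" if "q \<in> W" for q
    using vertD(2)[OF adapted_vert[OF that]] assms by simp
  then show ?thesis
    by (rule iffD2[OF fields_along_cong[OF A F ad(1)] fields_along_zero[OF A B F ad(1)]])
qed

lemma adapted_vertical_frame: "orthonormal_frame A gM vert W k (\<lambda>i. \<epsilon> (m + i))"
  unfolding orthonormal_frame_def
proof (intro conjI allI impI ballI)
  fix q assume q: "q \<in> W"
  note eq = M.orthonormalD[OF ad(3)[OF q]]
  show "gM q (\<epsilon> (m + i) q) (\<epsilon> (m + j) q) = (if i = j then 1 else 0)" if "i < k" "j < k" for i j
    using eq(3)[of "m + i" "m + j"] that by simp
  show "span ((\<lambda>i. \<epsilon> (m + i) q) ` {..<k}) = vert q"
  proof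
    show "span ((\<lambda>i. \<epsilon> (m + i) q) ` {..<k}) \<subseteq> vert q"
      by (rule span_minimal[OF _ subspace_vert]) (use adapted_vert[OF q] in auto)
    show "vert q \<subseteq> span ((\<lambda>i. \<epsilon> (m + i) q) ` {..<k})"
    proof
      fix v assume v: "v \<in> vert q"
      have "gM q v (\<epsilon> i q) *\<^sub>R \<epsilon> i q \<in> span ((\<lambda>i. \<epsilon> (m + i) q) ` {..<k})" if "i < m + k" for i
      proof (cases "i < m")
        case True
        then show ?thesis using horD'[OF adapted_hor[OF q True] v] by (simp add: span_zero)
      next
        case False
        then have "i = m + (i - m)" "i - m < k" using that by auto
        then show ?thesis by (metis imageI lessThan_iff span_base span_scale)
      qed
      then show "v \<in> span ((\<lambda>i. \<epsilon> (m + i) q) ` {..<k})"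
        by (subst adapted_expand[OF q vertD(1)[OF v]]) (auto intro: span_sum)
    qed
  qed
qed (use ad adapted_vert in \<open>auto simp: sections_def\<close>)

lemma adapted_hor_span:
  assumes q: "q \<in> W" and x: "x \<in> hor q"
  shows "x \<in> span ((\<lambda>i. \<epsilon> i q) ` {..<m})"
proof -
  have "gM q x (\<epsilon> i q) *\<^sub>R \<epsilon> i q \<in> span ((\<lambda>i. \<epsilon> i q) ` {..<m})" if "i < m + k" for i
  proof (cases "i < m")
    case False
    then show ?thesis using horD(2)[OF x adapted_vert[OF q]] that by (simp add: span_zero)
  qed (auto intro: span_scale span_base)
  then show ?thesis
    by (subst adapted_expand[OF q horD(1)[OF x]]) (auto intro: span_sum)
qed

section \<open>The second fundamental form at a point of an adapted frame\<close>

context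
  fixes p
  assumes p: "p \<in> W"
begin

text \<open>The second fundamental form depends on its first field only through the value at
  \<open>p\<close>; with a vector in that slot, linearity can be expressed.\<close>

definition sff :: "'m tvec \<Rightarrow> ('m \<Rightarrow> 'm tvec) \<Rightarrow> 'n tvec" where
  "sff u Z = DF p u (\<lambda>q. dF q (Z q)) - dF p (DM p u Z)"

text \<open>\<open>g\<^sub>N (sff (\<epsilon> a) (\<epsilon> b), y c)\<close> is symmetric in \<open>a, b\<close> since the connections are torsion
  free, and antisymmetric in \<open>b, c\<close> since they are metric.\<close>

lemma sff_hor_zero:
  assumes "a < m" "b < m"
  shows "sff (\<epsilon> a p) (\<epsilon> b) = 0"
proof -
  have Fp: "F p \<in> W'" using p adapted_fields(3) by blast
  have et: "\<epsilon> a p \<in> tangent_space A p" if "a < m" for a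
    using horD(1)[OF adapted_hor[OF p that]] .
  have yt: "y a (F p) \<in> tangent_space B (F p)" if "a < m" for a
    using fields_along_tangent[OF ad'(2)[OF that] Fp] .
  have ef: "\<epsilon> a \<in> vector_fields A W" if "a < m" for a
    using ad(2) that by simp
  \<comment> \<open>Since \<open>\<epsilon> b\<close> is related to \<open>y b\<close>, the pullback
    connection can be evaluated on the target, and the axioms of both Levi-Civita connections become
    applicable.\<close>
  define C where "C a b = DN (F p) (y a (F p)) (y b) - dF p (DM p (\<epsilon> a p) (\<epsilon> b))" for a b
  have C: "sff (\<epsilon> a p) (\<epsilon> b) = C a b" if "a < m" "b < m" for a b
  proof -
    have "DF p (\<epsilon> a p) (\<lambda>q. dF q (\<epsilon> b q)) = DF p (\<epsilon> a p) (\<lambda>q. y b (F q))"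
      by (rule connection_along_cong[OF A B F DF ad(1) p et adapted_push])
        (use that adapted_related in auto)
    then show ?thesis
      using DF_pullback[OF ad'(1,2) Fp et] adapted_related[OF p] that by (simp add: sff_def C_def)
  qed
  have DNt: "DN (F p) (y a (F p)) (y b) \<in> tangent_space B (F p)" if "a < m" "b < m" for a b
    using connection_along_tangent[OF B B smooth_map_ident[OF B] levi_civita_connection[OF LN] ad'(1) Fp yt]
      ad'(2) that by blast
  have DMt: "DM p (\<epsilon> a p) (\<epsilon> b) \<in> tangent_space A p" if "a < m" "b < m" for a b
    using connection_along_tangent[OF A A id DM ad(1) p et ef] that by blast
  have Ct: "C a b \<in> tangent_space B (F p)" if "a < m" "b < m" for a b
    unfolding C_def using DNt DMt dF_tangent N.mem(4) that by blast
  define T where "T a b c = gN (F p) (C a b) (y c (F p))" for a b c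
  have "C a b - C b a = 0" if "a < m" "b < m" for a b
  proof -
    have "C a b - C b a = (DN (F p) (y a (F p)) (y b) - DN (F p) (y b (F p)) (y a))
        - dF p (DM p (\<epsilon> a p) (\<epsilon> b) - DM p (\<epsilon> b p) (\<epsilon> a))"
      by (simp add: C_def differential_diff)
    also have "\<dots> = lie_bracket B (y a) (y b) (F p) - dF p (lie_bracket A (\<epsilon> a) (\<epsilon> b) p)"
      using levi_civita_torsion[OF LN ad'(1) Fp ad'(2) ad'(2)]
        levi_civita_torsion[OF LM ad(1) p ef ef] that by simp
    \<comment> \<open>The two brackets are related because the two frames are.\<close>
    also have "\<dots> = 0"
      using lie_bracket_related[OF A B F ad(1) p ad'(1) adapted_fields(3) ef ad'(2) adapted_related
          ef ad'(2) adapted_related] that by simp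
    finally show ?thesis .
  qed
  then have T_sym: "T a b c = T b a c" if "a < m" "b < m" for a b c
    using that by (simp add: T_def)
  have T_anti: "T a b c = - T a c b" if abc: "a < m" "b < m" "c < m" for a b c
  proof -
    have "y a (F p) (\<lambda>r. gN r (y b r) (y c r)) = y a (F p) (\<lambda>r. if b = c then 1 else 0)"
      by (rule tangent_local[OF B yt ad'(1) Fp]) (use abc N.orthonormalD(3)[OF ad'(3)] in auto)
    then have N: "gN (F p) (DN (F p) (y a (F p)) (y b)) (y c (F p)) +
        gN (F p) (y b (F p)) (DN (F p) (y a (F p)) (y c)) = 0"
      using levi_civita_metric[OF LN ad'(1) Fp yt ad'(2) ad'(2)] tangent_const[OF B yt] abc by simp
    have "\<epsilon> a p (\<lambda>q. gM q (\<epsilon> b q) (\<epsilon> c q)) = \<epsilon> a p (\<lambda>q. if b = c then 1 else 0)"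
      by (rule tangent_local[OF A et ad(1) p]) (use abc M.orthonormalD(3)[OF ad(3)] in auto)
    then have M: "gM p (DM p (\<epsilon> a p) (\<epsilon> b)) (\<epsilon> c p) + gM p (\<epsilon> b p) (DM p (\<epsilon> a p) (\<epsilon> c)) = 0"
      using levi_civita_metric[OF LM ad(1) p et ef ef] tangent_const[OF A et] abc by simp
    \<comment> \<open>As \<open>y c\<close> is the image of the horizontal
      \<open>\<epsilon> c\<close>, adjointness turns the second product into one on the
      source.\<close>
    have T: "T a b c = gN (F p) (DN (F p) (y a (F p)) (y b)) (y c (F p)) - gM p (\<epsilon> c p) (DM p (\<epsilon> a p) (\<epsilon> b))"
      if "b < m" "c < m" for b c
    proof -
      have "gN (F p) (dF p (DM p (\<epsilon> a p) (\<epsilon> b))) (y c (F p)) = gM p (\<epsilon> c p) (DM p (\<epsilon> a p) (\<epsilon> b))"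
        using hor_adjoint[OF adapted_hor[OF p \<open>c < m\<close>] DMt[OF abc(1) \<open>b < m\<close>]]
          adapted_related[OF p \<open>c < m\<close>] N.sym[OF yt dF_tangent[OF DMt]] that abc by simp
      then show ?thesis
        unfolding T_def C_def using N.diff_left[OF DNt dF_tangent[OF DMt] yt] that abc by simp
    qed
    show ?thesis
      using T[OF abc(2,3)] T[OF abc(3,2)] N M M.sym[OF et DMt] N.sym[OF yt DNt] abc by simp
  qed
  \<comment> \<open>Alternating the two symmetries six times returns to the same indices with the
    opposite sign.\<close>
  have T0: "T a b c = 0" if "a < m" "b < m" "c < m" for a b c
  proof -
    have "T a b c = - T a c b" by (rule T_anti[OF that])
    moreover have "T a c b = T c a b" by (rule T_sym[OF that(1,3)])
    moreover have "T c a b = - T c b a" by (rule T_anti[OF that(3,1,2)])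
    moreover have "T c b a = T b c a" by (rule T_sym[OF that(3,2)])
    moreover have "T b c a = - T b a c" by (rule T_anti[OF that(2,3,1)])
    moreover have "T b a c = T a b c" by (rule T_sym[OF that(2,1)])
    ultimately show ?thesis by linarith
  qed
  have "C a b = (\<Sum>c<m. T a b c *\<^sub>R y c (F p))"
    unfolding T_def using N.orthonormal_expand[OF ad'(3)[OF Fp]] adapted_span_target[OF Fp] Ct assms by simp
  then show ?thesis
    using C T0 assms by simp
qed

lemma sff_linear_left:
  assumes "a < m + k" "u = (\<Sum>b<m + k. c b *\<^sub>R \<epsilon> b p)"
  shows "sff u (\<epsilon> a) = (\<Sum>b<m + k. c b *\<^sub>R sff (\<epsilon> b p) (\<epsilon> a))"
proof -
  have t: "\<epsilon> b p \<in> tangent_space A p" if "b < m + k" for b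
    using fields_along_tangent[OF ad(2)[OF that] p] .
  have lin: "L u = (\<Sum>b<m + k. c b *\<^sub>R L (\<epsilon> b p))"
    if L: "linear_on_subspace (tangent_space A p) L" for L :: "'m tvec \<Rightarrow> 'x::real_vector"
    unfolding assms(2)
    using linear_on_subspace_sum[OF L M.subspace, of "{..<m + k}" "\<lambda>b. c b *\<^sub>R \<epsilon> b p"]
      linear_on_subspaceD(2)[OF L] t M.mem by simp
  show ?thesis
    unfolding sff_def
    using lin[OF connection_along_linear[OF A B F DF ad(1) p adapted_push[OF assms(1)]]]
      lin[OF connection_along_linear[OF A A id DM ad(1) p ad(2)[OF assms(1)]]]
    by (simp add: differential_sum differential_scaleR scaleR_diff_right sum_subtractf)
qed

text \<open>The Leibniz rule produces the terms
  \<open>u (f a) *\<^sub>R dF p (\<epsilon> a p)\<close> from both connections, and these cancel in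
  the difference.\<close>

lemma sff_tensorial:
  assumes Z: "Z \<in> vector_fields A W1" "open W1" "p \<in> W1" and u: "u \<in> tangent_space A p"
  shows "sff u Z = (\<Sum>a<m + k. gM p (Z p) (\<epsilon> a p) *\<^sub>R sff u (\<epsilon> a))"
proof -
  define W2 where "W2 = W \<inter> W1"
  have W2: "open W2" "p \<in> W2" "W2 \<subseteq> W" using ad(1) Z p W2_def by auto
  define f where "f a q = gM q (Z q) (\<epsilon> a q)" for a q
  have Z2: "Z \<in> vector_fields A W2"
    using fields_along_subset[OF Z(1)] W2_def by blast
  have e2: "\<epsilon> a \<in> vector_fields A W2" if "a < m + k" for a
    using fields_along_subset[OF ad(2)[OF that] W2(3)] .
  have p2: "(\<lambda>q. dF q (\<epsilon> a q)) \<in> fields_along A B F W2" if "a < m + k" for a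
    using fields_along_subset[OF adapted_push[OF that] W2(3)] .
  have f: "smooth_fun A W2 (f a)" if "a < m + k" for a
    unfolding f_def using smooth_metric[OF gM W2(1) Z2 e2[OF that]] .
  have Z_eq: "Z q = (\<Sum>a<m + k. f a q *\<^sub>R \<epsilon> a q)" if "q \<in> W2" for q
    unfolding f_def using adapted_expand fields_along_tangent[OF Z2 that] W2(3) that by blast
  have "DM p u Z = DM p u (\<lambda>q. \<Sum>a<m + k. f a q *\<^sub>R \<epsilon> a q)"
    by (rule connection_along_cong[OF A A id DM W2(1,2) u Z2 Z_eq])
  also have "\<dots> = (\<Sum>a<m + k. u (f a) *\<^sub>R \<epsilon> a p + f a p *\<^sub>R DM p u (\<epsilon> a))"
    using connection_along_sum[OF A A id DM W2(1,2) u, of "{..<m + k}" "\<lambda>a q. f a q *\<^sub>R \<epsilon> a q"]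
      fields_along_scaleR[OF A A id W2(1) f e2] connection_along_scaleR[OF A A id DM W2(1,2) u e2 f] by simp
  finally have 1: "DM p u Z = (\<Sum>a<m + k. u (f a) *\<^sub>R \<epsilon> a p + f a p *\<^sub>R DM p u (\<epsilon> a))" .
  have push_eq: "(\<Sum>a<m + k. f a q *\<^sub>R dF q (\<epsilon> a q)) = dF q (Z q)" if "q \<in> W2" for q
    using Z_eq[OF that] by (simp add: differential_sum differential_scaleR)
  have "(\<lambda>q. \<Sum>a<m + k. f a q *\<^sub>R dF q (\<epsilon> a q)) \<in> fields_along A B F W2"
    by (intro fields_along_sum[OF A B F W2(1)] fields_along_scaleR[OF A B F W2(1)] f p2) simp_all
  then have "DF p u (\<lambda>q. dF q (Z q)) = DF p u (\<lambda>q. \<Sum>a<m + k. f a q *\<^sub>R dF q (\<epsilon> a q))"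
    using connection_along_cong[OF A B F DF W2(1,2) u _ push_eq] by simp
  also have "\<dots> = (\<Sum>a<m + k. u (f a) *\<^sub>R dF p (\<epsilon> a p) + f a p *\<^sub>R DF p u (\<lambda>q. dF q (\<epsilon> a q)))"
    using connection_along_sum[OF A B F DF W2(1,2) u, of "{..<m + k}" "\<lambda>a q. f a q *\<^sub>R dF q (\<epsilon> a q)"]
      fields_along_scaleR[OF A B F W2(1) f p2] connection_along_scaleR[OF A B F DF W2(1,2) u p2 f] by simp
  finally show ?thesis
    unfolding sff_def 1 f_def
    by (simp add: differential_sum differential_add differential_scaleR scaleR_diff_right
        sum_subtractf sum.distrib)
qed

text \<open>The pushed-forward field vanishes on a whole neighbourhood, so its derivative along
  \<open>F\<close> is zero.\<close>

lemma sff_vert: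
  assumes "m \<le> a" "a < m + k" "u \<in> tangent_space A p"
  shows "sff u (\<epsilon> a) = - dF p (DM p u (\<epsilon> a))"
proof -
  have "DF p u (\<lambda>q. dF q (\<epsilon> a q)) = DF p u (\<lambda>q. 0)"
    by (rule connection_along_cong[OF A B F DF ad(1) p assms(3) adapted_push[OF assms(2)]])
      (use vertD(2)[OF adapted_vert] assms in auto)
  then show ?thesis
    using connection_along_zero[OF A B F DF ad(1) p assms(3)] by (simp add: sff_def)
qed

lemma trace_second_fundamental_form:
  assumes e: "orthonormal_frame A gM (tangent_space A) W1 n e" and W1: "p \<in> W1"
  shows "(\<Sum>i<n. second_fundamental_form B F DM DF (e i) (e i) p) =
    - dF p (\<Sum>i<k. DM p (\<epsilon> (m + i) p) (\<epsilon> (m + i)))"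
proof -
  note e' = orthonormal_fieldsD[OF orthonormal_fields_frame[OF gM e]]
  have "(\<Sum>i<n. second_fundamental_form B F DM DF (e i) (e i) p) =
      (\<Sum>a<m + k. sff (\<epsilon> a p) (\<epsilon> a))"
  \<comment> \<open>Tensoriality in the second slot and linearity in the first, both expanded in the
    adapted frame, supply the premise of basis independence.\<close>
  proof (rule M.orthonormal_trace[OF ad(3)[OF p] e'(3)[OF W1],
        where \<gamma> = "\<lambda>a b. sff (\<epsilon> a p) (\<epsilon> b)"])
    show "tangent_space A p = span ((\<lambda>i. \<epsilon> i p) ` {..<m + k})"
      using adapted_span[OF p] by simp
    show "tangent_space A p = span ((\<lambda>i. e i p) ` {..<n})"
      using e W1 unfolding orthonormal_frame_def by auto
    fix i assume "i \<in> {..<n}"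
    then have ei: "e i \<in> vector_fields A W1" "e i p \<in> tangent_space A p"
      using e'(2) fields_along_tangent W1 by blast+
    have "second_fundamental_form B F DM DF (e i) (e i) p = sff (e i p) (e i)"
      by (simp add: second_fundamental_form_def sff_def)
    also have "\<dots> = (\<Sum>a<m + k. gM p (e i p) (\<epsilon> a p) *\<^sub>R sff (e i p) (\<epsilon> a))"
      by (rule sff_tensorial[OF ei(1) e'(1) W1 ei(2)])
    also have "\<dots> = (\<Sum>a<m + k. gM p (e i p) (\<epsilon> a p) *\<^sub>R
        (\<Sum>b<m + k. gM p (e i p) (\<epsilon> b p) *\<^sub>R sff (\<epsilon> b p) (\<epsilon> a)))"
      using sff_linear_left[OF _ adapted_expand[OF p ei(2)]] by simp
    also have "\<dots> = (\<Sum>b<m + k. \<Sum>a<m + k. (gM p (e i p) (\<epsilon> b p) * gM p (e i p) (\<epsilon> a p)) *\<^sub>R sff (\<epsilon> b p) (\<epsilon> a))"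
      by (subst sum.swap) (simp add: scaleR_sum_right mult.commute)
    finally show "second_fundamental_form B F DM DF (e i) (e i) p =
        (\<Sum>b<m + k. \<Sum>a<m + k. (gM p (e i p) (\<epsilon> b p) * gM p (e i p) (\<epsilon> a p)) *\<^sub>R sff (\<epsilon> b p) (\<epsilon> a))" .
  qed
  also have "\<dots> = (\<Sum>a<m. sff (\<epsilon> a p) (\<epsilon> a)) + (\<Sum>i<k. sff (\<epsilon> (m + i) p) (\<epsilon> (m + i)))"
    by (rule sum_lessThan_add)
  also have "\<dots> = (\<Sum>i<k. - dF p (DM p (\<epsilon> (m + i) p) (\<epsilon> (m + i))))"
    using sff_hor_zero sff_vert vertD(1)[OF adapted_vert[OF p]] by simp
  finally show ?thesis
    by (simp add: differential_sum sum_negf)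
qed

end

end

end

context submersion
begin

section \<open>The O'Neill tensor on vertical fields and its trace\<close>

lemma sectionsD: "X \<in> sections A E W \<Longrightarrow> X \<in> vector_fields A W"
    "X \<in> sections A E W \<Longrightarrow> q \<in> W \<Longrightarrow> X q \<in> E q"
  unfolding sections_def by auto

text \<open>The tensor is defined by projecting fields before differentiating. For vertical fields
  the projections are the identity and zero throughout \<open>W\<close>, so locality of the
  connection removes them.\<close>

lemma oneill_T_vert:
  assumes W: "open W" "p \<in> W" and X: "X \<in> sections A vert W" and Y: "Y \<in> sections A vert W"
  shows "oneill_T A gM DM B F X Y p = orth_proj (gM p) (hor p) (DM p (X p) Y)"
proof -
  have Xp: "X p \<in> tangent_space A p"
    using vertD(1)[OF sectionsD(2)[OF X W(2)]] .
  have vp: "orth_proj (gM q) (vert q) v = v" if "v \<in> vert q" for v q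
    by (rule M.orth_proj_self[OF subspace_vert _ that]) (use vertD in auto)
  have hp: "orth_proj (gM q) (hor q) v = 0" if "v \<in> vert q" for v q
    by (rule M.orth_proj_eq[OF subspace_hor _ vertD(1)[OF that] subspace_0[OF subspace_hor]])
      (use horD' that in \<open>auto dest: horD(1)\<close>)
  have 1: "DM p (X p) (vert_proj A gM B F Y) = DM p (X p) Y"
    by (rule connection_along_cong[OF A A id DM W Xp sectionsD(1)[OF Y], symmetric])
      (use vp sectionsD(2)[OF Y] in \<open>auto simp: vert_proj_def\<close>)
  \<comment> \<open>The equation is read from the zero field to the projected one because the
    congruence rule wants smoothness of the left field.\<close>
  have "DM p (X p) (\<lambda>q. 0) = DM p (X p) (hor_proj A gM B F Y)"
    by (rule connection_along_cong[OF A A id DM W Xp fields_along_zero[OF A A id W(1)]])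
      (use hp sectionsD(2)[OF Y] in \<open>auto simp: hor_proj_def\<close>)
  then have 2: "DM p (X p) (hor_proj A gM B F Y) = 0"
    using connection_along_zero[OF A A id DM W Xp] by simp
  have "vert_proj A gM B F X p = X p"
    using vp[OF sectionsD(2)[OF X W(2)]] by (simp add: vert_proj_def)
  then show ?thesis
    unfolding oneill_T_def Let_def
    using 1 2 vp[OF subspace_0[OF subspace_vert]] by (simp add: vert_proj_def hor_proj_def)
qed

context
  fixes W k e p
  assumes frame: "orthonormal_frame A gM vert W k e" and p: "p \<in> W"
begin

lemma vertical_frame:
  shows vertical_frame_open: "open W"
    and vertical_frame_section: "i < k \<Longrightarrow> e i \<in> sections A vert W"
    and vertical_frame_span: "span ((\<lambda>i. e i p) ` {..<k}) = vert p"
  using frame p unfolding orthonormal_frame_def by auto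

lemma vertical_frame_vert: "i < k \<Longrightarrow> e i p \<in> vert p"
  using sectionsD(2)[OF vertical_frame_section p] .

lemma vertical_frame_derivative:
  "i < k \<Longrightarrow> v \<in> tangent_space A p \<Longrightarrow> DM p v (e i) \<in> tangent_space A p"
  using connection_along_tangent[OF A A id DM vertical_frame_open p _ sectionsD(1)[OF vertical_frame_section]] .

lemma trace_T_eq:
  "trace_T A gM DM B F k e p = (\<Sum>i<k. orth_proj (gM p) (hor p) (DM p (e i p) (e i)))"
  unfolding trace_T_def
  using oneill_T_vert[OF vertical_frame_open p vertical_frame_section vertical_frame_section] by simp

lemma trace_T_hor: "trace_T A gM DM B F k e p \<in> hor p"
  unfolding trace_T_eq
  by (intro subspace_sum[OF subspace_hor] hor_proj(1) vertical_frame_derivative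
      vertD(1) vertical_frame_vert) simp_all

lemma dF_trace_T: "dF p (trace_T A gM DM B F k e p) = dF p (\<Sum>i<k. DM p (e i p) (e i))"
  unfolding trace_T_eq differential_sum
  by (intro sum.cong refl hor_proj(2) vertical_frame_derivative vertD(1) vertical_frame_vert) simp_all

end

section \<open>Harmonicity in terms of vertical frames\<close>

lemma adapted_frame:
  assumes "adapted W W' y m k \<epsilon>"
  shows "orthonormal_frame A gM (tangent_space A) W (m + k) \<epsilon>"
proof -
  note e = orthonormal_fieldsD[OF adapted_fields(1)[OF assms]]
  show ?thesis
    unfolding orthonormal_frame_def sections_def
    using e(1,2) M.orthonormalD(3)[OF e(3)] adapted_span[OF assms] fields_along_tangent[OF e(2)] by auto
qed

text \<open>A vertical frame given in advance becomes the vertical part of an adapted one. Its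
  length \<open>l\<close> is not assumed to agree with \<open>k\<close>.\<close>

lemma adapted_replace_vertical:
  assumes ad: "adapted W W' y m k \<epsilon>" and e: "orthonormal_frame A gM vert W1 l e"
  shows "adapted (W \<inter> W1) W' y m l (\<lambda>i. if i < m then \<epsilon> i else e (i - m))"
proof -
  let ?\<epsilon> = "\<lambda>i. if i < m then \<epsilon> i else e (i - m)"
  note f = orthonormal_fieldsD[OF adapted_fields(1)[OF ad]]
  note g = orthonormal_fieldsD[OF orthonormal_fields_frame[OF gM e]]
  have vert: "e i q \<in> vert q" if "i < l" "q \<in> W1" for i q
    using vertical_frame_vert[OF e that(2,1)] .
  have "M.orthonormal q {..<m + l} (\<lambda>i. ?\<epsilon> i q)" if q: "q \<in> W \<inter> W1" for q
  proof -
    note fq = M.orthonormalD[OF f(3), of q] and gq = M.orthonormalD[OF g(3), of q]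
    have "gM q (\<epsilon> i q) (e j q) = 0" "gM q (e j q) (\<epsilon> i q) = 0" if "i < m" "j < l" for i j
      using horD(2) horD' adapted_hor[OF ad] vert q that by auto
    then show ?thesis
      unfolding M.orthonormal_def using fq(2,3) gq(2,3) q by auto
  qed
  moreover have "span ((\<lambda>i. ?\<epsilon> i q) ` {..<m + l}) = tangent_space A q" if q: "q \<in> W \<inter> W1" for q
  proof
    let ?S = "span ((\<lambda>i. ?\<epsilon> i q) ` {..<m + l})"
    have "?\<epsilon> i q \<in> tangent_space A q" if "i < m + l" for i
      using horD(1)[OF adapted_hor[OF ad]] vertD(1)[OF vert] q that by auto
    then show "?S \<subseteq> tangent_space A q"
      by (intro span_minimal[OF _ M.subspace]) auto
    have "\<epsilon> i q \<in> ?S" if "i < m" for i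
      using that by (intro span_base image_eqI[of _ _ i]) auto
    then have h: "hor q \<subseteq> ?S"
      using adapted_hor_span[OF ad, of q] span_minimal[OF _ subspace_span, of "(\<lambda>i. \<epsilon> i q) ` {..<m}"] q
      by blast
    have "e i q \<in> ?S" if "i < l" for i
      using that by (intro span_base image_eqI[of _ _ "m + i"]) auto
    then have v: "vert q \<subseteq> ?S"
      using vertical_frame_span[OF e, of q] span_minimal[OF _ subspace_span, of "(\<lambda>i. e i q) ` {..<l}"] q
      by blast
    show "tangent_space A q \<subseteq> ?S"
    proof
      fix v assume "v \<in> tangent_space A q"
      then obtain x y where "x \<in> hor q" "y \<in> vert q" "v = x + y" by (rule decompose)
      then show "v \<in> ?S" using h v span_add by blast
    qed
  qed
  moreover have "open (W \<inter> W1)" using f(1) g(1) by blast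
  moreover have "?\<epsilon> i \<in> vector_fields A (W \<inter> W1)" if "i < m + l" for i
    using fields_along_subset[OF f(2)[of i]] fields_along_subset[OF g(2)[of "i - m"]] that by auto
  ultimately show ?thesis
    using ad vert unfolding adapted_def orthonormal_fields_def by auto
qed

text \<open>From left to right the vertical frame is given, and harmonicity is tested in an adapted
  frame built around it. From right to left the full frame is given, and any adapted frame supplies
  the vertical one.\<close>

lemma harmonic_iff_trace_T:
  "harmonic A gM B F DM DF \<longleftrightarrow>
    (\<forall>W k e. orthonormal_frame A gM vert W k e \<longrightarrow> (\<forall>p\<in>W. trace_T A gM DM B F k e p = 0))"
proof
  assume H: "harmonic A gM B F DM DF"
  show "\<forall>W k e. orthonormal_frame A gM vert W k e \<longrightarrow> (\<forall>p\<in>W. trace_T A gM DM B F k e p = 0)"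
  proof clarify
    fix W1 l e p assume e: "orthonormal_frame A gM vert W1 l e" and p1: "p \<in> W1"
    obtain W W' y m k \<epsilon> where p: "p \<in> W" and ad: "adapted W W' y m k \<epsilon>"
      by (rule adapted_exists)
    define \<delta> where "\<delta> i = (if i < m then \<epsilon> i else e (i - m))" for i
    have ad2: "adapted (W \<inter> W1) W' y m l \<delta>"
      using adapted_replace_vertical[OF ad e] unfolding \<delta>_def .
    have p2: "p \<in> W \<inter> W1" using p p1 by blast
    have "dF p (\<Sum>i<l. DM p (\<delta> (m + i) p) (\<delta> (m + i))) = 0"
      using trace_second_fundamental_form[OF ad2 p2 adapted_frame[OF ad2] p2]
        H[unfolded harmonic_def, rule_format, OF adapted_frame[OF ad2] p2] by simp
    then have "dF p (trace_T A gM DM B F l e p) = 0"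
      using dF_trace_T[OF e p1] by (simp add: \<delta>_def)
    then show "trace_T A gM DM B F l e p = 0"
      by (rule hor_zero[OF trace_T_hor[OF e p1]])
  qed
next
  assume T: "\<forall>W k e. orthonormal_frame A gM vert W k e \<longrightarrow> (\<forall>p\<in>W. trace_T A gM DM B F k e p = 0)"
  show "harmonic A gM B F DM DF"
    unfolding harmonic_def
  proof clarify
    fix W1 n e p assume e: "orthonormal_frame A gM (tangent_space A) W1 n e" and p1: "p \<in> W1"
    obtain W W' y m k \<epsilon> where p: "p \<in> W" and ad: "adapted W W' y m k \<epsilon>"
      by (rule adapted_exists)
    note v = adapted_vertical_frame[OF ad]
    have "trace_T A gM DM B F k (\<lambda>i. \<epsilon> (m + i)) p = 0"
      using T v p by blast
    then have "dF p (\<Sum>i<k. DM p (\<epsilon> (m + i) p) (\<epsilon> (m + i))) = 0"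
      using dF_trace_T[OF v p] by (simp only: differential_zero)
    then show "(\<Sum>i<n. second_fundamental_form B F DM DF (e i) (e i) p) = 0"
      using trace_second_fundamental_form[OF ad p e p1] by simp
  qed
qed


subsection \<open>Parallel complex structures mapping vertical to horizontal vectors\<close>

context
  fixes R :: "'m \<Rightarrow> 'm tvec \<Rightarrow> 'm tvec"
  assumes R: "endomorphism_field A R" and R_parallel: "parallel A DM R"
    and R_square: "\<And>p v. v \<in> tangent_space A p \<Longrightarrow> R p (R p v) = - v"
    and R_isometry: "\<And>p v w. v \<in> tangent_space A p \<Longrightarrow> w \<in> tangent_space A p \<Longrightarrow>
      gM p (R p v) (R p w) = gM p v w"
    and R_vert: "\<And>p v. v \<in> vert p \<Longrightarrow> R p v \<in> hor p"
begin

lemma R_linear: "linear_on_subspace (tangent_space A p) (R p)"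
  and R_tangent: "v \<in> tangent_space A p \<Longrightarrow> R p v \<in> tangent_space A p"
  and R_field: "open W \<Longrightarrow> X \<in> vector_fields A W \<Longrightarrow> (\<lambda>p. R p (X p)) \<in> vector_fields A W"
  using R unfolding endomorphism_field_def by auto

lemma R_derivative:
  assumes "open W" "p \<in> W" "v \<in> tangent_space A p" "Y \<in> vector_fields A W"
  shows "DM p v (\<lambda>q. R q (Y q)) = R p (DM p v Y)"
  using R_parallel[unfolded parallel_def, rule_format, OF assms] by simp

text \<open>This is the isometry property for \<open>v\<close> and \<open>R p w\<close>, combined
  with \<open>R p (R p w) = - w\<close>.\<close>

lemma R_skew:
  assumes "v \<in> tangent_space A p" "w \<in> tangent_space A p"
  shows "gM p (R p v) w = - gM p v (R p w)"
  using R_isometry[OF assms(1) R_tangent[OF assms(2)]] R_square[OF assms(2)]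
    M.minus_right[OF assms(2) R_tangent[OF assms(1)]] by simp

text \<open>The orthogonality of \<open>X\<close> and \<open>R V\<close> is differentiated along
  \<open>X\<close>; this needs both fields to be vertical on a neighbourhood, not only at
  \<open>p\<close>.\<close>

lemma R_derivative_frame:
  assumes W: "open W" "p \<in> W" and X: "X \<in> sections A vert W" and V: "V \<in> sections A vert W"
  shows "gM p (DM p (X p) X) (R p (V p)) = gM p (R p (X p)) (DM p (V p) X)"
proof -
  note Xf = sectionsD(1)[OF X] and Vf = sectionsD(1)[OF V]
  have vert: "X p \<in> vert p" "V p \<in> vert p" using sectionsD(2) X V W by auto
  note t = vert[THEN vertD(1)]
  have Dt: "DM p v Y \<in> tangent_space A p" if "v \<in> tangent_space A p" "Y \<in> vector_fields A W" for v Y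
    using connection_along_tangent[OF A A id DM W that] .
  have "gM q (X q) (R q (V q)) = 0" if "q \<in> W" for q
    using horD'[OF R_vert] sectionsD(2)[OF X that] sectionsD(2)[OF V that] by blast
  then have "X p (\<lambda>q. gM q (X q) (R q (V q))) = X p (\<lambda>q. 0)"
    by (rule tangent_local[OF A t(1) W])
  then have "gM p (DM p (X p) X) (R p (V p)) + gM p (X p) (R p (DM p (X p) V)) = 0"
    using levi_civita_metric[OF LM W t(1) Xf R_field[OF W(1) Vf]] R_derivative[OF W t(1) Vf]
      tangent_const[OF A t(1)] by simp
  then have 1: "gM p (DM p (X p) X) (R p (V p)) = gM p (R p (X p)) (DM p (X p) V)"
    using R_skew[OF t(1) Dt[OF t(1) Vf]] by simp
  \<comment> \<open>Vertical fields are those related to the zero field of the target, so their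
    bracket is related to a bracket of zero fields.\<close>
  have "dF p (lie_bracket A X V p) = lie_bracket B (\<lambda>r. 0) (\<lambda>r. 0) (F p)"
    by (rule lie_bracket_related[OF A B F W open_UNIV])
      (use Xf Vf fields_along_zero[OF B B smooth_map_ident[OF B]] vertD(2)[OF sectionsD(2)[OF X]]
        vertD(2)[OF sectionsD(2)[OF V]] in auto)
  also have "\<dots> = 0"
    by (simp add: lie_bracket_def fun_eq_iff)
  finally have "DM p (X p) V - DM p (V p) X \<in> vert p"
    using levi_civita_torsion[OF LM W Xf Vf] M.mem(4)[OF Dt[OF t(1) Vf] Dt[OF t(2) Xf]]
    by (simp add: ker_diff_def)
  then have "gM p (DM p (X p) V - DM p (V p) X) (R p (X p)) = 0"
    by (rule horD'[OF R_vert[OF vert(1)]])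
  then have "gM p (R p (X p)) (DM p (X p) V) = gM p (R p (X p)) (DM p (V p) X)"
    using M.diff_left[OF Dt[OF t(1) Vf] Dt[OF t(2) Xf] R_tangent[OF t(1)]]
      M.sym[OF R_tangent[OF t(1)] Dt] t Vf Xf by simp
  then show ?thesis using 1 by simp
qed

text \<open>On the left the frame fields are differentiated along \<open>V\<close>, on the right
  along themselves; \<open>R_derivative_frame\<close> exchanges the two, and the sign is that of
  skewness.\<close>

lemma trace_RT_eq:
  assumes frame: "orthonormal_frame A gM vert W k e" and p: "p \<in> W" and V: "V \<in> sections A vert W"
  shows "trace_RT A gM DM B F R V k e p = - gM p (trace_T A gM DM B F k e p) (R p (V p))"
proof -
  note W = vertical_frame_open[OF frame p]
  have Vv: "V p \<in> vert p" using sectionsD(2)[OF V p] .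
  let ?h = "orth_proj (gM p) (hor p)"
  have "gM p (R p (oneill_T A gM DM B F V (e i) p)) (e i p) = - gM p (?h (DM p (e i p) (e i))) (R p (V p))"
    if i: "i < k" for i
  proof -
    note ei = vertical_frame_section[OF frame p i]
    have v: "e i p \<in> vert p" using vertical_frame_vert[OF frame p i] .
    have Dt: "DM p v (e i) \<in> tangent_space A p" if "v \<in> vert p" for v
      using vertical_frame_derivative[OF frame p i vertD(1)[OF that]] .
    have ht: "?h (DM p v (e i)) \<in> tangent_space A p" if "v \<in> vert p" for v
      using horD(1)[OF hor_proj(1)[OF Dt[OF that]]] .
    have "gM p (R p (oneill_T A gM DM B F V (e i) p)) (e i p) = gM p (R p (?h (DM p (V p) (e i)))) (e i p)"
      using oneill_T_vert[OF W p V ei] by simp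
    also have "\<dots> = - gM p (R p (e i p)) (?h (DM p (V p) (e i)))"
      using R_skew[OF ht[OF Vv] vertD(1)[OF v]] M.sym[OF ht[OF Vv] R_tangent[OF vertD(1)[OF v]]] by simp
    \<comment> \<open>The projection may be dropped, since the other factor is horizontal; it is
      restored in the same way after the exchange.\<close>
    also have "\<dots> = - gM p (R p (e i p)) (DM p (V p) (e i))"
      using hor_proj(3)[OF Dt[OF Vv] R_vert[OF v]] by simp
    also have "\<dots> = - gM p (DM p (e i p) (e i)) (R p (V p))"
      using R_derivative_frame[OF W p ei V] by simp
    also have "\<dots> = - gM p (?h (DM p (e i p) (e i))) (R p (V p))"
      using hor_proj(3)[OF Dt[OF v] R_vert[OF Vv]] M.sym[OF Dt[OF v] R_tangent[OF vertD(1)[OF Vv]]]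
        M.sym[OF ht[OF v] R_tangent[OF vertD(1)[OF Vv]]] by simp
    finally show ?thesis .
  qed
  then have "trace_RT A gM DM B F R V k e p = (\<Sum>i<k. - gM p (?h (DM p (e i p) (e i))) (R p (V p)))"
    unfolding trace_RT_def by simp
  also have "\<dots> = - (\<Sum>i<k. gM p (?h (DM p (e i p) (e i))) (R p (V p)))"
    by (simp add: sum_negf)
  also have "\<dots> = - gM p (\<Sum>i<k. ?h (DM p (e i p) (e i))) (R p (V p))"
    by (subst M.sum_left)
      (auto intro!: horD(1)[OF hor_proj(1)] vertical_frame_derivative[OF frame p] R_tangent
        vertD(1)[OF Vv] vertD(1)[OF vertical_frame_vert[OF frame p]])
  finally show ?thesis
    unfolding trace_T_eq[OF frame p] .
qed

section \<open>The complement of the rotated vertical space and its projection\<close>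

lemma subspace_mu: "subspace (mu_space A gM B F R p)"
  unfolding mu_space_def
  by (rule M.subspace_orth_compl[OF subspace_hor]) (use horD(1) R_vert in auto)

lemma mu_hor: "u \<in> mu_space A gM B F R p \<Longrightarrow> u \<in> hor p"
  by (simp add: mu_space_def orth_compl_def)

text \<open>As \<open>R\<close> is isometric, it carries the vertical frame to an orthonormal basis
  of the image of the vertical space, whose components are removed. The formula also shows that the
  projection exists, which its definition by a definite description leaves open.\<close>

lemma Q_proj_eq:
  assumes frame: "orthonormal_frame A gM vert W k e" and p: "p \<in> W" and x: "x \<in> hor p"
  shows "Q_proj A gM B F R p x = x - (\<Sum>i<k. gM p x (R p (e i p)) *\<^sub>R R p (e i p))"
proof -
  define w where "w = (\<Sum>i<k. gM p x (R p (e i p)) *\<^sub>R R p (e i p))"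
  note v = vertical_frame_vert[OF frame p]
  note t = vertD(1)[OF v]
  have o: "M.orthonormal p {..<k} (\<lambda>i. R p (e i p))"
    unfolding M.orthonormal_def
    using R_tangent[OF t] R_isometry[OF t t] frame p unfolding orthonormal_frame_def by auto
  have w: "w \<in> hor p"
    unfolding w_def by (intro subspace_sum[OF subspace_hor] subspace_scale[OF subspace_hor] R_vert v) simp
  have Rv: "R p z = (\<Sum>i<k. gM p z (e i p) *\<^sub>R R p (e i p))" if z: "z \<in> vert p" for z
  proof -
    have "z = (\<Sum>i<k. gM p z (e i p) *\<^sub>R e i p)"
      using M.orthonormal_expand[OF orthonormal_fieldsD(3)[OF orthonormal_fields_frame[OF gM frame] p]]
        vertical_frame_span[OF frame p] z by blast
    then have "R p z = R p (\<Sum>i<k. gM p z (e i p) *\<^sub>R e i p)" by simp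
    also have "\<dots> = (\<Sum>i<k. R p (gM p z (e i p) *\<^sub>R e i p))"
      by (rule linear_on_subspace_sum[OF R_linear M.subspace]) (use t M.mem in auto)
    also have "\<dots> = (\<Sum>i<k. gM p z (e i p) *\<^sub>R R p (e i p))"
      by (intro sum.cong refl linear_on_subspaceD(2)[OF R_linear] t) simp
    finally show ?thesis .
  qed
  have "gM p (x - w) (R p z) = 0" if z: "z \<in> vert p" for z
    unfolding w_def
    by (rule M.orthonormal_residual[OF o horD(1)[OF x]], subst Rv[OF z])
      (intro span_sum span_scale span_base imageI)
  then have mu: "x - w \<in> mu_space A gM B F R p"
    using subspace_diff[OF subspace_hor x w] by (auto simp: mu_space_def orth_compl_def)
  have "orth_proj (gM p) (mu_space A gM B F R p) x = x - w"
  proof (rule M.orth_proj_eq[OF subspace_mu _ horD(1)[OF x] mu])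
    show "mu_space A gM B F R p \<subseteq> tangent_space A p" using mu_hor horD(1) by blast
    fix u assume u: "u \<in> mu_space A gM B F R p"
    then have "gM p (R p (e i p)) u = 0" if "i < k" for i
      using v[OF that] M.sym[OF horD(1)[OF mu_hor[OF u]] R_tangent[OF t[OF that]]]
      by (auto simp: mu_space_def orth_compl_def)
    then have "gM p w u = 0"
      unfolding w_def using R_tangent[OF t] horD(1)[OF mu_hor[OF u]]
      by (subst M.sum_left) (auto simp: M.scale_left M.mem(3))
    then show "gM p (x - (x - w)) u = 0" by simp
  qed
  then show ?thesis
    by (simp add: Q_proj_def w_def)
qed

lemma harmonic_iff_anti_invariant:
  "harmonic A gM B F DM DF \<longleftrightarrow>
    Q_trace_T_vanishes A gM DM B F R \<and> (\<forall>V\<in>sections A vert UNIV. trace_RT_vanishes A gM DM B F R V)"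
proof
  assume "harmonic A gM B F DM DF"
  then have T: "trace_T A gM DM B F k e p = 0" if "orthonormal_frame A gM vert W k e" "p \<in> W" for W k e p
    using harmonic_iff_trace_T that by blast
  have "Q_proj A gM B F R p 0 = 0" for p
    unfolding Q_proj_def
    by (rule M.orth_proj_self[OF subspace_mu _ subspace_0[OF subspace_mu]]) (use mu_hor horD(1) in blast)
  then have "Q_trace_T_vanishes A gM DM B F R"
    unfolding Q_trace_T_vanishes_def using T by metis
  moreover have "trace_RT_vanishes A gM DM B F R V" if V: "V \<in> sections A vert UNIV" for V
    unfolding trace_RT_vanishes_def
  proof clarify
    fix W k e p assume e: "orthonormal_frame A gM vert W k e" "p \<in> W"
    have VW: "V \<in> sections A vert W"
      using V fields_along_subset[OF sectionsD(1)[OF V], of W] by (auto simp: sections_def)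
    have "R p (V p) \<in> tangent_space A p"
      using R_tangent[OF vertD(1)] sectionsD(2)[OF V] by blast
    then show "trace_RT A gM DM B F R V k e p = 0"
      using trace_RT_eq[OF e VW] T[OF e] M.zero_left by simp
  qed
  ultimately show "Q_trace_T_vanishes A gM DM B F R \<and>
      (\<forall>V\<in>sections A vert UNIV. trace_RT_vanishes A gM DM B F R V)" by blast
next
  assume H: "Q_trace_T_vanishes A gM DM B F R \<and> (\<forall>V\<in>sections A vert UNIV. trace_RT_vanishes A gM DM B F R V)"
  show "harmonic A gM B F DM DF"
    unfolding harmonic_iff_trace_T
  proof clarify
    fix W k e p assume e: "orthonormal_frame A gM vert W k e" "p \<in> W"
    let ?\<tau> = "trace_T A gM DM B F k e p"
    have "gM p ?\<tau> (R p (e i p)) = 0" if i: "i < k" for i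
    proof -
      note ei = vertical_frame_section[OF e i]
      \<comment> \<open>The hypothesis speaks of global vertical fields, while \<open>e i\<close>
        lives on \<open>W\<close> only. The cut-off field is a multiple of \<open>e i\<close> on
        \<open>W\<close> and zero elsewhere, hence vertical everywhere, and at \<open>p\<close> the
        factor \<open>c\<close> can be divided out.\<close>
      obtain V c where V: "V \<in> vector_fields A UNIV" "\<And>q. q \<notin> W \<Longrightarrow> V q = 0"
        "\<And>q. q \<in> W \<Longrightarrow> \<exists>c. V q = c *\<^sub>R e i q" and c: "c \<noteq> 0" "V p = c *\<^sub>R e i p"
        using global_field_exists[OF A vertical_frame_open[OF e] e(2) sectionsD(1)[OF ei]] by blast
      have "V q \<in> vert q" for q
        using V(2,3)[of q] sectionsD(2)[OF ei, of q] subspace_0[OF subspace_vert]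
          subspace_scale[OF subspace_vert] by (cases "q \<in> W") auto
      then have Vs: "V \<in> sections A vert UNIV" "V \<in> sections A vert W"
        using V(1) fields_along_subset[OF V(1), of W] by (auto simp: sections_def)
      have t: "e i p \<in> tangent_space A p" using vertD(1)[OF vertical_frame_vert[OF e i]] .
      have 0: "gM p ?\<tau> (R p (V p)) = 0"
        using trace_RT_eq[OF e Vs(2)] H Vs(1) e unfolding trace_RT_vanishes_def by force
      have "R p (V p) = c *\<^sub>R R p (e i p)"
        unfolding c(2) by (rule linear_on_subspaceD(2)[OF R_linear t])
      then have "c * gM p ?\<tau> (R p (e i p)) = 0"
        using 0 M.scale_right[OF R_tangent[OF t] horD(1)[OF trace_T_hor[OF e]], of c] by metis
      then show ?thesis using c(1) by simp
    qed
    \<comment> \<open>With all components along \<open>R p (e i p)\<close> gone, the trace lies in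
      the complement already, so the projection fixes it.\<close>
    then have "Q_proj A gM B F R p ?\<tau> = ?\<tau>"
      using Q_proj_eq[OF e trace_T_hor[OF e]] by simp
    then show "?\<tau> = 0"
      using H e unfolding Q_trace_T_vanishes_def by metis
  qed
qed

end

end

theorem theorem3p17:
  fixes A :: "('m::{t2_space, second_countable_topology}, 'e::euclidean_space) atlas"
    and B :: "('n::{t2_space, second_countable_topology}, 'f::euclidean_space) atlas"
    and gM :: "'m metric" and gN :: "'n metric"
    and I J K :: "'m \<Rightarrow> 'm tvec \<Rightarrow> 'm tvec"
    and F :: "'m \<Rightarrow> 'n"
    and DM :: "('m, 'm) connection" and DN :: "('n, 'n) connection"
    and DF :: "('m, 'n) connection"
  assumes M: "hyperkaehler A gM DM I J K"
    and N: "riemannian_manifold B gN" "levi_civita B gN DN"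
    and DF: "pullback_connection A B F DN DF"
    and F: "h_anti_invariant_submersion A gM I J K B gN F"
  shows "(harmonic A gM B F DM DF \<longleftrightarrow>
          Q_trace_T_vanishes A gM DM B F I \<and>
          (\<forall>V\<in>sections A (ker_diff A B F) UNIV. trace_RT_vanishes A gM DM B F I V)) \<and>
         (harmonic A gM B F DM DF \<longleftrightarrow>
          Q_trace_T_vanishes A gM DM B F J \<and>
          (\<forall>V\<in>sections A (ker_diff A B F) UNIV. trace_RT_vanishes A gM DM B F J V)) \<and>
         (harmonic A gM B F DM DF \<longleftrightarrow>
          Q_trace_T_vanishes A gM DM B F K \<and>
          (\<forall>V\<in>sections A (ker_diff A B F) UNIV. trace_RT_vanishes A gM DM B F K V))"
proof -
  interpret submersion A B gM gN F DM DN DF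
    using M N DF F unfolding submersion_def hyperkaehler_def h_anti_invariant_submersion_def by blast
  \<comment> \<open>Harmonicity is the hub: its equivalence with the condition for each single
    \<open>R\<close> makes all four conditions equivalent.\<close>
  have "harmonic A gM B F DM DF \<longleftrightarrow> Q_trace_T_vanishes A gM DM B F R \<and>
      (\<forall>V\<in>sections A vert UNIV. trace_RT_vanishes A gM DM B F R V)" if R: "R \<in> {I, J, K}" for R
  proof (rule harmonic_iff_anti_invariant)
    have RM: "endomorphism_field A R \<and> parallel A DM R \<and>
        (\<forall>p. \<forall>v\<in>tangent_space A p. R p (R p v) = - v) \<and>
        (\<forall>p. \<forall>v\<in>tangent_space A p. \<forall>w\<in>tangent_space A p. gM p (R p v) (R p w) = gM p v w)"
      using M R unfolding hyperkaehler_def by blast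
    then show "endomorphism_field A R" "parallel A DM R"
      "\<And>p v. v \<in> tangent_space A p \<Longrightarrow> R p (R p v) = - v"
      "\<And>p v w. v \<in> tangent_space A p \<Longrightarrow> w \<in> tangent_space A p \<Longrightarrow> gM p (R p v) (R p w) = gM p v w"
      by simp_all
    show "R p v \<in> hor p" if "v \<in> vert p" for p v
      using assms(5) R that unfolding h_anti_invariant_submersion_def by blast
  qed
  then show ?thesis by simp
qed

end
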